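(* Let $U, V, W\in L^\infty(\mathbb{R})$ be real-valued compactly supported functions, and for $\varepsilon>0$ let $$\mathcal{H}_\varepsilon = -\frac{d^2}{dx^2} + W(x) + \varepsilon^{-1} U(\varepsilon^{-1}x) + \varepsilon^{-2} V(\varepsilon^{-1}x), \qquad \operatorname{dom}\mathcal{H}_\varepsilon = W_2^2(\mathbb{R}).$$ Assume that $V$ is resonant with a (real-valued) half-bound state $v$ having limits $v_\pm=\lim_{x\to\pm\infty}v(x)$, and that the potentials $W$ and $U$ satisfy the conditions $W\ge0$ and $$\int_0^{+\infty}\big(v_-^2W(-x)+v_+^2W(x)\big)\,dx < -\frac12\int_{\mathbb{R}}Uv^2\,dx.$$ Then, for $\varepsilon$ small enough, the operator $\mathcal{H}_\varepsilon$ has a negative eigenvalue $\lambda_\varepsilon$ converging, as $\varepsilon\to0$, to the negative eigenvalue of the operator $$\mathcal{H}=-\frac{d^2}{dx^2}+W,\qquad \operatorname{dom}\mathcal{H}=\{\phi\in W_2^2(\mathbb{R}\setminus\{0\}) : \phi(+0)=\theta\phi(-0),\ \phi'(+0)=\theta^{-1}\phi'(-0)+\eta\phi(-0)\},$$ where $$\theta=\frac{v_+}{v_-},\qquad \eta=\frac{1}{v_-v_+}\int_{\mathbb{R}}Uv^2\,dx.$$ If $W=0$ and $\int_{\mathbb{R}}Uv^2\,dx<0$, then this eigenvalue $\lambda_\varepsilon$ has asymptotics $$\lambda_\varepsilon = -\frac{1}{(v_-^2+v_+^2)^2}\left(\int_{\mathbb{R}}Uv^2\,dx\right)^2+O(\varepsilon),\qquad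 \varepsilon\to0.$$
   Context: $W_2^2$ denotes the $L^2$-based Sobolev space of order 2; operators act in $L^2(\mathbb{R})$, and $\mathcal{H}\phi=-\phi''+W\phi$ on $\mathbb{R}\setminus\{0\}$. $\phi(\pm0)$, $\phi'(\pm0)$ are one-sided limits at the origin. The potential $V$ is called resonant if the equation $v''=Vv$ admits a nontrivial solution $v$ bounded on the entire real line; such a solution is called a half-bound state. Every half-bound state has finite, nonzero limits $v_\pm$ at $\pm\infty$. Under the stated hypotheses the operator $\mathcal{H}$ has a unique negative eigenvalue. *)

theory Defs
  imports "HOL-Analysis.Analysis" "HOL-Library.Landau_Symbols"
begin

text \<open>Measurability, integrals and null sets refer to Lebesgue measure on the real line.
  Elements of \<open>L\<^sup>2\<close> and \<open>L\<^sup>\<infinity>\<close> are represented by functions, and every notion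
  below depends on them only up to a.e. equality, except that a half-bound state is its continuous
  representative.\<close>

definition compactly_supported_Linf :: "(real \<Rightarrow> real) \<Rightarrow> bool" where
  "compactly_supported_Linf f \<longleftrightarrow>
     f \<in> borel_measurable lebesgue \<and>
     (\<exists>C. AE x in lebesgue. \<bar>f x\<bar> \<le> C) \<and>
     (\<exists>R. AE x in lebesgue. \<bar>x\<bar> > R \<longrightarrow> f x = 0)"

definition square_integrable_on :: "real set \<Rightarrow> (real \<Rightarrow> complex) \<Rightarrow> bool" where
  "square_integrable_on \<Omega> \<phi> \<longleftrightarrow>
     set_borel_measurable lebesgue \<Omega> \<phi> \<and> set_integrable lebesgue \<Omega> (\<lambda>x. (cmod (\<phi> x))\<^sup>2)"

definition test_function :: "real set \<Rightarrow> (real \<Rightarrow> real) \<Rightarrow> bool" where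
  "test_function \<Omega> \<psi> \<longleftrightarrow>
     (\<forall>k x. ((deriv ^^ k) \<psi>) field_differentiable (at x)) \<and>
     compact (closure {x. \<psi> x \<noteq> 0}) \<and> closure {x. \<psi> x \<noteq> 0} \<subseteq> \<Omega>"

definition locally_integrable_on ::
    "real set \<Rightarrow> (real \<Rightarrow> 'a::{banach, second_countable_topology}) \<Rightarrow> bool" where
  "locally_integrable_on \<Omega> \<phi> \<longleftrightarrow> (\<forall>K. compact K \<and> K \<subseteq> \<Omega> \<longrightarrow> set_integrable lebesgue K \<phi>)"

text \<open>\<open>g\<close> is the distributional derivative of \<open>\<phi>\<close> on the open set \<open>\<Omega>\<close>.
  Real test functions suffice for complex-valued \<open>\<phi>\<close>, by linearity.\<close>

definition weak_derivative_on ::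
    "real set \<Rightarrow> (real \<Rightarrow> 'a::{banach, second_countable_topology}) \<Rightarrow> (real \<Rightarrow> 'a) \<Rightarrow> bool" where
  "weak_derivative_on \<Omega> \<phi> g \<longleftrightarrow>
     locally_integrable_on \<Omega> \<phi> \<and> locally_integrable_on \<Omega> g \<and>
     (\<forall>\<psi>. test_function \<Omega> \<psi> \<longrightarrow>
        (LINT x|lebesgue. deriv \<psi> x *\<^sub>R \<phi> x) = - (LINT x|lebesgue. \<psi> x *\<^sub>R g x))"

definition sobolev_2_2 :: "real set \<Rightarrow> (real \<Rightarrow> complex) set" where
  "sobolev_2_2 \<Omega> = {\<phi>. \<exists>g h.
     weak_derivative_on \<Omega> \<phi> g \<and> weak_derivative_on \<Omega> g h \<and>
     square_integrable_on \<Omega> \<phi> \<and> square_integrable_on \<Omega> g \<and> square_integrable_on \<Omega> h}"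

text \<open>An operator in \<open>L\<^sup>2(\<real>)\<close> is given by its graph. The set \<open>\<Omega>\<close> where the derivatives are
  taken is the whole line or the line without the origin, hence of full measure.\<close>

type_synonym L2_operator = "((real \<Rightarrow> complex) \<times> (real \<Rightarrow> complex)) set"

definition schrodinger_operator ::
    "real set \<Rightarrow> (real \<Rightarrow> real) \<Rightarrow> (real \<Rightarrow> complex) set \<Rightarrow> L2_operator" where
  "schrodinger_operator \<Omega> q D = {(\<phi>, f). \<phi> \<in> D \<and>
     (\<exists>g h. weak_derivative_on \<Omega> \<phi> g \<and> weak_derivative_on \<Omega> g h \<and>
        (AE x in lebesgue. f x = - h x + complex_of_real (q x) * \<phi> x))}"

definition is_eigenvalue :: "L2_operator \<Rightarrow> complex \<Rightarrow> bool" where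
  "is_eigenvalue T z \<longleftrightarrow>
     (\<exists>\<phi> f. (\<phi>, f) \<in> T \<and> \<not> (AE x in lebesgue. \<phi> x = 0) \<and> (AE x in lebesgue. f x = z * \<phi> x))"

definition negative_eigenvalue :: "L2_operator \<Rightarrow> real \<Rightarrow> bool" where
  "negative_eigenvalue T \<mu> \<longleftrightarrow> \<mu> < 0 \<and> is_eigenvalue T (complex_of_real \<mu>)"

definition H_eps ::
    "(real \<Rightarrow> real) \<Rightarrow> (real \<Rightarrow> real) \<Rightarrow> (real \<Rightarrow> real) \<Rightarrow> real \<Rightarrow> L2_operator" where
  "H_eps U V W \<epsilon> =
     schrodinger_operator UNIV (\<lambda>x. W x + U (x / \<epsilon>) / \<epsilon> + V (x / \<epsilon>) / \<epsilon>\<^sup>2) (sobolev_2_2 UNIV)"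

text \<open>The one-sided limits at the origin are those of the representative \<open>u\<close> of \<open>\<phi>\<close> that is
  continuously differentiable off the origin, and of its derivative \<open>u'\<close>.\<close>

definition interface_domain :: "real \<Rightarrow> real \<Rightarrow> (real \<Rightarrow> complex) set" where
  "interface_domain \<theta> \<eta> = {\<phi> \<in> sobolev_2_2 (- {0}).
     \<exists>u u' a b a' b'. (AE x in lebesgue. \<phi> x = u x) \<and>
       (\<forall>x. x \<noteq> 0 \<longrightarrow> (u has_vector_derivative u' x) (at x)) \<and> continuous_on (- {0}) u' \<and>
       (u \<longlongrightarrow> a) (at_left 0) \<and> (u \<longlongrightarrow> b) (at_right 0) \<and>
       (u' \<longlongrightarrow> a') (at_left 0) \<and> (u' \<longlongrightarrow> b') (at_right 0) \<and>
       b = complex_of_real \<theta> * a \<and>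
       b' = complex_of_real (inverse \<theta>) * a' + complex_of_real \<eta> * a}"

definition H_interface :: "(real \<Rightarrow> real) \<Rightarrow> real \<Rightarrow> real \<Rightarrow> L2_operator" where
  "H_interface W \<theta> \<eta> = schrodinger_operator (- {0}) W (interface_domain \<theta> \<eta>)"

text \<open>Since \<open>V\<close> is merely bounded and measurable, \<open>v'' = V v\<close> is understood in the weak sense,
  for the continuous representative \<open>v\<close>.\<close>

definition half_bound_state :: "(real \<Rightarrow> real) \<Rightarrow> (real \<Rightarrow> real) \<Rightarrow> bool" where
  "half_bound_state V v \<longleftrightarrow>
     continuous_on UNIV v \<and>
     (\<exists>g. weak_derivative_on UNIV v g \<and> weak_derivative_on UNIV g (\<lambda>x. V x * v x)) \<and>
     (\<exists>x. v x \<noteq> 0) \<and> bounded (range v)"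

definition resonant :: "(real \<Rightarrow> real) \<Rightarrow> bool" where
  "resonant V \<longleftrightarrow> (\<exists>v. half_bound_state V v)"

end

theory Submission
  imports Defs
begin

text \<open>
  All potentials have compact support, so \<open>- k\<^sup>2\<close> with \<open>k > 0\<close> is an eigenvalue exactly when the
  solution of \<open>y'' = (q + k\<^sup>2) y\<close> that decays at \<open>-\<infinity>\<close>, continued across the origin by the interface
  conditions if there are any, also decays at \<open>+\<infinity>\<close>. For each operator this is one scalar equation
  for \<open>k\<close>, and the theorem compares two such equations.

  For the interface operator, let \<open>m\<^sub>-(k)\<close> and \<open>m\<^sub>+(k)\<close> be the logarithmic derivatives at the origin
  of the solutions for \<open>W\<close> that decay to the left and, after reflection, to the right. The
  interface conditions amount to
  \<open>secular k = m\<^sub>-(k) + \<theta>\<^sup>2 m\<^sub>+(k) + \<theta> \<eta> = 0\<close> (\<open>interface_eigenvalue_iff\<close>). Since \<open>W \<ge> 0\<close>, a Sturm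
  comparison makes \<open>m\<^sub>\<plusminus>\<close> increase in \<open>k\<close> with slope bounded below
  (\<open>jost_log_derivative_mono\<close>). Moreover \<open>m\<^sub>-(0)\<close> and \<open>m\<^sub>+(0)\<close> are at most the integrals of \<open>W\<close>
  over the two half-lines, so the hypothesis makes \<open>secular 0\<close> negative, while \<open>m\<^sub>\<plusminus>(k) \<ge> k\<close> makes
  \<open>secular\<close> nonnegative at \<open>- \<theta> \<eta>\<close>. Hence there is exactly one root \<open>k\<^sub>0\<close> (\<open>secular_root\<close>), and the
  negative eigenvalue is \<open>- k\<^sub>0\<^sup>2\<close>. For \<open>W = 0\<close> one has \<open>m\<^sub>\<plusminus>(k) = k\<close>, which gives
  \<open>k\<^sub>0 = - (v\<^sub>-\<^sup>2 + v\<^sub>+\<^sup>2)\<^sup>-\<^sup>1 \<integral> U v\<^sup>2\<close>.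

  For the scaled operator, let \<open>shot \<epsilon> k\<close> be the coefficient that measures the failure to decay at
  \<open>+\<infinity>\<close>. Outside \<open>[- \<epsilon> R, \<epsilon> R]\<close> the solution is governed by \<open>W\<close> alone. Inside, \<open>w t = y (\<epsilon> t)\<close>
  solves \<open>w'' = (V + O(\<epsilon>)) w\<close> and enters with slope \<open>O(\<epsilon>)\<close>; by Gronwall's inequality it is a multiple
  of the half-bound state \<open>v\<close> up to \<open>O(\<epsilon>)\<close>. Its slope on exit is itself of order \<open>\<epsilon>\<close> and is needed to
  leading order; the Wronskian of \<open>w\<close> and \<open>v\<close> provides it, since this Wronskian grows by
  \<open>\<epsilon> \<integral> U w v + O(\<epsilon>\<^sup>2)\<close> and \<open>v'\<close> vanishes at both ends. The outcome is
  \<open>\<theta> \<cdot> shot \<epsilon> k = secular k \<cdot> jost k 0 \<cdot> mirror.jost k 0 + O(\<epsilon>)\<close>, uniformly for bounded \<open>k\<close>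
  (\<open>shot_asymptotics\<close>). As \<open>secular\<close> crosses zero at \<open>k\<^sub>0\<close> with slope bounded below, the
  intermediate value theorem gives a zero of \<open>shot \<epsilon>\<close> within \<open>O(\<epsilon>)\<close> of \<open>k\<^sub>0\<close>
  (\<open>eigenvalue_near_root\<close>). This yields the convergence and, for \<open>W = 0\<close>, the error term.

  The other lemmas pass between distributional equations in \<open>L\<^sup>2\<close> and these differential equations:
  primitives have weak derivatives (\<open>weak_derivative_on_glued\<close>), continuous functions are
  primitives of their weak derivatives (\<open>weak_derivative_on_integral\<close>), and a function with zero
  weak derivative has constant averages (\<open>weak_derivative_zero_average\<close>).
\<close>

section \<open>Linear second-order equations with a bounded measurable coefficient\<close>

lemma DERIV_compose_affine:
  fixes f :: "real \<Rightarrow> real"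
  assumes "(f has_real_derivative D) (at (m * x + c))"
  shows "((\<lambda>x. f (m * x + c)) has_real_derivative m * D) (at x)"
proof -
  have "((\<lambda>x. m * x + c) has_real_derivative m) (at x)" by (auto intro!: derivative_eq_intros)
  from DERIV_chain2[where f=f and g="\<lambda>x. m * x + c", OF assms this] show ?thesis
    by (simp add: mult.commute)
qed

lemma integral_continuous_mult_integrable:
  fixes f G :: "real \<Rightarrow> real"
  assumes "f integrable_on {a..b}" and "\<And>t. t \<in> {a..b} \<Longrightarrow> \<bar>f t\<bar> \<le> M"
    and "continuous_on {a..b} G"
  shows "(\<lambda>t. f t * G t) integrable_on {a..b}"
proof -
  have f: "f absolutely_integrable_on {a..b}"
    by (rule absolutely_integrable_integrable_bound[where g="\<lambda>_. M"]) (use assms in auto)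
  have "(\<lambda>t. G t * f t) absolutely_integrable_on {a..b}"
  proof (rule absolutely_integrable_bounded_measurable_product_real)
    show "G \<in> borel_measurable (lebesgue_on {a..b})"
      using assms(3) by (rule continuous_imp_measurable_on_sets_lebesgue) auto
    show "bounded (G ` {a..b})"
      using assms(3) compact_Icc compact_continuous_image compact_imp_bounded by blast
  qed (use f in auto)
  then have "(\<lambda>t. G t * f t) integrable_on {a..b}"
    using set_lebesgue_integral_eq_integral(1) by blast
  then show ?thesis by (simp add: mult.commute)
qed

lemma primitive_lipschitz:
  fixes F f :: "real \<Rightarrow> real"
  assumes "\<And>c d. a \<le> c \<Longrightarrow> c \<le> d \<Longrightarrow> d \<le> b \<Longrightarrow> (f has_integral F d - F c) {c..d}"
    and "\<And>t. t \<in> {a..b} \<Longrightarrow> \<bar>f t\<bar> \<le> M" and "a \<le> b"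
    and "x \<in> {a..b}" "y \<in> {a..b}"
  shows "\<bar>F y - F x\<bar> \<le> M * \<bar>y - x\<bar>"
proof -
  have M: "M \<ge> 0" using assms(2)[of a] assms(3) by force
  have *: "\<bar>F d - F c\<bar> \<le> M * \<bar>d - c\<bar>" if "a \<le> c" "c \<le> d" "d \<le> b" for c d
  proof -
    have "norm (F d - F c) \<le> M * measure lborel {c..d}"
      by (rule has_integral_bound_real[where f=f and S="{}"]) (use M assms that in auto)
    then show ?thesis using that by simp
  qed
  show ?thesis
    using *[of x y] *[of y x] assms(4,5) by (cases "x \<le> y") (auto simp: abs_minus_commute)
qed

text \<open>For bounded densities both primitives are Lipschitz, so over \<open>[c, d]\<close> the quantity
  \<open>F G - \<integral> (f G + F g)\<close> changes by at most a constant times \<open>(d - c)\<^sup>2\<close>. Its derivative therefore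
  vanishes and it is constant.\<close>
lemma product_rule_integral:
  fixes F G f g :: "real \<Rightarrow> real"
  assumes F: "\<And>c d. a \<le> c \<Longrightarrow> c \<le> d \<Longrightarrow> d \<le> b \<Longrightarrow> (f has_integral F d - F c) {c..d}"
    and G: "\<And>c d. a \<le> c \<Longrightarrow> c \<le> d \<Longrightarrow> d \<le> b \<Longrightarrow> (g has_integral G d - G c) {c..d}"
    and f: "\<And>t. t \<in> {a..b} \<Longrightarrow> \<bar>f t\<bar> \<le> M" and g: "\<And>t. t \<in> {a..b} \<Longrightarrow> \<bar>g t\<bar> \<le> N"
    and ab: "a \<le> b"
  shows "((\<lambda>t. f t * G t + F t * g t) has_integral F b * G b - F a * G a) {a..b}"
proof -
  have lF: "\<bar>F y - F x\<bar> \<le> M * \<bar>y - x\<bar>" if "x \<in> {a..b}" "y \<in> {a..b}" for x y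
    using primitive_lipschitz[OF F f ab that] .
  have lG: "\<bar>G y - G x\<bar> \<le> N * \<bar>y - x\<bar>" if "x \<in> {a..b}" "y \<in> {a..b}" for x y
    using primitive_lipschitz[OF G g ab that] .
  have M: "M \<ge> 0" and N: "N \<ge> 0" using f[of a] g[of a] ab by force+
  have cF: "continuous_on {a..b} F" and cG: "continuous_on {a..b} G"
  proof -
    show "continuous_on {a..b} F"
      by (rule lipschitz_on_continuous_on[where L=M], rule lipschitz_onI)
        (use lF M in \<open>auto simp: dist_real_def\<close>)
    show "continuous_on {a..b} G"
      by (rule lipschitz_on_continuous_on[where L=N], rule lipschitz_onI)
        (use lG N in \<open>auto simp: dist_real_def\<close>)
  qed
  define h where "h t = f t * G t + F t * g t" for t
  have hi: "h integrable_on {c..d}" if "a \<le> c" "c \<le> d" "d \<le> b" for c d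
  proof -
    have "(\<lambda>t. f t * G t) integrable_on {c..d}"
      by (rule integral_continuous_mult_integrable[where M=M])
        (use F[OF that] f that cG in \<open>auto intro: continuous_on_subset[of "{a..b}"]\<close>)
    moreover have "(\<lambda>t. g t * F t) integrable_on {c..d}"
      by (rule integral_continuous_mult_integrable[where M=N])
        (use G[OF that] g that cF in \<open>auto intro: continuous_on_subset[of "{a..b}"]\<close>)
    ultimately show ?thesis unfolding h_def by (auto intro!: integrable_add simp: mult.commute)
  qed
  define P where "P x = F x * G x - integral {a..x} h" for x
  define K where "K = M * N + M * N"
  have est: "\<bar>P d - P c\<bar> \<le> K * (d - c) ^ 2" if cd: "a \<le> c" "c \<le> d" "d \<le> b" for c d
  proof -
    have "integral {a..d} h = integral {a..c} h + integral {c..d} h"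
      using Henstock_Kurzweil_Integration.integral_combine[OF cd(1,2) hi] cd by simp
    then have "P d - P c = (F d - F c) * G d + F c * (G d - G c) - integral {c..d} h"
      by (simp add: P_def algebra_simps)
    moreover have "((\<lambda>t. f t * G d + F c * g t - h t) has_integral
        (F d - F c) * G d + F c * (G d - G c) - integral {c..d} h) {c..d}"
      by (intro has_integral_diff has_integral_add has_integral_mult_left has_integral_mult_right
          F G cd integrable_integral hi)
    ultimately have "((\<lambda>t. f t * G d + F c * g t - h t) has_integral P d - P c) {c..d}" by simp
    moreover have "norm (f t * G d + F c * g t - h t) \<le> K * (d - c)" if t: "t \<in> {c..d} - {}" for t
    proof -
      have "\<bar>f t * (G d - G t)\<bar> \<le> M * (N * (d - c))"
        unfolding abs_mult
      proof (rule mult_mono)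
        have "N * \<bar>d - t\<bar> \<le> N * (d - c)" using N t by (intro mult_left_mono) auto
        then show "\<bar>G d - G t\<bar> \<le> N * (d - c)" using lG[of t d] t cd by auto
      qed (use f t cd M in auto)
      moreover have "\<bar>(F c - F t) * g t\<bar> \<le> (M * (d - c)) * N"
        unfolding abs_mult
      proof (rule mult_mono)
        have "M * \<bar>c - t\<bar> \<le> M * (d - c)" using M t by (intro mult_left_mono) auto
        then show "\<bar>F c - F t\<bar> \<le> M * (d - c)" using lF[of t c] t cd by auto
      qed (use g t cd M in auto)
      moreover have "f t * G d + F c * g t - h t = f t * (G d - G t) + (F c - F t) * g t"
        by (simp add: h_def algebra_simps)
      ultimately show ?thesis by (simp add: K_def algebra_simps)
    qed
    ultimately have "norm (P d - P c) \<le> K * (d - c) * measure lborel {c..d}"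
      by (intro has_integral_bound_real[where S="{}"]) (use M N cd in \<open>auto simp: K_def\<close>)
    then show ?thesis using cd by (simp add: power2_eq_square mult.assoc)
  qed
  have "K \<ge> 0" using M N by (simp add: K_def)
  have est': "\<bar>P y - P x\<bar> \<le> K * \<bar>y - x\<bar> * \<bar>y - x\<bar>" if "x \<in> {a..b}" "y \<in> {a..b}" for x y
    using est[of x y] est[of y x] that
    by (cases "x \<le> y") (auto simp: power2_eq_square abs_minus_commute mult.assoc)
  have "(P has_derivative (\<lambda>h. 0)) (at x within {a..b})" if x: "x \<in> {a..b}" for x
    unfolding has_derivative_within_alt
  proof (intro conjI allI impI bounded_linear_zero)
    fix e :: real assume e: "e > 0"
    show "\<exists>d>0. \<forall>y\<in>{a..b}. norm (y - x) < d \<longrightarrow> norm (P y - P x - 0) \<le> e * norm (y - x)"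
    proof (intro exI[of _ "e / (K + 1)"] conjI ballI impI)
      show "e / (K + 1) > 0" using e \<open>K \<ge> 0\<close> by simp
      fix y assume y: "y \<in> {a..b}" "norm (y - x) < e / (K + 1)"
      have "K * \<bar>y - x\<bar> \<le> (K + 1) * (e / (K + 1))"
        by (rule mult_mono) (use y \<open>K \<ge> 0\<close> in auto)
      then have "K * \<bar>y - x\<bar> \<le> e" using \<open>K \<ge> 0\<close> by simp
      then have "K * \<bar>y - x\<bar> * \<bar>y - x\<bar> \<le> e * \<bar>y - x\<bar>" by (intro mult_right_mono) auto
      then show "norm (P y - P x - 0) \<le> e * norm (y - x)" using est'[OF x y(1)] by simp
    qed
  qed
  then have "P b = P a"
    using has_derivative_zero_constant[of "{a..b}" P] ab by (metis atLeastAtMost_iff convex_real_interval(5) order_refl)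
  then have "integral {a..b} h = F b * G b - F a * G a" by (simp add: P_def)
  then show ?thesis using hi[of a b] ab unfolding h_def
    by (metis (no_types, lifting) integrable_integral order_refl)
qed

text \<open>The function \<open>exp (- L (x - a)) (\<integral>\<^sub>a\<^sup>x d + A / L)\<close> is nonincreasing.\<close>
lemma gronwall:
  fixes d :: "real \<Rightarrow> real"
  assumes ab: "a \<le> b" and cont: "continuous_on {a..b} d" and L: "L > 0"
    and le: "\<And>x. x \<in> {a..b} \<Longrightarrow> d x \<le> A + L * integral {a..x} d" and x: "x \<in> {a..b}"
  shows "d x \<le> A * exp (L * (x - a))"
proof -
  define J where "J x = exp (- L * (x - a)) * (integral {a..x} d + A / L)" for x
  have J: "(J has_real_derivative exp (- L * (t - a)) * (d t - L * integral {a..t} d - A)) (at t within {a..b})"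
    if "t \<in> {a..b}" for t
    unfolding J_def using L
    by (auto intro!: derivative_eq_intros integral_has_real_derivative[OF cont that] simp: field_simps)
  have "J x \<le> J a"
  proof (rule DERIV_nonpos_imp_decreasing_open[of a x J])
    fix t assume t: "a < t" "t < x"
    have "(J has_real_derivative exp (- L * (t - a)) * (d t - L * integral {a..t} d - A)) (at t)"
      using J[of t] t x by (metis at_within_Icc_at atLeastAtMost_iff less_imp_le order_less_le_trans)
    moreover have "exp (- L * (t - a)) * (d t - L * integral {a..t} d - A) \<le> 0"
      using le[of t] t x by (intro mult_nonneg_nonpos) auto
    ultimately show "\<exists>y. (J has_real_derivative y) (at t) \<and> y \<le> 0" by blast
  next
    show "continuous_on {a..x} J"
      using J x by (metis (no_types, lifting) DERIV_continuous atLeastAtMost_iff atLeastatMost_subset_iff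
          continuous_on_eq_continuous_within continuous_on_subset order_refl)
  qed (use x in auto)
  then have "exp (- L * (x - a)) * (integral {a..x} d + A / L) \<le> A / L" by (simp add: J_def)
  then have "exp (L * (x - a)) * (exp (- L * (x - a)) * (integral {a..x} d + A / L)) \<le> exp (L * (x - a)) * (A / L)"
    by (intro mult_left_mono) auto
  also have "exp (L * (x - a)) * (exp (- L * (x - a)) * (integral {a..x} d + A / L)) = integral {a..x} d + A / L"
    by (simp add: mult.assoc[symmetric] exp_add[symmetric])
  finally have "L * (integral {a..x} d + A / L) \<le> L * (exp (L * (x - a)) * (A / L))"
    using L by (intro mult_left_mono) auto
  then have "A + L * integral {a..x} d \<le> A * exp (L * (x - a))"
    using L by (simp add: distrib_left mult.commute)
  then show ?thesis using le[OF x] by simp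
qed

text \<open>The equation \<open>y'' = q y\<close> for measurable \<open>q\<close>: \<open>z\<close> is the derivative of \<open>y\<close>, and \<open>z' = q y\<close> holds in
  integrated form, the second derivative existing only almost everywhere.\<close>
definition solves_on :: "real set \<Rightarrow> (real \<Rightarrow> real) \<Rightarrow> (real \<Rightarrow> real) \<Rightarrow> (real \<Rightarrow> real) \<Rightarrow> bool" where
  "solves_on S q y z \<longleftrightarrow> (\<forall>x\<in>S. (y has_real_derivative z x) (at x)) \<and>
     (\<forall>a b. a \<le> b \<longrightarrow> {a..b} \<subseteq> S \<longrightarrow> ((\<lambda>t. q t * y t) has_integral z b - z a) {a..b})"

lemma solves_onD:
  assumes "solves_on S q y z"
  shows "x \<in> S \<Longrightarrow> (y has_real_derivative z x) (at x)"
    and "a \<le> b \<Longrightarrow> {a..b} \<subseteq> S \<Longrightarrow> ((\<lambda>t. q t * y t) has_integral z b - z a) {a..b}"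
  using assms unfolding solves_on_def by blast+

lemma solves_on_subset: "solves_on S q y z \<Longrightarrow> T \<subseteq> S \<Longrightarrow> solves_on T q y z"
  unfolding solves_on_def by blast

lemma solves_on_cmult:
  assumes "solves_on S q y z"
  shows "solves_on S q (\<lambda>x. c * y x) (\<lambda>x. c * z x)"
  unfolding solves_on_def
proof safe
  fix x assume "x \<in> S"
  then show "((\<lambda>x. c * y x) has_real_derivative c * z x) (at x)"
    by (intro DERIV_cmult solves_onD[OF assms])
next
  fix a b :: real assume "a \<le> b" "{a..b} \<subseteq> S"
  from has_integral_mult_right[OF solves_onD(2)[OF assms this], of c]
  show "((\<lambda>t. q t * (c * y t)) has_integral c * z b - c * z a) {a..b}"
    by (simp add: algebra_simps)
qed

text \<open>Translations, the reflection at the origin and the rescaling \<open>x = \<epsilon> t\<close> are the cases of interest;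
  the last turns a potential \<open>\<epsilon>\<^sup>-\<^sup>2 V (x / \<epsilon>)\<close> into \<open>V t\<close>.\<close>
lemma solves_on_affine:
  assumes "solves_on S q y z" and m: "m \<noteq> 0"
  shows "solves_on {t. m * t + c \<in> S} (\<lambda>t. m\<^sup>2 * q (m * t + c)) (\<lambda>t. y (m * t + c)) (\<lambda>t. m * z (m * t + c))"
  unfolding solves_on_def
proof safe
  fix t assume "m * t + c \<in> S"
  then have "(y has_real_derivative z (m * t + c)) (at (m * t + c))" by (rule solves_onD[OF assms(1)])
  then show "((\<lambda>t. y (m * t + c)) has_real_derivative m * z (m * t + c)) (at t)"
    by (rule DERIV_compose_affine)
next
  fix a b :: real assume ab: "a \<le> b" "{a..b} \<subseteq> {t. m * t + c \<in> S}"
  define l where "l = min (m * a + c) (m * b + c)"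
  define r where "r = max (m * a + c) (m * b + c)"
  have img: "(\<lambda>x. (1 / m) *\<^sub>R x + - ((1 / m) *\<^sub>R c)) ` cbox l r = {a..b}"
  proof (intro equalityI subsetI)
    fix x assume "x \<in> (\<lambda>x. (1 / m) *\<^sub>R x + - ((1 / m) *\<^sub>R c)) ` cbox l r"
    then obtain s where s: "l \<le> s" "s \<le> r" "x = (s - c) / m" by (auto simp: diff_divide_distrib)
    then have "m * x + c = s" using m by simp
    then have "l \<le> m * x + c" "m * x + c \<le> r" using s by auto
    then show "x \<in> {a..b}" using ab m unfolding l_def r_def
      by (cases "m > 0") (auto simp: min_def max_def mult_le_cancel_left split: if_splits)
  next
    fix x assume x: "x \<in> {a..b}"
    have "m * x + c \<in> cbox l r" unfolding l_def r_def using x m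
      by (cases "m > 0") (auto simp: min_def max_def mult_le_cancel_left)
    moreover have "x = (1 / m) *\<^sub>R (m * x + c) + - ((1 / m) *\<^sub>R c)" using m by (simp add: field_simps)
    ultimately show "x \<in> (\<lambda>x. (1 / m) *\<^sub>R x + - ((1 / m) *\<^sub>R c)) ` cbox l r" by blast
  qed
  have sub: "{l..r} \<subseteq> S"
  proof
    fix s assume "s \<in> {l..r}"
    then have "(s - c) / m \<in> {a..b}" using img by (force simp: diff_divide_distrib)
    then have "m * ((s - c) / m) + c \<in> S" using ab by blast
    then show "s \<in> S" using m by simp
  qed
  have lr: "l \<le> r" by (simp add: l_def r_def)
  have "((\<lambda>t. q (m * t + c) * y (m * t + c)) has_integral (1 / \<bar>m\<bar>) * (z r - z l)) {a..b}"
    using has_integral_affinity[OF _ m, of "\<lambda>t. q t * y t" "z r - z l" l r c, unfolded img]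
      solves_onD(2)[OF assms(1) lr sub] by simp
  from has_integral_mult_right[OF this, of "m\<^sup>2"]
  have *: "((\<lambda>t. m\<^sup>2 * q (m * t + c) * y (m * t + c)) has_integral m\<^sup>2 * (1 / \<bar>m\<bar> * (z r - z l))) {a..b}"
    by (simp add: mult.assoc)
  have "m\<^sup>2 * (1 / \<bar>m\<bar> * (z r - z l)) = m * z (m * b + c) - m * z (m * a + c)"
    unfolding l_def r_def using m ab
    by (cases "m > 0") (auto simp: min_def max_def mult_le_cancel_left power2_eq_square algebra_simps)
  with * show "((\<lambda>t. m\<^sup>2 * q (m * t + c) * y (m * t + c)) has_integral m * z (m * b + c) - m * z (m * a + c)) {a..b}"
    by simp
qed

lemma solves_on_reflect:
  assumes "solves_on S q y z"
  shows "solves_on {t. - t \<in> S} (\<lambda>t. q (- t)) (\<lambda>t. y (- t)) (\<lambda>t. - z (- t))"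
  using solves_on_affine[OF assms, of "-1" 0] by simp

lemma solves_on_continuous:
  assumes "solves_on S q y z" and "{a..b} \<subseteq> S" and "\<And>t. t \<in> {a..b} \<Longrightarrow> \<bar>q t\<bar> \<le> M"
  shows "continuous_on {a..b} y" and "continuous_on {a..b} z"
proof -
  show y: "continuous_on {a..b} y"
    using solves_onD(1)[OF assms(1)] assms(2)
    by (meson DERIV_isCont continuous_at_imp_continuous_on subsetD)
  show "continuous_on {a..b} z"
  proof (cases "a \<le> b")
    case True
    have "((\<lambda>t. q t * y t) has_integral z b - z a) {a..b}"
      by (rule solves_onD(2)[OF assms(1) True assms(2)])
    then have "continuous_on {a..b} (\<lambda>x. integral {a..x} (\<lambda>t. q t * y t))"
      by (intro indefinite_integral_continuous_1) auto
    then have "continuous_on {a..b} (\<lambda>x. z a + integral {a..x} (\<lambda>t. q t * y t))"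
      by (intro continuous_intros)
    moreover have "z a + integral {a..x} (\<lambda>t. q t * y t) = z x" if "x \<in> {a..b}" for x
    proof -
      have "{a..x} \<subseteq> S" using that assms(2) by auto
      from integral_unique[OF solves_onD(2)[OF assms(1) _ this]] show ?thesis using that by simp
    qed
    ultimately show ?thesis by (metis (no_types, lifting) continuous_on_cong)
  qed auto
qed

lemma solves_on_has_integral_deriv:
  assumes "solves_on S q y z" "a \<le> b" "{a..b} \<subseteq> S"
  shows "(z has_integral y b - y a) {a..b}"
proof (rule fundamental_theorem_of_calculus)
  show "(y has_vector_derivative z x) (at x within {a..b})" if "x \<in> {a..b}" for x
    using solves_onD(1)[OF assms(1), of x] that assms(3)
    by (meson has_field_derivative_at_within has_real_derivative_iff_has_vector_derivative subsetD)
qed fact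

lemma bounded_on_Icc:
  fixes y :: "real \<Rightarrow> real"
  assumes "continuous_on {a..b} y"
  obtains C where "C \<ge> 0" "\<And>t. t \<in> {a..b} \<Longrightarrow> \<bar>y t\<bar> \<le> C"
proof -
  have "bounded (y ` {a..b})"
    using assms compact_Icc compact_continuous_image compact_imp_bounded by blast
  then obtain C where "\<forall>t\<in>{a..b}. \<bar>y t\<bar> \<le> C" unfolding bounded_iff by auto
  then show ?thesis using that[of "max C 0"] by (metis max.cobounded2 max.coboundedI1)
qed

text \<open>The integrated form of \<open>(y\<^sub>1' y\<^sub>2 - y\<^sub>1 y\<^sub>2')' = (q\<^sub>1 - q\<^sub>2) y\<^sub>1 y\<^sub>2\<close>. It serves three purposes: with equal
  potentials it matches a solution to a decaying one, with potentials \<open>W + k\<^sup>2\<close> and \<open>W + l\<^sup>2\<close> it is a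
  Sturm comparison, and with a perturbed potential it gives first-order perturbation theory.\<close>
lemma wronskian_integral:
  assumes 1: "solves_on S q1 y1 z1" and 2: "solves_on S q2 y2 z2"
    and ab: "a \<le> b" "{a..b} \<subseteq> S"
    and b1: "\<And>t. t \<in> {a..b} \<Longrightarrow> \<bar>q1 t\<bar> \<le> M" and b2: "\<And>t. t \<in> {a..b} \<Longrightarrow> \<bar>q2 t\<bar> \<le> M"
  shows "((\<lambda>t. (q1 t - q2 t) * y1 t * y2 t) has_integral
           (z1 b * y2 b - y1 b * z2 b) - (z1 a * y2 a - y1 a * z2 a)) {a..b}"
proof -
  note c1 = solves_on_continuous[OF 1 ab(2) b1] and c2 = solves_on_continuous[OF 2 ab(2) b2]
  obtain Y1 where Y1: "Y1 \<ge> 0" "\<And>t. t \<in> {a..b} \<Longrightarrow> \<bar>y1 t\<bar> \<le> Y1" using bounded_on_Icc c1 by metis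
  obtain Y2 where Y2: "Y2 \<ge> 0" "\<And>t. t \<in> {a..b} \<Longrightarrow> \<bar>y2 t\<bar> \<le> Y2" using bounded_on_Icc c2 by metis
  obtain Z1 where Z1: "Z1 \<ge> 0" "\<And>t. t \<in> {a..b} \<Longrightarrow> \<bar>z1 t\<bar> \<le> Z1" using bounded_on_Icc c1 by metis
  obtain Z2 where Z2: "Z2 \<ge> 0" "\<And>t. t \<in> {a..b} \<Longrightarrow> \<bar>z2 t\<bar> \<le> Z2" using bounded_on_Icc c2 by metis
  have M: "M \<ge> 0" using b1[of a] ab by force
  have q1: "\<bar>q1 t * y1 t\<bar> \<le> M * Y1" if "t \<in> {a..b}" for t
    unfolding abs_mult using that b1 Y1 M by (intro mult_mono) auto
  have q2: "\<bar>q2 t * y2 t\<bar> \<le> M * Y2" if "t \<in> {a..b}" for t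
    unfolding abs_mult using that b2 Y2 M by (intro mult_mono) auto
  have sub: "{c..d} \<subseteq> S" if "a \<le> c" "d \<le> b" for c d using that ab by fastforce
  have A: "((\<lambda>t. q1 t * y1 t * y2 t + z1 t * z2 t) has_integral z1 b * y2 b - z1 a * y2 a) {a..b}"
    by (rule product_rule_integral[where M="M * Y1" and N=Z2])
      (use q1 Z2 ab in \<open>auto intro!: solves_onD(2)[OF 1] solves_on_has_integral_deriv[OF 2] sub\<close>)
  have B: "((\<lambda>t. z1 t * z2 t + y1 t * (q2 t * y2 t)) has_integral y1 b * z2 b - y1 a * z2 a) {a..b}"
    by (rule product_rule_integral[where N="M * Y2" and M=Z1])
      (use q2 Z1 ab in \<open>auto intro!: solves_onD(2)[OF 2] solves_on_has_integral_deriv[OF 1] sub\<close>)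
  show ?thesis using has_integral_diff[OF A B] by (simp add: algebra_simps)
qed

text \<open>Gronwall's inequality for \<open>\<bar>y\<^sub>1 - y\<^sub>2\<bar> + \<bar>z\<^sub>1 - z\<^sub>2\<bar>\<close>. This one estimate yields uniqueness, a priori
  bounds (comparison with the zero solution), Lipschitz dependence on the spectral parameter, and the
  approximation of the rescaled solution by the half-bound state.\<close>
lemma solution_stability:
  assumes 1: "solves_on S q1 y1 z1" and 2: "solves_on S q2 y2 z2"
    and ab: "{a..b} \<subseteq> S"
    and b1: "\<And>t. t \<in> {a..b} \<Longrightarrow> \<bar>q1 t\<bar> \<le> M" and b2: "\<And>t. t \<in> {a..b} \<Longrightarrow> \<bar>q2 t\<bar> \<le> N"
    and close: "\<And>t. t \<in> {a..b} \<Longrightarrow> \<bar>q1 t - q2 t\<bar> \<le> \<delta>" and Y: "\<And>t. t \<in> {a..b} \<Longrightarrow> \<bar>y2 t\<bar> \<le> Y"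
    and x: "x \<in> {a..b}"
  shows "\<bar>y1 x - y2 x\<bar> + \<bar>z1 x - z2 x\<bar>
     \<le> (\<bar>y1 a - y2 a\<bar> + \<bar>z1 a - z2 a\<bar> + \<delta> * Y * (b - a)) * exp ((1 + M) * (x - a))"
proof -
  have aleb: "a \<le> b" using x by auto
  note c1 = solves_on_continuous[OF 1 ab b1] and c2 = solves_on_continuous[OF 2 ab b2]
  have nn: "M \<ge> 0" "\<delta> \<ge> 0" "Y \<ge> 0" using b1[of a] close[of a] Y[of a] aleb by force+
  define d where "d t = \<bar>y1 t - y2 t\<bar> + \<bar>z1 t - z2 t\<bar>" for t
  have cd: "continuous_on {a..b} d" unfolding d_def by (intro continuous_intros c1 c2)
  have "d x \<le> (\<bar>y1 a - y2 a\<bar> + \<bar>z1 a - z2 a\<bar> + \<delta> * Y * (b - a)) * exp ((1 + M) * (x - a))"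
  proof (rule gronwall[OF aleb cd _ _ x])
    show "0 < 1 + M" using nn by simp
    fix x assume x: "x \<in> {a..b}"
    have ax: "a \<le> x" and sub: "{a..x} \<subseteq> S" using x ab by auto
    have cdx: "continuous_on {a..x} d" using cd x continuous_on_subset by fastforce
    have id: "d integrable_on {a..x}" using cdx by (rule integrable_continuous_real)
    have I1: "((\<lambda>t. z1 t - z2 t) has_integral (y1 x - y1 a) - (y2 x - y2 a)) {a..x}"
      by (intro has_integral_diff solves_on_has_integral_deriv[OF 1] solves_on_has_integral_deriv[OF 2] ax sub)
    have I2: "((\<lambda>t. q1 t * y1 t - q2 t * y2 t) has_integral (z1 x - z1 a) - (z2 x - z2 a)) {a..x}"
      by (intro has_integral_diff solves_onD(2)[OF 1] solves_onD(2)[OF 2] ax sub)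
    have "norm (integral {a..x} (\<lambda>t. z1 t - z2 t)) \<le> integral {a..x} (\<lambda>t. \<bar>z1 t - z2 t\<bar>)"
      using I1 continuous_on_subset[OF c1(2)] continuous_on_subset[OF c2(2)] x
      by (intro integral_norm_bound_integral integrable_continuous_real continuous_intros) auto
    then have e1: "\<bar>y1 x - y2 x\<bar> \<le> \<bar>y1 a - y2 a\<bar> + integral {a..x} (\<lambda>t. \<bar>z1 t - z2 t\<bar>)"
      using integral_unique[OF I1] by simp
    have bd: "norm (q1 t * y1 t - q2 t * y2 t) \<le> M * \<bar>y1 t - y2 t\<bar> + \<delta> * Y" if "t \<in> {a..x}" for t
    proof -
      have t: "t \<in> {a..b}" using that x by auto
      have "\<bar>q1 t * (y1 t - y2 t)\<bar> \<le> M * \<bar>y1 t - y2 t\<bar>"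
        unfolding abs_mult using b1[OF t] by (intro mult_right_mono) auto
      moreover have "\<bar>(q1 t - q2 t) * y2 t\<bar> \<le> \<delta> * Y"
        unfolding abs_mult using close[OF t] Y[OF t] nn by (intro mult_mono) auto
      moreover have "q1 t * y1 t - q2 t * y2 t = q1 t * (y1 t - y2 t) + (q1 t - q2 t) * y2 t"
        by (simp add: algebra_simps)
      ultimately show ?thesis by simp
    qed
    have i3: "(\<lambda>t. M * \<bar>y1 t - y2 t\<bar> + \<delta> * Y) integrable_on {a..x}"
      using continuous_on_subset[OF c1(1)] continuous_on_subset[OF c2(1)] x
      by (intro integrable_continuous_real continuous_intros) auto
    have "norm (integral {a..x} (\<lambda>t. q1 t * y1 t - q2 t * y2 t)) \<le> integral {a..x} (\<lambda>t. M * \<bar>y1 t - y2 t\<bar> + \<delta> * Y)"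
      using I2 i3 bd by (intro integral_norm_bound_integral) auto
    also have "\<dots> = integral {a..x} (\<lambda>t. M * \<bar>y1 t - y2 t\<bar>) + \<delta> * Y * (x - a)"
      using continuous_on_subset[OF c1(1)] continuous_on_subset[OF c2(1)] x
      by (subst integral_add) (auto intro!: integrable_continuous_real continuous_intros)
    also have "\<delta> * Y * (x - a) \<le> \<delta> * Y * (b - a)" using nn x by (intro mult_left_mono) auto
    finally have e2: "\<bar>z1 x - z2 x\<bar> \<le> \<bar>z1 a - z2 a\<bar> + integral {a..x} (\<lambda>t. M * \<bar>y1 t - y2 t\<bar>) + \<delta> * Y * (b - a)"
      using integral_unique[OF I2] by simp
    have "integral {a..x} (\<lambda>t. \<bar>z1 t - z2 t\<bar>) + integral {a..x} (\<lambda>t. M * \<bar>y1 t - y2 t\<bar>)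
        = integral {a..x} (\<lambda>t. \<bar>z1 t - z2 t\<bar> + M * \<bar>y1 t - y2 t\<bar>)"
      using continuous_on_subset[OF c1(1)] continuous_on_subset[OF c2(1)] x
         continuous_on_subset[OF c1(2)] continuous_on_subset[OF c2(2)]
      by (subst integral_add) (auto intro!: integrable_continuous_real continuous_intros)
    also have "\<dots> \<le> integral {a..x} (\<lambda>t. (1 + M) * d t)"
    proof (rule integral_le)
      show "(\<lambda>t. \<bar>z1 t - z2 t\<bar> + M * \<bar>y1 t - y2 t\<bar>) integrable_on {a..x}"
        using continuous_on_subset[OF c1(1)] continuous_on_subset[OF c2(1)] x
         continuous_on_subset[OF c1(2)] continuous_on_subset[OF c2(2)]
        by (auto intro!: integrable_continuous_real continuous_intros)
      show "(\<lambda>t. (1 + M) * d t) integrable_on {a..x}"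
        using cdx by (auto intro!: integrable_continuous_real continuous_intros)
      show "\<bar>z1 t - z2 t\<bar> + M * \<bar>y1 t - y2 t\<bar> \<le> (1 + M) * d t" for t
        using nn by (simp add: d_def algebra_simps)
    qed
    also have "\<dots> = (1 + M) * integral {a..x} d" by simp
    finally show "d x \<le> (\<bar>y1 a - y2 a\<bar> + \<bar>z1 a - z2 a\<bar> + \<delta> * Y * (b - a)) + (1 + M) * integral {a..x} d"
      using e1 e2 by (simp add: d_def)
  qed
  then show ?thesis by (simp add: d_def)
qed

lemma solution_unique:
  assumes 1: "solves_on S q1 y1 z1" and 2: "solves_on S q2 y2 z2" and ab: "{a..b} \<subseteq> S"
    and b1: "\<And>t. t \<in> {a..b} \<Longrightarrow> \<bar>q1 t\<bar> \<le> M" and eq: "\<And>t. t \<in> {a..b} \<Longrightarrow> q1 t = q2 t"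
    and init: "y1 a = y2 a" "z1 a = z2 a" and x: "x \<in> {a..b}"
  shows "y1 x = y2 x \<and> z1 x = z2 x"
proof -
  have b2: "\<And>t. t \<in> {a..b} \<Longrightarrow> \<bar>q2 t\<bar> \<le> M" using b1 eq by metis
  obtain Y where Y: "\<And>t. t \<in> {a..b} \<Longrightarrow> \<bar>y2 t\<bar> \<le> Y"
    using bounded_on_Icc[OF solves_on_continuous(1)[OF 2 ab b2]] by metis
  have "\<bar>y1 x - y2 x\<bar> + \<bar>z1 x - z2 x\<bar> \<le> 0"
    using solution_stability[OF 1 2 ab b1 b2 _ Y x, of 0] eq init by simp
  moreover have "0 \<le> \<bar>y1 x - y2 x\<bar>" "0 \<le> \<bar>z1 x - z2 x\<bar>" by simp_all
  ultimately have "\<bar>y1 x - y2 x\<bar> = 0" "\<bar>z1 x - z2 x\<bar> = 0" by linarith+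
  then show ?thesis by simp
qed

lemma solves_on_zero: "solves_on S q (\<lambda>_. 0) (\<lambda>_. 0)"
  by (simp add: solves_on_def)

lemma zero_solution:
  assumes 1: "solves_on UNIV q y z" and b: "\<And>t. \<bar>q t\<bar> \<le> M" and init: "y a = 0" "z a = 0"
  shows "y x = 0 \<and> z x = 0"
proof (cases "a \<le> x")
  case True
  then show ?thesis
    using solution_unique[OF 1 solves_on_zero[of UNIV q], of a x M x] b init by simp
next
  case False
  have "solves_on UNIV (\<lambda>t. q (- t)) (\<lambda>t. y (- t)) (\<lambda>t. - z (- t))" using solves_on_reflect[OF 1] by simp
  from solution_unique[OF this solves_on_zero[of UNIV "\<lambda>t. q (- t)"], of "-a" "-x" M "-x"]
  show ?thesis using False b init by simp
qed

lemma solution_unique_left: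
  assumes 1: "solves_on UNIV q1 y1 z1" and 2: "solves_on UNIV q2 y2 z2"
    and b1: "\<And>t. t \<in> {a..b} \<Longrightarrow> \<bar>q1 t\<bar> \<le> M" and eq: "\<And>t. t \<in> {a..b} \<Longrightarrow> q1 t = q2 t"
    and init: "y1 b = y2 b" "z1 b = z2 b" and x: "x \<in> {a..b}"
  shows "y1 x = y2 x \<and> z1 x = z2 x"
proof -
  have 1: "solves_on UNIV (\<lambda>t. q1 (- t)) (\<lambda>t. y1 (- t)) (\<lambda>t. - z1 (- t))" using solves_on_reflect[OF 1] by simp
  have 2: "solves_on UNIV (\<lambda>t. q2 (- t)) (\<lambda>t. y2 (- t)) (\<lambda>t. - z2 (- t))" using solves_on_reflect[OF 2] by simp
  show ?thesis using solution_unique[OF 1 2, of "-b" "-a" M "-x"] b1 eq init x by simp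
qed

lemma exp_solves: "solves_on UNIV (\<lambda>_. k\<^sup>2) (\<lambda>x. exp (k * (x - a))) (\<lambda>x. k * exp (k * (x - a)))"
  unfolding solves_on_def
proof safe
  show "((\<lambda>x. exp (k * (x - a))) has_real_derivative k * exp (k * (x - a))) (at x)" for x
    by (auto intro!: derivative_eq_intros)
  fix c d :: real assume cd: "c \<le> d"
  show "((\<lambda>t. k\<^sup>2 * exp (k * (t - a))) has_integral k * exp (k * (d - a)) - k * exp (k * (c - a))) {c..d}"
    by (rule fundamental_theorem_of_calculus[OF cd])
      (auto intro!: derivative_eq_intros simp: has_real_derivative_iff_has_vector_derivative[symmetric] power2_eq_square)
qed

section \<open>Existence of solutions\<close>

text \<open>The integral from \<open>0\<close> to \<open>x\<close> with the usual sign for \<open>x < 0\<close>: at most one of the two terms is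
  nonzero.\<close>
definition oriented_integral :: "(real \<Rightarrow> real) \<Rightarrow> real \<Rightarrow> real" where
  "oriented_integral f x = integral {0..x} f - integral {x..0} f"

lemma oriented_integral_has_integral:
  assumes f: "\<And>a b. f integrable_on {a..b}" and "a \<le> b"
  shows "(f has_integral oriented_integral f b - oriented_integral f a) {a..b}"
proof -
  have c: "integral {l..m} f + integral {m..r} f = integral {l..r} f" if "l \<le> m" "m \<le> r" for l m r
    using Henstock_Kurzweil_Integration.integral_combine[OF that f] .
  have e: "integral {l..r} f = 0" if "r \<le> l" for l r
    using that by (cases "l = r") auto
  have "oriented_integral f b - oriented_integral f a = integral {a..b} f"
    unfolding oriented_integral_def using c[of a 0 b] c[of 0 a b] c[of a b 0] e[of 0 a] e[of a 0] e[of b 0] e[of 0 b] \<open>a \<le> b\<close>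
    by linarith
  then show ?thesis using f by (metis integrable_integral)
qed

lemma oriented_integral_eq:
  assumes f: "\<And>a b. f integrable_on {a..b}" and "a \<le> t"
  shows "oriented_integral f t = oriented_integral f a + integral {a..t} f"
  using integral_unique[OF oriented_integral_has_integral[OF assms]] by simp

lemma oriented_integral_continuous:
  assumes f: "\<And>a b. f integrable_on {a..b}"
  shows "continuous_on UNIV (oriented_integral f)"
proof (rule continuous_at_imp_continuous_on, safe)
  fix x :: real
  have "continuous_on {x-1..x+1} (\<lambda>t. oriented_integral f (x-1) + integral {x-1..t} f)"
    by (intro continuous_intros indefinite_integral_continuous_1 f)
  then have "continuous_on {x-1..x+1} (oriented_integral f)"
    using oriented_integral_eq[OF f] by (metis (no_types, lifting) atLeastAtMost_iff continuous_on_cong)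
  then show "isCont (oriented_integral f) x"
    by (rule continuous_on_interior) auto
qed

lemma oriented_integral_deriv:
  assumes "continuous_on UNIV f"
  shows "(oriented_integral f has_real_derivative f x) (at x)"
proof -
  have c: "continuous_on {a..b} f" for a b using assms continuous_on_subset by blast
  have f: "f integrable_on {a..b}" for a b using c by (rule integrable_continuous_real)
  have "((\<lambda>t. oriented_integral f (x-1) + integral {x-1..t} f) has_real_derivative f x) (at x within {x-1..x+1})"
    by (auto intro!: derivative_eq_intros integral_has_real_derivative c)
  then have "(oriented_integral f has_real_derivative f x) (at x within {x-1..x+1})"
    by (rule has_field_derivative_transform_within[where d=1])
      (auto simp: oriented_integral_eq[OF f, symmetric])
  then show ?thesis using at_within_Icc_at[of "x-1" x "x+1"] by simp
qed

lemma oriented_integral_bound: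
  assumes f: "\<And>a b. f integrable_on {a..b}" and L: "L > 0"
    and le: "\<And>t. \<bar>f t\<bar> \<le> C * exp (L * \<bar>t\<bar>)"
  shows "\<bar>oriented_integral f x\<bar> \<le> C / L * exp (L * \<bar>x\<bar>)"
proof -
  have C: "C \<ge> 0" using le[of 0] by simp
  show ?thesis
  proof (cases "x \<ge> 0")
    case True
    have "((\<lambda>t. C * exp (L * t)) has_integral C / L * exp (L * x) - C / L * exp (L * 0)) {0..x}"
      by (rule fundamental_theorem_of_calculus[OF True])
        (use L in \<open>auto intro!: derivative_eq_intros simp: has_real_derivative_iff_has_vector_derivative[symmetric]\<close>)
    note I = this
    have "norm (integral {0..x} f) \<le> integral {0..x} (\<lambda>t. C * exp (L * t))"
      by (rule integral_norm_bound_integral[OF f has_integral_integrable[OF I]]) (use le in \<open>auto intro: order_trans[OF le]\<close>)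
    then have "norm (integral {0..x} f) \<le> C / L * exp (L * x) - C / L * exp (L * 0)"
      unfolding integral_unique[OF I] .
    moreover have "integral {x..0} f = 0" using True by (cases "x = 0") auto
    moreover have "C / L * exp (L * x) - C / L * exp (L * 0) \<le> C / L * exp (L * \<bar>x\<bar>)" using True C L by simp
    ultimately show ?thesis by (simp add: oriented_integral_def)
  next
    case False
    then have x: "x \<le> 0" by simp
    have "((\<lambda>t. C * exp (- L * t)) has_integral - (C / L) * exp (- L * 0) - - (C / L) * exp (- L * x)) {x..0}"
      by (rule fundamental_theorem_of_calculus[OF x])
        (use L in \<open>auto intro!: derivative_eq_intros simp: has_real_derivative_iff_has_vector_derivative[symmetric]\<close>)
    note I = this
    have "norm (integral {x..0} f) \<le> integral {x..0} (\<lambda>t. C * exp (- L * t))"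
      by (rule integral_norm_bound_integral[OF f has_integral_integrable[OF I]]) (use le in \<open>auto intro: order_trans[OF le]\<close>)
    then have "norm (integral {x..0} f) \<le> - (C / L) * exp (- L * 0) - - (C / L) * exp (- L * x)"
      unfolding integral_unique[OF I] .
    moreover have "integral {0..x} f = 0" using False by auto
    moreover have "- (C / L) * exp (- L * 0) - - (C / L) * exp (- L * x) \<le> C / L * exp (L * \<bar>x\<bar>)" using False C L by simp
    ultimately show ?thesis by (simp add: oriented_integral_def)
  qed
qed

lemma bounded_measurable_integrable:
  fixes q :: "real \<Rightarrow> real"
  assumes "q \<in> borel_measurable lebesgue" "\<And>x. \<bar>q x\<bar> \<le> M"
  shows "q integrable_on {a..b}"
proof (rule measurable_bounded_by_integrable_imp_integrable_real)
  show "q \<in> borel_measurable (lebesgue_on {a..b})" using assms(1) by (simp add: measurable_restrict_space1)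
  show "(\<lambda>_. M) integrable_on {a..b}" by auto
qed (use assms in auto)

text \<open>The Volterra equation is solved for \<open>p x = exp (- L \<bar>x\<bar>) y x\<close> in the space of bounded continuous
  functions. In this weight an integration gains a factor \<open>1 / L\<close>, so the fixed-point map has Lipschitz
  constant \<open>M / L\<^sup>2\<close>, which is less than one for \<open>L = 1 + M\<close>, and the solution is global at once.\<close>
lemma solution_exists_at_0:
  assumes q: "q \<in> borel_measurable lebesgue" "\<And>x. \<bar>q x\<bar> \<le> M"
  obtains y z where "solves_on UNIV q y z" "y 0 = A" "z 0 = B"
proof -
  have M: "M \<ge> 0" using q(2)[of 0] by simp
  define L where "L = 1 + M"
  have L: "L > 0" using M by (simp add: L_def)
  define g where "g p t = q t * (exp (L * \<bar>t\<bar>) * p t)" for p :: "real \<Rightarrow> real" and t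
  define Z where "Z p s = B + oriented_integral (g p) s" for p s
  define Y where "Y p x = A + oriented_integral (Z p) x" for p x
  define F where "F p x = exp (- (L * \<bar>x\<bar>)) * Y p x" for p x
  have gi: "g p integrable_on {a..b}" if "continuous_on UNIV p" for p a b
    unfolding g_def
    by (rule integral_continuous_mult_integrable[where M=M, OF bounded_measurable_integrable[OF q]])
      (use that q in \<open>auto intro!: continuous_intros intro: continuous_on_subset\<close>)
  have Zc: "continuous_on UNIV (Z p)" if "continuous_on UNIV p" for p
    unfolding Z_def by (intro continuous_intros oriented_integral_continuous gi that)
  have Zi: "Z p integrable_on {a..b}" if "continuous_on UNIV p" for p a b
    using Zc[OF that] continuous_on_subset integrable_continuous_real by blast
  have gb: "\<bar>g p t\<bar> \<le> (M * N) * exp (L * \<bar>t\<bar>)" if "\<And>t. \<bar>p t\<bar> \<le> N" for p t N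
  proof -
    have "\<bar>q t\<bar> * (exp (L * \<bar>t\<bar>) * \<bar>p t\<bar>) \<le> M * (exp (L * \<bar>t\<bar>) * N)"
      using that M q by (intro mult_mono) auto
    then show ?thesis by (simp add: g_def abs_mult mult_ac)
  qed
  have one_le: "1 \<le> exp (L * \<bar>t\<bar>)" for t using L by simp
  have Yc: "continuous_on UNIV (Y p)" if "continuous_on UNIV p" for p
    unfolding Y_def by (intro continuous_intros oriented_integral_continuous Zi that)
  have Fc: "continuous_on UNIV (F p)" if "continuous_on UNIV p" for p
    unfolding F_def by (intro continuous_intros Yc that)
  have Fb: "\<bar>F p x\<bar> \<le> \<bar>A\<bar> + (\<bar>B\<bar> + M * N / L) / L" if p: "continuous_on UNIV p" "\<And>t. \<bar>p t\<bar> \<le> N" for p x N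
  proof -
    have "\<bar>Z p s\<bar> \<le> (\<bar>B\<bar> + M * N / L) * exp (L * \<bar>s\<bar>)" for s
    proof -
      have "\<bar>B\<bar> * 1 \<le> \<bar>B\<bar> * exp (L * \<bar>s\<bar>)" using one_le by (intro mult_left_mono) auto
      moreover have "\<bar>oriented_integral (g p) s\<bar> \<le> M * N / L * exp (L * \<bar>s\<bar>)"
        using oriented_integral_bound[OF gi[OF p(1)] L gb[OF p(2)]] .
      moreover have "\<bar>Z p s\<bar> \<le> \<bar>B\<bar> + \<bar>oriented_integral (g p) s\<bar>" unfolding Z_def by simp
      ultimately show ?thesis unfolding distrib_right[of "\<bar>B\<bar>"] by linarith
    qed
    from oriented_integral_bound[OF Zi[OF p(1)] L this]
    have "\<bar>oriented_integral (Z p) x\<bar> \<le> (\<bar>B\<bar> + M * N / L) / L * exp (L * \<bar>x\<bar>)" .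
    moreover have "\<bar>A\<bar> * 1 \<le> \<bar>A\<bar> * exp (L * \<bar>x\<bar>)" using one_le by (intro mult_left_mono) auto
    moreover have "\<bar>Y p x\<bar> \<le> \<bar>A\<bar> + \<bar>oriented_integral (Z p) x\<bar>" unfolding Y_def by simp
    ultimately have "\<bar>Y p x\<bar> \<le> (\<bar>A\<bar> + (\<bar>B\<bar> + M * N / L) / L) * exp (L * \<bar>x\<bar>)"
      unfolding distrib_right[of "\<bar>A\<bar>"] by linarith
    then have "exp (- (L * \<bar>x\<bar>)) * \<bar>Y p x\<bar> \<le> exp (- (L * \<bar>x\<bar>)) * ((\<bar>A\<bar> + (\<bar>B\<bar> + M * N / L) / L) * exp (L * \<bar>x\<bar>))"
      by (intro mult_left_mono) auto
    also have "\<dots> = (\<bar>A\<bar> + (\<bar>B\<bar> + M * N / L) / L) * (exp (- (L * \<bar>x\<bar>)) * exp (L * \<bar>x\<bar>))" by (simp only: mult_ac)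
    finally show ?thesis unfolding F_def abs_mult by (simp add: exp_add[symmetric])
  qed
  define T :: "(real \<Rightarrow>\<^sub>C real) \<Rightarrow> (real \<Rightarrow>\<^sub>C real)" where "T p = Bcontfun (F (apply_bcontfun p))" for p
  have pc: "continuous_on UNIV (apply_bcontfun p)" for p :: "real \<Rightarrow>\<^sub>C real" by simp
  have pn: "\<bar>apply_bcontfun p t\<bar> \<le> norm p" for p :: "real \<Rightarrow>\<^sub>C real" and t
    using norm_bounded[of p t] by simp
  have T: "apply_bcontfun (T p) = F (apply_bcontfun p)" for p
    unfolding T_def
    by (rule Bcontfun_inverse, rule bcontfun_normI[OF Fc[OF pc]]) (use Fb[OF pc pn] in auto)
  have "dist (T p1) (T p2) \<le> (M / L / L) * dist p1 p2" for p1 p2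
  proof (rule dist_bound)
    fix x
    let ?p = "\<lambda>t. p1 t - p2 t"
    have d: "\<bar>p1 t - p2 t\<bar> \<le> dist p1 p2" for t
      using dist_bounded[of p1 t p2] by (simp add: dist_real_def)
    have gd: "g ?p = (\<lambda>t. g p1 t - g p2 t)" by (auto simp: g_def algebra_simps)
    have oid: "oriented_integral (\<lambda>t. f t - h t) s = oriented_integral f s - oriented_integral h s"
      if "\<And>a b. f integrable_on {a..b}" "\<And>a b. h integrable_on {a..b}" for f h s
      unfolding oriented_integral_def using that by (simp add: integral_diff)
    have z: "Z p1 s - Z p2 s = oriented_integral (g ?p) s" for s
      unfolding Z_def gd by (subst oid[OF gi[OF pc] gi[OF pc]]) simp
    have cp: "continuous_on UNIV ?p" by (intro continuous_intros) auto
    have "\<bar>Z p1 s - Z p2 s\<bar> \<le> M * dist p1 p2 / L * exp (L * \<bar>s\<bar>)" for s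
      unfolding z using oriented_integral_bound[OF gi[OF cp] L gb[OF d]] .
    then have "\<bar>oriented_integral (\<lambda>s. Z p1 s - Z p2 s) x\<bar> \<le> M * dist p1 p2 / L / L * exp (L * \<bar>x\<bar>)"
      by (intro oriented_integral_bound L) (auto intro!: integrable_diff Zi)
    then have "\<bar>Y p1 x - Y p2 x\<bar> \<le> M * dist p1 p2 / L / L * exp (L * \<bar>x\<bar>)"
      unfolding Y_def by (subst (asm) oid[OF Zi[OF pc] Zi[OF pc]]) simp
    then have "exp (- (L * \<bar>x\<bar>)) * \<bar>Y p1 x - Y p2 x\<bar> \<le> exp (- (L * \<bar>x\<bar>)) * (M * dist p1 p2 / L / L * exp (L * \<bar>x\<bar>))"
      by (intro mult_left_mono) auto
    also have "\<dots> = M * dist p1 p2 / L / L * (exp (- (L * \<bar>x\<bar>)) * exp (L * \<bar>x\<bar>))" by (simp only: mult_ac)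
    also have "exp (- (L * \<bar>x\<bar>)) * \<bar>Y p1 x - Y p2 x\<bar> = \<bar>F p1 x - F p2 x\<bar>"
      unfolding F_def right_diff_distrib[symmetric] abs_mult by simp
    finally have "\<bar>F p1 x - F p2 x\<bar> \<le> M * dist p1 p2 / L / L" by (simp add: exp_add[symmetric])
    then show "dist (T p1 x) (T p2 x) \<le> M / L / L * dist p1 p2"
      unfolding T by (simp add: dist_real_def field_simps)
  qed
  moreover have "M / L / L < 1" "0 \<le> M / L / L"
  proof -
    have "M < L" "1 \<le> L" using M by (auto simp: L_def)
    then have "M < L * L" using mult_mono[of 1 L L L] by linarith
    then show "M / L / L < 1" using L by (simp add: field_simps)
  qed (use M L in auto)
  ultimately have "\<exists>!p. T p = p"
    by (intro banach_fix_type[of "M / L / L"]) auto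
  then obtain p where p: "T p = p" by blast
  define y where "y = Y (apply_bcontfun p)"
  define z where "z = Z (apply_bcontfun p)"
  have "apply_bcontfun p x = F p x" for x using T[of p] p by metis
  then have ep: "exp (L * \<bar>t\<bar>) * p t = y t" for t
    by (simp add: F_def y_def mult.assoc[symmetric] exp_add[symmetric])
  show thesis
  proof (rule that)
    show "solves_on UNIV q y z"
      unfolding solves_on_def
    proof safe
      fix x
      show "(y has_real_derivative z x) (at x)"
        unfolding y_def Y_def z_def
        by (auto intro!: derivative_eq_intros oriented_integral_deriv Zc)
    next
      fix a b :: real assume "a \<le> b"
      from oriented_integral_has_integral[OF gi[OF pc] this, of p]
      show "((\<lambda>t. q t * y t) has_integral z b - z a) {a..b}"
        unfolding z_def Z_def g_def[of "apply_bcontfun p"] ep by simp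
    qed
    show "y 0 = A" "z 0 = B" by (auto simp: y_def Y_def z_def Z_def oriented_integral_def)
  qed
qed

lemma measurable_affine_lebesgue:
  fixes q :: "real \<Rightarrow> real"
  assumes "q \<in> borel_measurable lebesgue" "m \<noteq> 0"
  shows "(\<lambda>x. q (m * x + c)) \<in> borel_measurable lebesgue"
  using borel_measurable_affine[OF assms(1) assms(2), of c] assms by (simp add: mult.commute add.commute)

lemma solution_exists:
  assumes q: "q \<in> borel_measurable lebesgue" "\<And>x. \<bar>q x\<bar> \<le> M"
  obtains y z where "solves_on UNIV q y z" "y a = A" "z a = B"
proof -
  have "(\<lambda>x. q (x + a)) \<in> borel_measurable lebesgue"
    using measurable_affine_lebesgue[OF q(1), of 1 a] by simp
  then obtain y z where s: "solves_on UNIV (\<lambda>x. q (x + a)) y z" "y 0 = A" "z 0 = B"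
    using q(2) solution_exists_at_0[of "\<lambda>x. q (x + a)" M] by metis
  show thesis
  proof (rule that)
    show "solves_on UNIV q (\<lambda>x. y (x - a)) (\<lambda>x. z (x - a))"
      using solves_on_affine[OF s(1), of 1 "-a"] by simp
  qed (use s in auto)
qed

section \<open>Smooth step functions\<close>

lemma poly_mult_exp_tendsto_0:
  fixes p :: "real poly"
  shows "((\<lambda>u. poly p u * exp (- u)) \<longlongrightarrow> 0) at_top"
proof -
  have "((\<lambda>u. \<Sum>i\<le>degree p. coeff p i * (u ^ i / exp u)) \<longlongrightarrow> (\<Sum>i\<le>degree p. coeff p i * 0)) at_top"
    by (intro tendsto_intros tendsto_power_div_exp_0)
  then show ?thesis
    by (simp add: poly_altdef sum_distrib_right exp_minus divide_inverse mult.assoc)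
qed

text \<open>The functions \<open>p (1 / x) exp (- 1 / x)\<close>, continued by zero, form a class closed under
  differentiation; \<open>p = 1\<close> is the classical example of a smooth function that is not analytic.\<close>
definition flat_exp :: "real poly \<Rightarrow> real \<Rightarrow> real" where
  "flat_exp p x = (if x > 0 then poly p (1 / x) * exp (- (1 / x)) else 0)"

lemma flat_exp_deriv:
  "(flat_exp p has_real_derivative flat_exp (pCons 0 (pCons 0 (p - pderiv p))) x) (at x)"
proof -
  consider "x < 0" | "x > 0" | "x = 0" by linarith
  then show ?thesis
  proof cases
    case 1
    have "((\<lambda>_. 0::real) has_real_derivative 0) (at x)" by simp
    then have "(flat_exp p has_real_derivative 0) (at x)"
      by (rule has_field_derivative_transform_within_open[where S="{..<0}"])
        (use 1 in \<open>auto simp: flat_exp_def\<close>)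
    then show ?thesis using 1 by (simp add: flat_exp_def)
  next
    case 2
    have "((\<lambda>x. poly p (1 / x) * exp (- (1 / x))) has_real_derivative
        poly (pCons 0 (pCons 0 (p - pderiv p))) (1 / x) * exp (- (1 / x))) (at x)"
      using 2 by (auto intro!: derivative_eq_intros DERIV_chain2[OF poly_DERIV] simp: field_simps power2_eq_square)
    then have "(flat_exp p has_real_derivative
        poly (pCons 0 (pCons 0 (p - pderiv p))) (1 / x) * exp (- (1 / x))) (at x)"
      by (rule has_field_derivative_transform_within_open[where S="{0<..}"])
        (use 2 in \<open>auto simp: flat_exp_def\<close>)
    then show ?thesis using 2 by (simp add: flat_exp_def)
  next
    case 3
    have "((\<lambda>h. flat_exp p h / h) \<longlongrightarrow> 0) (at 0)"
    proof (rule filterlim_split_at)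
      have "((\<lambda>h. 0::real) \<longlongrightarrow> 0) (at_left 0)" by simp
      then show "((\<lambda>h. flat_exp p h / h) \<longlongrightarrow> 0) (at_left 0)"
        by (rule Lim_transform_eventually) (auto simp: flat_exp_def eventually_at_filter)
      have "((\<lambda>h. poly (pCons 0 p) (inverse h) * exp (- inverse h)) \<longlongrightarrow> 0) (at_right 0)"
        by (rule filterlim_compose[OF poly_mult_exp_tendsto_0 filterlim_inverse_at_top_right])
      then show "((\<lambda>h. flat_exp p h / h) \<longlongrightarrow> 0) (at_right 0)"
        by (rule Lim_transform_eventually)
          (auto simp: flat_exp_def eventually_at_filter inverse_eq_divide field_simps)
    qed
    then show ?thesis using 3 by (simp add: has_field_derivative_iff flat_exp_def)
  qed
qed

text \<open>A class of functions closed under differentiation, hence consisting of smooth functions. The last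
  rule admits the primitives of a bump, from which the test functions below are built.\<close>
inductive smooth_class :: "(real \<Rightarrow> real) \<Rightarrow> bool" where
  bump: "smooth_class (\<lambda>x. flat_exp p x * flat_exp r (1 - x))"
| add: "smooth_class f \<Longrightarrow> smooth_class g \<Longrightarrow> smooth_class (\<lambda>x. f x + g x)"
| scale: "smooth_class f \<Longrightarrow> smooth_class (\<lambda>x. c * f x)"
| affine: "smooth_class f \<Longrightarrow> smooth_class (\<lambda>x. f (m * x + c))"
| primitive: "smooth_class f \<Longrightarrow> (\<And>x. (F has_real_derivative f x) (at x)) \<Longrightarrow> smooth_class F"

lemma smooth_class_deriv:
  assumes "smooth_class f"
  shows "\<exists>f'. smooth_class f' \<and> (\<forall>x. (f has_real_derivative f' x) (at x))"
  using assms
proof induction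
  case (bump p r)
  let ?d = "\<lambda>p. pCons 0 (pCons 0 (p - pderiv p))"
  have r: "((\<lambda>x. flat_exp r (1 - x)) has_real_derivative - flat_exp (?d r) (1 - x)) (at x)" for x
  proof -
    have e: "(-1) * x + 1 = 1 - x" for x :: real by simp
    have "(flat_exp r has_real_derivative flat_exp (?d r) (1 - x)) (at ((-1) * x + 1))"
      unfolding e by (rule flat_exp_deriv)
    from DERIV_compose_affine[where f="flat_exp r" and m="-1" and c=1, OF this, unfolded e] show ?thesis by simp
  qed
  have "smooth_class (\<lambda>x. flat_exp (?d p) x * flat_exp r (1 - x) + (-1) * (flat_exp p x * flat_exp (?d r) (1 - x)))"
    by (rule smooth_class.add[OF smooth_class.bump smooth_class.scale[OF smooth_class.bump]])
  moreover have "((\<lambda>x. flat_exp p x * flat_exp r (1 - x)) has_real_derivative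
      flat_exp (?d p) x * flat_exp r (1 - x) + (-1) * (flat_exp p x * flat_exp (?d r) (1 - x))) (at x)" for x
    using DERIV_mult[OF flat_exp_deriv[of p x] r[of x]] by (simp add: mult.commute)
  ultimately show ?case by blast
next
  case (add f g)
  then obtain f' g' where "smooth_class f'" "smooth_class g'"
    "\<And>x. (f has_real_derivative f' x) (at x)" "\<And>x. (g has_real_derivative g' x) (at x)" by blast
  then show ?case by (intro exI[of _ "\<lambda>x. f' x + g' x"]) (auto intro: smooth_class.add DERIV_add)
next
  case (scale f c)
  then obtain f' where "smooth_class f'" "\<And>x. (f has_real_derivative f' x) (at x)" by blast
  then show ?case by (intro exI[of _ "\<lambda>x. c * f' x"]) (auto intro: smooth_class.scale DERIV_cmult)
next
  case (affine f m c)
  then obtain f' where f': "smooth_class f'" "\<And>x. (f has_real_derivative f' x) (at x)" by blast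
  have "((\<lambda>x. f (m * x + c)) has_real_derivative m * f' (m * x + c)) (at x)" for x
    by (rule DERIV_compose_affine, rule f'(2))
  moreover have "smooth_class (\<lambda>x. m * f' (m * x + c))" by (rule smooth_class.scale[OF smooth_class.affine[OF f'(1)]])
  ultimately show ?case by blast
qed blast

lemma smooth_class_differentiable:
  assumes "smooth_class f"
  shows "((deriv ^^ k) f) field_differentiable (at x)"
proof -
  have "smooth_class ((deriv ^^ k) f)"
  proof (induction k)
    case (Suc k)
    obtain f' where f': "smooth_class f'" "\<And>x. ((deriv ^^ k) f has_real_derivative f' x) (at x)"
      using smooth_class_deriv[OF Suc] by blast
    then have "deriv ((deriv ^^ k) f) = f'" by (auto intro: DERIV_imp_deriv)
    then show ?case using f' by simp
  qed (use assms in auto)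
  then show ?thesis using smooth_class_deriv field_differentiable_def by blast
qed

lemma smooth_class_test_function:
  assumes "smooth_class \<psi>" "\<And>x. x \<notin> {a..b} \<Longrightarrow> \<psi> x = 0" "{a..b} \<subseteq> \<Omega>"
  shows "test_function \<Omega> \<psi>"
proof -
  have "closure {x. \<psi> x \<noteq> 0} \<subseteq> {a..b}"
  proof (rule closure_minimal)
    show "{x. \<psi> x \<noteq> 0} \<subseteq> {a..b}" using assms(2) by blast
  qed simp
  moreover from this have "compact (closure {x. \<psi> x \<noteq> 0})"
    by (metis bounded_closed_interval bounded_subset closed_closure compact_eq_bounded_closed)
  ultimately show ?thesis
    unfolding test_function_def using smooth_class_differentiable[OF assms(1)] assms(3) by blast
qed

text \<open>\<open>h\<close> is a normalised bump on \<open>[0, 1]\<close>, \<open>H\<close> a smooth step with derivative \<open>h\<close>, and \<open>K\<close> a primitive of \<open>H\<close>.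
  A difference of rescaled copies of \<open>H\<close> is a test function close to an indicator function; a suitable
  combination of copies of \<open>K\<close> is a test function whose derivative is close to a difference of two
  normalised indicator functions.\<close>
lemma smooth_step:
  obtains h H K :: "real \<Rightarrow> real" where
    "smooth_class h" "\<And>x. (H has_real_derivative h x) (at x)" "\<And>x. (K has_real_derivative H x) (at x)"
    "\<And>x. h x \<ge> 0" "\<And>x. x \<notin> {0..1} \<Longrightarrow> h x = 0"
    "\<And>x. x \<le> 0 \<Longrightarrow> H x = 0" "\<And>x. x \<ge> 1 \<Longrightarrow> H x = 1" "\<And>x. 0 \<le> H x" "\<And>x. H x \<le> 1"
    "\<And>x. x \<le> 0 \<Longrightarrow> K x = 0" "\<And>x. x \<ge> 1 \<Longrightarrow> K x = K 1 + x - 1"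
proof -
  define b where "b x = flat_exp 1 x * flat_exp 1 (1 - x)" for x
  have sb: "smooth_class b" unfolding b_def by (rule smooth_class.bump)
  have sc: "continuous_on A f" if "smooth_class f" for f A
    using smooth_class_deriv[OF that] by (meson DERIV_isCont continuous_at_imp_continuous_on)
  have b0: "b x \<ge> 0" for x by (simp add: b_def flat_exp_def)
  have bz: "b x = 0" if "x \<notin> {0<..<1}" for x using that by (auto simp: b_def flat_exp_def)
  have prim: "\<exists>F. (\<forall>x. (F has_real_derivative f x) (at x)) \<and> (\<forall>x\<le>0. F x = 0)"
    if "continuous_on UNIV f" "\<And>x. x \<le> 0 \<Longrightarrow> f x = 0" for f :: "real \<Rightarrow> real"
  proof -
    define F where "F x = integral {0..x} f" for x
    have c: "continuous_on {a..b} f" for a b using that continuous_on_subset by blast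
    have eq: "F x = integral {-t..x} f" if "0 < t" "-t < x" for x t
    proof (cases "x \<ge> 0")
      case True
      have "integral {-t..0} f = integral {-t..0} (\<lambda>_. 0)"
        by (rule Henstock_Kurzweil_Integration.integral_cong) (use \<open>\<And>x. x \<le> 0 \<Longrightarrow> f x = 0\<close> in auto)
      then show ?thesis
        unfolding F_def using Henstock_Kurzweil_Integration.integral_combine[of "-t" 0 x f] True that
          integrable_continuous_real[OF c] by simp
    next
      case False
      have "integral {-t..x} f = integral {-t..x} (\<lambda>_. 0)"
        by (rule Henstock_Kurzweil_Integration.integral_cong) (use False \<open>\<And>x. x \<le> 0 \<Longrightarrow> f x = 0\<close> in auto)
      then show ?thesis using False by (simp add: F_def)
    qed
    have "(F has_real_derivative f x) (at x)" for x
    proof -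
      define t where "t = \<bar>x\<bar> + 1"
      have t: "0 < t" "-t < x" "x < t" by (auto simp: t_def)
      have "((\<lambda>x. integral {-t..x} f) has_real_derivative f x) (at x within {-t..t})"
        by (rule integral_has_real_derivative[OF c]) (use t in auto)
      then have "((\<lambda>x. integral {-t..x} f) has_real_derivative f x) (at x)"
        using at_within_Icc_at t by metis
      then show ?thesis
        by (rule has_field_derivative_transform_within_open[where S="{-t<..}"]) (use t eq[OF t(1)] in auto)
    qed
    moreover have "F x = 0" if "x \<le> 0" for x using that by (cases "x = 0") (auto simp: F_def)
    ultimately show ?thesis by blast
  qed
  obtain H0 where H0: "\<And>x. (H0 has_real_derivative b x) (at x)" "\<And>x. x \<le> 0 \<Longrightarrow> H0 x = 0"
    using prim[OF sc[OF sb]] bz by fastforce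
  have mono: "H0 x \<le> H0 y" if "x \<le> y" for x y
    using DERIV_nonneg_imp_nondecreasing[OF that] H0(1) b0 by blast
  have pos: "H0 1 > 0"
  proof -
    have "H0 (1/4) < H0 (3/4)"
      by (rule DERIV_pos_imp_increasing[of "1/4" "3/4" H0])
        (use H0(1) in \<open>force simp: b_def flat_exp_def\<close>)+
    then show ?thesis using mono[of "3/4" 1] mono[of 0 "1/4"] H0(2)[of 0] by simp
  qed
  have const: "H0 x = H0 1" if "x \<ge> 1" for x
  proof (cases "x = 1")
    case False
    then have "1 < x" using that by simp
    have "\<forall>y. 1 < y \<and> y < x \<longrightarrow> (H0 has_real_derivative 0) (at y)"
      using H0(1) bz by (metis greaterThanLessThan_iff less_asym)
    moreover have "continuous_on {1..x} H0" by (meson DERIV_isCont H0(1) continuous_at_imp_continuous_on)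
    ultimately show ?thesis using DERIV_isconst_end[OF \<open>1 < x\<close>, of H0] by blast
  qed auto
  define c where "c = inverse (H0 1)"
  define h where "h x = c * b x" for x
  define H where "H x = c * H0 x" for x
  have c: "c > 0" "c * H0 1 = 1" using pos by (auto simp: c_def)
  have sh: "smooth_class h" unfolding h_def by (intro smooth_class.scale sb)
  have Hh: "(H has_real_derivative h x) (at x)" for x unfolding H_def h_def by (intro DERIV_cmult H0)
  have sH: "smooth_class H" using smooth_class.primitive[OF sh Hh] .
  have Hz: "H x = 0" if "x \<le> 0" for x using H0(2) that by (simp add: H_def)
  have H1: "H x = 1" if "x \<ge> 1" for x using const[OF that] c by (simp add: H_def)
  have Hm: "H x \<le> H y" if "x \<le> y" for x y using mono[OF that] c by (simp add: H_def)
  obtain K where K: "\<And>x. (K has_real_derivative H x) (at x)" "\<And>x. x \<le> 0 \<Longrightarrow> K x = 0"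
    using prim[OF sc[OF sH]] Hz by fastforce
  have K1: "K x = K 1 + x - 1" if "x \<ge> 1" for x
  proof (cases "x = 1")
    case False
    then have "1 < x" using that by simp
    have D: "((\<lambda>y. K y - y) has_real_derivative H y - 1) (at y)" for y
      by (auto intro!: derivative_eq_intros K)
    have "\<forall>y. 1 < y \<and> y < x \<longrightarrow> ((\<lambda>y. K y - y) has_real_derivative 0) (at y)"
      using D H1 by (metis diff_self less_imp_le)
    moreover have "continuous_on {1..x} (\<lambda>y. K y - y)" using D by (meson DERIV_isCont continuous_at_imp_continuous_on)
    ultimately have "K x - x = K 1 - 1" using DERIV_isconst_end[OF \<open>1 < x\<close>, of "\<lambda>y. K y - y"] by blast
    then show ?thesis by simp
  qed auto
  show thesis
  proof (rule that[OF sh Hh K(1)])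
    show "0 \<le> H x" "H x \<le> 1" for x
      using Hm[of 0 x] Hm[of x 1] Hz[of x] Hz[of 0] H1[of x] H1[of 1] by linarith+
    show "0 \<le> h x" for x using b0 c by (simp add: h_def)
    show "h x = 0" if "x \<notin> {0..1}" for x using bz[of x] that by (auto simp: h_def)
  qed (fact Hz H1 K K1)+
qed

section \<open>Weak derivatives and primitives\<close>

lemma integrable_scaleR_test:
  fixes f :: "real \<Rightarrow> 'a::{banach, second_countable_topology}"
  assumes "set_integrable lebesgue K f" "compact K" "continuous_on UNIV \<psi>" "\<And>x. x \<notin> K \<Longrightarrow> \<psi> x = 0"
  shows "integrable lebesgue (\<lambda>x. \<psi> x *\<^sub>R f x)"
proof -
  obtain C where C: "\<And>x. x \<in> K \<Longrightarrow> \<bar>\<psi> x\<bar> \<le> C"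
  proof -
    have "bounded (\<psi> ` K)"
      using assms(2,3) by (meson compact_continuous_image compact_imp_bounded continuous_on_subset subset_UNIV)
    then show ?thesis using that unfolding bounded_iff by auto
  qed
  have int: "integrable lebesgue (\<lambda>x. indicator K x *\<^sub>R f x)" using assms(1) by (simp add: set_integrable_def)
  have eq: "\<psi> x *\<^sub>R f x = \<psi> x *\<^sub>R (indicator K x *\<^sub>R f x)" for x
    using assms(4)[of x] by (cases "x \<in> K") auto
  have "\<psi> \<in> borel_measurable lebesgue"
    using borel_measurable_continuous_onI[OF assms(3)] by (simp add: measurable_completion)
  then have "(\<lambda>x. \<psi> x *\<^sub>R (indicator K x *\<^sub>R f x)) \<in> borel_measurable lebesgue"
    by (rule borel_measurable_scaleR) (use int in \<open>blast intro: borel_measurable_integrable\<close>)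
  then show ?thesis unfolding eq
  proof (rule Bochner_Integration.integrable_bound[rotated])
    show "integrable lebesgue (\<lambda>x. C * norm (indicator K x *\<^sub>R f x))"
      by (rule integrable_mult_right[OF integrable_norm[OF int]])
    have "norm (\<psi> x *\<^sub>R (indicator K x *\<^sub>R f x)) \<le> norm (C * norm (indicator K x *\<^sub>R f x))" for x
      using C[of x] by (cases "x \<in> K") (auto intro!: mult_mono simp: abs_mult)
    then show "AE x in lebesgue. norm (\<psi> x *\<^sub>R (indicator K x *\<^sub>R f x)) \<le> norm (C * norm (indicator K x *\<^sub>R f x))"
      by blast
  qed
qed

lemma test_function_continuous: "test_function \<Omega> \<psi> \<Longrightarrow> continuous_on A \<psi>"
  and test_function_deriv: "test_function \<Omega> \<psi> \<Longrightarrow> (\<psi> has_real_derivative deriv \<psi> x) (at x)"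
  and test_function_deriv_continuous: "test_function \<Omega> \<psi> \<Longrightarrow> continuous_on A (deriv \<psi>)"
proof -
  assume t: "test_function \<Omega> \<psi>"
  have 0: "\<psi> field_differentiable (at x)" for x using t[unfolded test_function_def] by (metis funpow_0)
  have 1: "deriv \<psi> field_differentiable (at x)" for x using t[unfolded test_function_def]
    by (metis funpow_0 funpow_simps_right(2) o_apply)
  show "continuous_on A \<psi>" "continuous_on A (deriv \<psi>)"
    by (auto intro!: continuous_at_imp_continuous_on field_differentiable_imp_continuous_at 0 1)
  show "(\<psi> has_real_derivative deriv \<psi> x) (at x)" by (simp add: DERIV_deriv_iff_field_differentiable 0)
qed

lemma test_function_support:
  assumes "test_function \<Omega> \<psi>"
  obtains K where "compact K" "K \<subseteq> \<Omega>" "\<And>x. x \<notin> K \<Longrightarrow> \<psi> x = 0" "\<And>x. x \<notin> K \<Longrightarrow> deriv \<psi> x = 0"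
proof -
  define K where "K = closure {x. \<psi> x \<noteq> 0}"
  have "{x. \<psi> x \<noteq> 0} \<subseteq> K" unfolding K_def by (rule closure_subset)
  then have z: "\<psi> x = 0" if "x \<notin> K" for x using that by blast
  have K: "compact K" "K \<subseteq> \<Omega>" using assms by (auto simp: test_function_def K_def)
  have "deriv \<psi> x = 0" if x: "x \<notin> K" for x
  proof -
    have "((\<lambda>_. 0::real) has_real_derivative 0) (at x)" by simp
    then have "(\<psi> has_real_derivative 0) (at x)"
    proof (rule has_field_derivative_transform_within_open[where S="- K"])
      show "open (- K)" using K(1) by (simp add: compact_imp_closed open_Compl)
    qed (use x z in force)+
    then show ?thesis by (rule DERIV_imp_deriv)
  qed
  with K z show thesis by (rule that)
qed

lemma LINT_test:
  fixes f :: "real \<Rightarrow> real"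
  assumes "set_integrable lebesgue {a..b} f" "continuous_on UNIV \<psi>" "\<And>x. x \<notin> {a..b} \<Longrightarrow> \<psi> x = 0"
  shows "(LINT x|lebesgue. \<psi> x *\<^sub>R f x) = integral {a..b} (\<lambda>x. \<psi> x * f x)"
proof -
  have "integrable lebesgue (\<lambda>x. \<psi> x *\<^sub>R f x)" by (rule integrable_scaleR_test) (use assms in auto)
  moreover have eq: "indicator {a..b} x *\<^sub>R (\<psi> x * f x) = \<psi> x *\<^sub>R f x" for x
    using assms(3)[of x] by (cases "x \<in> {a..b}") auto
  ultimately have "set_integrable lebesgue {a..b} (\<lambda>x. \<psi> x * f x)"
    unfolding set_integrable_def eq by blast
  from set_lebesgue_integral_eq_integral(2)[OF this] show ?thesis
    unfolding set_lebesgue_integral_def eq .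
qed

lemma weak_derivative_on_bounded_linear:
  fixes \<phi> g :: "real \<Rightarrow> 'a::{banach, second_countable_topology}"
    and T :: "'a \<Rightarrow> 'b::{banach, second_countable_topology}"
  assumes w: "weak_derivative_on \<Omega> \<phi> g" and T: "bounded_linear T"
  shows "weak_derivative_on \<Omega> (\<lambda>x. T (\<phi> x)) (\<lambda>x. T (g x))"
proof -
  interpret bounded_linear T by fact
  have li: "locally_integrable_on \<Omega> (\<lambda>x. T (f x))" if "locally_integrable_on \<Omega> f" for f
    unfolding locally_integrable_on_def
  proof safe
    fix K :: "real set" assume "compact K" "K \<subseteq> \<Omega>"
    then have "set_integrable lebesgue K f" using that by (auto simp: locally_integrable_on_def)
    from integrable_bounded_linear[OF T this[unfolded set_integrable_def]]
    show "set_integrable lebesgue K (\<lambda>x. T (f x))" by (simp add: set_integrable_def scaleR)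
  qed
  have "(LINT x|lebesgue. deriv \<psi> x *\<^sub>R T (\<phi> x)) = - (LINT x|lebesgue. \<psi> x *\<^sub>R T (g x))"
    if t: "test_function \<Omega> \<psi>" for \<psi>
  proof -
    obtain K where K: "compact K" "K \<subseteq> \<Omega>" "\<And>x. x \<notin> K \<Longrightarrow> \<psi> x = 0" "\<And>x. x \<notin> K \<Longrightarrow> deriv \<psi> x = 0"
      using test_function_support[OF t] by metis
    have i1: "integrable lebesgue (\<lambda>x. deriv \<psi> x *\<^sub>R \<phi> x)" and i2: "integrable lebesgue (\<lambda>x. \<psi> x *\<^sub>R g x)"
      using w K t by (auto simp: weak_derivative_on_def locally_integrable_on_def
          intro!: integrable_scaleR_test[of K] test_function_continuous test_function_deriv_continuous)
    have "T (LINT x|lebesgue. deriv \<psi> x *\<^sub>R \<phi> x) = T (- (LINT x|lebesgue. \<psi> x *\<^sub>R g x))"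
      using w t by (simp add: weak_derivative_on_def)
    then show ?thesis
      using integral_bounded_linear[OF T i1] integral_bounded_linear[OF T i2] by (simp add: scaleR neg)
  qed
  then show ?thesis using w li by (simp add: weak_derivative_on_def)
qed

lemma locally_integrable_on_cong_AE:
  fixes f f' :: "real \<Rightarrow> 'a::{banach, second_countable_topology}"
  assumes l: "locally_integrable_on \<Omega> f" and ae: "AE x in lebesgue. f x = f' x"
    and m: "f \<in> borel_measurable lebesgue" "f' \<in> borel_measurable lebesgue"
  shows "locally_integrable_on \<Omega> f'"
  unfolding locally_integrable_on_def
proof safe
  fix K :: "real set" assume "compact K" "K \<subseteq> \<Omega>"
  then have "set_integrable lebesgue K f" using l by (auto simp: locally_integrable_on_def)
  moreover have "K \<in> sets lebesgue" using \<open>compact K\<close> by (simp add: compact_imp_closed borel_closed)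
  ultimately show "set_integrable lebesgue K f'"
    by (subst (asm) set_integrable_cong_AE[where g=f']) (use ae m in auto)
qed

lemma LINT_scaleR_cong_AE:
  fixes f f' :: "real \<Rightarrow> 'a::{banach, second_countable_topology}"
  assumes ae: "AE x in lebesgue. f x = f' x" and c: "continuous_on UNIV \<psi>"
    and m: "f \<in> borel_measurable lebesgue" "f' \<in> borel_measurable lebesgue"
  shows "(LINT x|lebesgue. \<psi> x *\<^sub>R f x) = (LINT x|lebesgue. \<psi> x *\<^sub>R f' x)"
proof -
  have "\<psi> \<in> borel_measurable lebesgue"
    using borel_measurable_continuous_onI[OF c] by (simp add: measurable_completion)
  then show ?thesis using ae m by (intro integral_cong_AE) auto
qed

lemma weak_derivative_on_cong_left:
  fixes \<phi> \<phi>' g :: "real \<Rightarrow> 'a::{banach, second_countable_topology}"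
  assumes w: "weak_derivative_on \<Omega> \<phi> g" and ae: "AE x in lebesgue. \<phi> x = \<phi>' x"
    and m: "\<phi> \<in> borel_measurable lebesgue" "\<phi>' \<in> borel_measurable lebesgue"
  shows "weak_derivative_on \<Omega> \<phi>' g"
  using w locally_integrable_on_cong_AE[OF _ ae m, of \<Omega>]
    LINT_scaleR_cong_AE[OF ae test_function_deriv_continuous m]
  unfolding weak_derivative_on_def by metis

lemma weak_derivative_on_cong_right:
  fixes \<phi> g g' :: "real \<Rightarrow> 'a::{banach, second_countable_topology}"
  assumes w: "weak_derivative_on \<Omega> \<phi> g" and ae: "AE x in lebesgue. g x = g' x"
    and m: "g \<in> borel_measurable lebesgue" "g' \<in> borel_measurable lebesgue"
  shows "weak_derivative_on \<Omega> \<phi> g'"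
  using w locally_integrable_on_cong_AE[OF _ ae m, of \<Omega>]
    LINT_scaleR_cong_AE[OF ae test_function_continuous m]
  unfolding weak_derivative_on_def by metis

text \<open>The steps sharpen to the indicator function of \<open>[c, b]\<close> away from the point \<open>c\<close>, where the limit is
  \<open>H e\<close>. The shift \<open>e\<close> decides on which side of \<open>c\<close> the transition takes place, and thereby keeps
  supports inside a prescribed interval.\<close>
lemma step_limit:
  fixes H f :: "real \<Rightarrow> real"
  assumes H: "continuous_on UNIV H" "\<And>x. x \<le> 0 \<Longrightarrow> H x = 0" "\<And>x. x \<ge> 1 \<Longrightarrow> H x = 1" "\<And>x. 0 \<le> H x" "\<And>x. H x \<le> 1"
    and f: "set_integrable lebesgue {a..b} f" and c: "a \<le> c" "c \<le> b"
  shows "(\<lambda>n. integral {a..b} (\<lambda>x. H (real n * (x - c) + e) * f x)) \<longlonglongrightarrow> integral {c..b} f"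
    and "(\<lambda>x. H (m * (x - c) + e) * f x) integrable_on {a..b}"
proof -
  have i: "(\<lambda>x. H (m * (x - c) + e) * f x) integrable_on {a..b}" for m
  proof -
    have "(\<lambda>x. H (m * (x - c) + e) * f x) absolutely_integrable_on {a..b}"
    proof (rule absolutely_integrable_bounded_measurable_product_real[OF _ _ _ f])
      have "continuous_on {a..b} (\<lambda>x. H (m * (x - c) + e))"
        by (intro continuous_on_compose2[OF H(1)] continuous_intros) auto
      then show "(\<lambda>x. H (m * (x - c) + e)) \<in> borel_measurable (lebesgue_on {a..b})"
        by (rule continuous_imp_measurable_on_sets_lebesgue) auto
      show "bounded ((\<lambda>x. H (m * (x - c) + e)) ` {a..b})"
        using H(4,5) by (auto simp: bounded_iff intro!: exI[of _ 1])
    qed auto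
    then show ?thesis using set_lebesgue_integral_eq_integral(1) by blast
  qed
  then show "(\<lambda>x. H (m * (x - c) + e) * f x) integrable_on {a..b}" .
  define g where "g x = (if x < c then 0 else if x = c then H e * f x else f x)" for x
  have "(\<lambda>n. integral {a..b} (\<lambda>x. H (real n * (x - c) + e) * f x)) \<longlonglongrightarrow> integral {a..b} g"
  proof (rule dominated_convergence(2)[where h="\<lambda>x. \<bar>f x\<bar>"])
    show "(\<lambda>x. \<bar>f x\<bar>) integrable_on {a..b}"
      using set_lebesgue_integral_eq_integral(1)[OF set_integrable_norm[OF f]] by simp
    show "norm (H (real n * (x - c) + e) * f x) \<le> \<bar>f x\<bar>" for n x
      using H(4,5)[of "real n * (x - c) + e"] by (simp add: abs_mult mult_left_le_one_le)
    fix x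
    consider "x < c" | "x = c" | "x > c" by linarith
    then show "(\<lambda>n. H (real n * (x - c) + e) * f x) \<longlonglongrightarrow> g x"
    proof cases
      case 1
      obtain N :: nat where N: "real N > e / (c - x)" using reals_Archimedean2 by blast
      have "H (real n * (x - c) + e) * f x = g x" if "n \<ge> N" for n
      proof -
        have "real n \<ge> e / (c - x)" using N that by linarith
        then have "e \<le> real n * (c - x)" using 1 by (simp add: field_simps)
        then have "real n * (x - c) + e \<le> 0" by (simp add: algebra_simps)
        then show ?thesis using H(2) 1 by (simp add: g_def)
      qed
      then show ?thesis by (intro tendsto_eventually) (auto simp: eventually_sequentially)
    next
      case 3
      obtain N :: nat where N: "real N > (1 - e) / (x - c)" using reals_Archimedean2 by blast
      have "H (real n * (x - c) + e) * f x = g x" if "n \<ge> N" for n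
      proof -
        have "real n \<ge> (1 - e) / (x - c)" using N that by linarith
        then have "1 - e \<le> real n * (x - c)" using 3 by (simp add: field_simps)
        then have "real n * (x - c) + e \<ge> 1" by (simp add: algebra_simps)
        then show ?thesis using H(3) 3 by (simp add: g_def)
      qed
      then show ?thesis by (intro tendsto_eventually) (auto simp: eventually_sequentially)
    qed (simp add: g_def)
  qed (rule i)
  also have "integral {a..b} g = integral {a..b} (\<lambda>x. if x \<in> {c..b} then f x else 0)"
    by (rule integral_spike[where S="{c}"]) (use c in \<open>auto simp: g_def\<close>)
  also have "\<dots> = integral {c..b} f"
    using integral_restrict_Int[of "{a..b}" "{c..b}" f] c by (simp add: Int_absorb1)
  finally show "(\<lambda>n. integral {a..b} (\<lambda>x. H (real n * (x - c) + e) * f x)) \<longlonglongrightarrow> integral {c..b} f" .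
qed

lemma plateau_limit:
  fixes H f :: "real \<Rightarrow> real"
  assumes H: "continuous_on UNIV H" "\<And>x. x \<le> 0 \<Longrightarrow> H x = 0" "\<And>x. x \<ge> 1 \<Longrightarrow> H x = 1" "\<And>x. 0 \<le> H x" "\<And>x. H x \<le> 1"
    and f: "set_integrable lebesgue {a..b} f" and c: "a \<le> c" "c \<le> d" "d \<le> b"
  shows "(\<lambda>n. integral {a..b} (\<lambda>x. (H (real n * (x - c)) - H (real n * (x - d) + e)) * f x)) \<longlonglongrightarrow> integral {c..d} f"
proof -
  have "(\<lambda>n. integral {a..b} (\<lambda>x. H (real n * (x - c) + 0) * f x) - integral {a..b} (\<lambda>x. H (real n * (x - d) + e) * f x))
     \<longlonglongrightarrow> integral {c..b} f - integral {d..b} f"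
    using c by (intro tendsto_diff step_limit[OF H f]) auto
  moreover have "integral {c..b} f = integral {c..d} f + integral {d..b} f"
  proof -
    have "f integrable_on {a..b}" using f set_lebesgue_integral_eq_integral(1) by blast
    then have "f integrable_on {c..b}" by (rule integrable_on_subinterval) (use c in auto)
    then show ?thesis using Henstock_Kurzweil_Integration.integral_combine[of c d b f] c by simp
  qed
  moreover have "integral {a..b} (\<lambda>x. H (real n * (x - c) + 0) * f x) - integral {a..b} (\<lambda>x. H (real n * (x - d) + e) * f x)
    = integral {a..b} (\<lambda>x. (H (real n * (x - c)) - H (real n * (x - d) + e)) * f x)" for n
    using step_limit(2)[OF H f, of c "real n" 0] step_limit(2)[OF H f, of d "real n" e] c
    by (subst integral_diff[symmetric]) (auto simp: left_diff_distrib)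
  ultimately show ?thesis by simp
qed

lemma locally_integrable_on_Icc:
  "locally_integrable_on \<Omega> f \<Longrightarrow> {a..b} \<subseteq> \<Omega> \<Longrightarrow> set_integrable lebesgue {a..b} f" for a b :: real
  by (simp add: locally_integrable_on_def)

lemma eventually_real_ge: "\<forall>\<^sub>F n in sequentially. real n \<ge> c"
  using eventually_ge_at_top[of "nat \<lceil>c\<rceil>"] by eventually_elim linarith

lemma smooth_class_continuous: "smooth_class f \<Longrightarrow> continuous_on A f"
  using smooth_class_deriv by (meson DERIV_isCont continuous_at_imp_continuous_on)

lemma smooth_class_diff: "smooth_class f \<Longrightarrow> smooth_class g \<Longrightarrow> smooth_class (\<lambda>x. f x - g x)"
  using smooth_class.add[OF _ smooth_class.scale[of g "-1"], of f] by simp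

lemma smooth_class_rescale: "smooth_class f \<Longrightarrow> smooth_class (\<lambda>x. f (m * (x - c) + e))"
  using smooth_class.affine[of f m "e - m * c"] by (simp add: algebra_simps)

text \<open>Lebesgue differentiation on the countably many intervals with rational end points.\<close>
lemma AE_zero_of_integrals_zero:
  fixes f :: "real \<Rightarrow> real"
  assumes "open \<Omega>" and i: "\<And>a b. {a..b} \<subseteq> \<Omega> \<Longrightarrow> f integrable_on {a..b}"
    and z: "\<And>a b. a \<le> b \<Longrightarrow> {a..b} \<subseteq> \<Omega> \<Longrightarrow> integral {a..b} f = 0"
  shows "AE x in lebesgue. x \<in> \<Omega> \<longrightarrow> f x = 0"
proof -
  have 1: "AE x in lebesgue. a < x \<longrightarrow> x < b \<longrightarrow> f x = 0" if ab: "{a..b} \<subseteq> \<Omega>" for a b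
  proof -
    define F where "F x = (if x \<in> {a..b} then f x else 0)" for x
    have "F integrable_on UNIV" unfolding F_def using i[OF ab] integrable_restrict_UNIV by blast
    then have "F integrable_on cbox c d" for c d using integrable_on_subcbox by blast
    then obtain N where N: "negligible N" "\<And>x e. \<lbrakk>x \<notin> N; 0 < e\<rbrakk> \<Longrightarrow>
               \<exists>d>0. \<forall>h. 0 < h \<and> h < d \<longrightarrow> norm (integral (cbox x (x + h *\<^sub>R One)) F /\<^sub>R h ^ DIM(real) - F x) < e"
      using integrable_ccontinuous_explicit[of F] by metis
    have "f x = 0" if x: "x \<notin> N" "a < x" "x < b" for x
    proof (rule ccontr)
      assume "f x \<noteq> 0"
      then obtain d where d: "d > 0" "\<And>h. 0 < h \<Longrightarrow> h < d \<Longrightarrow> norm (integral {x..x + h} F / h - F x) < \<bar>f x\<bar>"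
        using N(2)[OF x(1), of "\<bar>f x\<bar>"] by (auto simp: divide_inverse mult.commute)
      define h where "h = min (d / 2) ((b - x) / 2)"
      have "h \<le> d / 2" "h \<le> (b - x) / 2" unfolding h_def by (rule min.cobounded1, rule min.cobounded2)
      moreover have "0 < h" using d(1) x unfolding h_def by simp
      ultimately have "0 < h" "h \<le> d / 2" "h \<le> (b - x) / 2" by blast+
      note h0 = this
      have h: "0 < h" "h < d" "x + h < b"
        subgoal using h0 by linarith
        subgoal using h0 d(1) by linarith
        subgoal using h0 x(2,3) by (simp add: field_simps)
        done
      have "integral {x..x + h} F = integral {x..x + h} f"
        by (rule Henstock_Kurzweil_Integration.integral_cong) (use x h in \<open>auto simp: F_def\<close>)
      also have "\<dots> = 0" by (rule z) (use x h ab in auto)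
      finally show False using d(2)[OF h(1,2)] x by (simp add: F_def)
    qed
    then have "{x. \<not> (a < x \<longrightarrow> x < b \<longrightarrow> f x = 0)} \<subseteq> N" by blast
    then have "negligible {x. \<not> (a < x \<longrightarrow> x < b \<longrightarrow> f x = 0)}" using N(1) negligible_subset by blast
    then show ?thesis using eventually_ae_filter_negligible by blast
  qed
  have "AE x in lebesgue. \<forall>p::rat \<times> rat. {real_of_rat (fst p)..real_of_rat (snd p)} \<subseteq> \<Omega> \<longrightarrow>
      real_of_rat (fst p) < x \<longrightarrow> x < real_of_rat (snd p) \<longrightarrow> f x = 0"
    unfolding AE_all_countable
  proof
    fix p :: "rat \<times> rat"
    show "AE x in lebesgue. {real_of_rat (fst p)..real_of_rat (snd p)} \<subseteq> \<Omega> \<longrightarrow>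
      real_of_rat (fst p) < x \<longrightarrow> x < real_of_rat (snd p) \<longrightarrow> f x = 0"
      using 1[of "real_of_rat (fst p)" "real_of_rat (snd p)"]
      by (cases "{real_of_rat (fst p)..real_of_rat (snd p)} \<subseteq> \<Omega>") auto
  qed
  then show ?thesis
  proof eventually_elim
    case (elim x)
    show ?case
    proof
      assume "x \<in> \<Omega>"
      then obtain e where e: "e > 0" "ball x e \<subseteq> \<Omega>" using \<open>open \<Omega>\<close> openE by blast
      have "x - e < x" "x < x + e" using e(1) by auto
      from of_rat_dense[OF this(1)] of_rat_dense[OF this(2)]
      obtain r s where r: "x - e < of_rat r" "of_rat r < x" and s: "x < of_rat s" "of_rat s < x + e"
        by blast
      have "{real_of_rat r..of_rat s} \<subseteq> ball x e" using r s by (auto simp: dist_real_def)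
      then have "{real_of_rat r..of_rat s} \<subseteq> \<Omega>" using e(2) by blast
      then show "f x = 0" using elim[rule_format, of "(r, s)"] r s by auto
    qed
  qed
qed

text \<open>The weak derivative is tested against \<open>\<psi> x = H (n (x - c)) - H (n (x - d) + 1)\<close>, which is supported in
  \<open>[c, d]\<close> and tends to \<open>1\<close> inside. Its derivative is a bump concentrating at \<open>c\<close> minus one concentrating
  at \<open>d\<close>, so that continuity of \<open>w\<close> produces the boundary values in the limit.\<close>
lemma weak_derivative_on_integral:
  fixes w g :: "real \<Rightarrow> real"
  assumes w: "weak_derivative_on \<Omega> w g" and cont: "continuous_on {c..d} w" and cd: "c \<le> d" "{c..d} \<subseteq> \<Omega>"
  shows "(g has_integral w d - w c) {c..d}"
proof (cases "c = d")
  case False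
  then have "c < d" using cd by simp
  obtain h H K :: "real \<Rightarrow> real" where H: "smooth_class h" "\<And>x. (H has_real_derivative h x) (at x)"
    "\<And>x. x \<le> 0 \<Longrightarrow> H x = 0" "\<And>x. x \<ge> 1 \<Longrightarrow> H x = 1" "\<And>x. 0 \<le> H x" "\<And>x. H x \<le> 1"
    and h: "\<And>x. h x \<ge> 0" "\<And>x. x \<notin> {0..1} \<Longrightarrow> h x = 0"
    using smooth_step by metis
  have sH: "smooth_class H" using smooth_class.primitive H by blast
  have wi: "set_integrable lebesgue {c..d} w" and gi: "set_integrable lebesgue {c..d} g"
    using w cd locally_integrable_on_Icc by (auto simp: weak_derivative_on_def)
  have lim_g: "(\<lambda>n. integral {c..d} (\<lambda>x. (H (real n * (x - c)) - H (real n * (x - d) + 1)) * g x)) \<longlonglongrightarrow> integral {c..d} g"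
    by (rule plateau_limit[OF smooth_class_continuous[OF sH] H(3-6) gi]) (use cd in auto)
  \<comment> \<open>the derivative of \<open>H (n (x - a) + e)\<close>, a bump of integral one near \<open>a\<close>\<close>
  define B where "B n a e x = real n * h (real n * (x - a) + e)" for n :: nat and a e x
  have dH: "((\<lambda>x. H (real n * (x - a) + e)) has_real_derivative B n a e x) (at x)" for n a e x
  proof -
    have r: "real n * x + (e - real n * a) = real n * (x - a) + e" for x by (simp add: algebra_simps)
    have "((\<lambda>x. H (real n * x + (e - real n * a))) has_real_derivative
        real n * h (real n * x + (e - real n * a))) (at x)"
      by (rule DERIV_compose_affine) (rule H(2))
    then show ?thesis unfolding r B_def .
  qed
  have Bc: "continuous_on A (B n a e)" for A n a e
    unfolding B_def by (rule smooth_class_continuous[OF smooth_class.scale[OF smooth_class_rescale[OF H(1)]]])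
  have conc: "(\<lambda>n. integral {c..d} (\<lambda>x. B n a e x * w x)) \<longlonglongrightarrow> w a"
    if a: "(a = c \<and> e = 0) \<or> (a = d \<and> e = 1)" for a e
  proof (rule LIMSEQ_I)
    fix r :: real assume r: "r > 0"
    have a_in: "a \<in> {c..d}" using a cd by auto
    obtain \<delta> where \<delta>: "\<delta> > 0" "\<And>x. x \<in> {c..d} \<Longrightarrow> \<bar>x - a\<bar> < \<delta> \<Longrightarrow> \<bar>w x - w a\<bar> < r / 2"
      using cont[unfolded continuous_on_iff, rule_format, OF a_in, of "r / 2"] r by (auto simp: dist_real_def)
    obtain N :: nat where N: "real N > max (1 / (d - c)) (1 / \<delta>)" using reals_Archimedean2 by blast
    show "\<exists>no. \<forall>n\<ge>no. norm (integral {c..d} (\<lambda>x. B n a e x * w x) - w a) < r"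
    proof (intro exI allI impI)
      fix n assume "n \<ge> N"
      then have n: "real n > 1 / (d - c)" "real n > 1 / \<delta>" using N by auto
      then have n': "real n * (d - c) > 1" "real n * \<delta> > 1" "real n > 0"
      proof -
        show "real n * (d - c) > 1" "real n * \<delta> > 1" using n \<open>c < d\<close> \<delta> by (auto simp: field_simps)
        then show "real n > 0" by (cases "n = 0") auto
      qed
      have "(B n a e has_integral H (real n * (d - a) + e) - H (real n * (c - a) + e)) {c..d}"
        by (rule fundamental_theorem_of_calculus[OF cd(1)])
          (use dH has_field_derivative_at_within has_real_derivative_iff_has_vector_derivative in blast)
      moreover have "H (real n * (d - a) + e) - H (real n * (c - a) + e) = 1"
        using a H(3,4) n' by (auto simp: algebra_simps)
      ultimately have B1: "(B n a e has_integral 1) {c..d}" by simp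
      have i1: "(\<lambda>x. B n a e x * (w x - w a)) integrable_on {c..d}"
        by (intro integrable_continuous_real continuous_intros Bc cont)
      have i2: "(\<lambda>x. B n a e x * w x) integrable_on {c..d}"
        by (intro integrable_continuous_real continuous_intros Bc cont)
      have "norm (integral {c..d} (\<lambda>x. B n a e x * (w x - w a))) \<le> integral {c..d} (\<lambda>x. B n a e x * (r / 2))"
      proof (rule integral_norm_bound_integral[OF i1])
        show "(\<lambda>x. B n a e x * (r / 2)) integrable_on {c..d}"
          by (intro integrable_continuous_real continuous_intros Bc)
        fix x assume x: "x \<in> {c..d}"
        have B0: "B n a e x \<ge> 0" using h by (simp add: B_def)
        show "norm (B n a e x * (w x - w a)) \<le> B n a e x * (r / 2)"
        proof (cases "\<bar>x - a\<bar> < \<delta>")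
          case True
          then have "B n a e x * \<bar>w x - w a\<bar> \<le> B n a e x * (r / 2)"
            using \<delta>(2)[OF x] by (intro mult_left_mono B0) simp
          then show ?thesis using B0 by (simp add: abs_mult)
        next
          case False
          have "real n * (x - a) + e \<notin> {0..1}"
          proof -
            have "real n * \<delta> \<le> real n * \<bar>x - a\<bar>" using False by (intro mult_left_mono) auto
            then have "real n * \<bar>x - a\<bar> > 1" using n' by linarith
            then show ?thesis using a x by (auto simp: abs_if algebra_simps split: if_splits)
          qed
          then have "B n a e x = 0" using h(2) by (simp add: B_def)
          then show ?thesis by simp
        qed
      qed
      also have "integral {c..d} (\<lambda>x. B n a e x * (r / 2)) = r / 2"
        using integral_unique[OF has_integral_mult_left[OF B1, of "r / 2"]] by simp
      also have "integral {c..d} (\<lambda>x. B n a e x * (w x - w a)) = integral {c..d} (\<lambda>x. B n a e x * w x) - w a"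
        using integral_unique[OF has_integral_diff[OF integrable_integral[OF i2] has_integral_mult_left[OF B1, of "w a"]]]
        by (simp add: right_diff_distrib)
      finally show "norm (integral {c..d} (\<lambda>x. B n a e x * w x) - w a) < r" using r by simp
    qed
  qed
  have lim_w: "(\<lambda>n. integral {c..d} (\<lambda>x. B n c 0 x * w x) - integral {c..d} (\<lambda>x. B n d 1 x * w x)) \<longlonglongrightarrow> w c - w d"
    by (intro tendsto_diff conc) auto
  have "\<forall>\<^sub>F n in sequentially. integral {c..d} (\<lambda>x. B n c 0 x * w x) - integral {c..d} (\<lambda>x. B n d 1 x * w x)
      = - integral {c..d} (\<lambda>x. (H (real n * (x - c)) - H (real n * (x - d) + 1)) * g x)"
    using eventually_real_ge[of "1 / (d - c)"]
  proof eventually_elim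
    case (elim n)
    define \<psi> where "\<psi> x = H (real n * (x - c) + 0) - H (real n * (x - d) + 1)" for x
    have n: "real n * (d - c) \<ge> 1"
    proof -
      have "0 < d - c" using \<open>c < d\<close> by simp
      from pos_divide_le_eq[OF this, of 1 "real n"] elim show ?thesis by (rule iffD1)
    qed
    have s: "smooth_class \<psi>" unfolding \<psi>_def by (rule smooth_class_diff[OF smooth_class_rescale[OF sH] smooth_class_rescale[OF sH]])
    have out: "\<psi> x = 0 \<and> (real n * (x - c) + 0 \<notin> {0..1} \<or> h (real n * (x - c)) = 0) \<and> real n * (x - d) + 1 \<notin> {0..1}" if "x \<notin> {c..d}" for x
    proof (cases "x < c")
      case True
      have "n \<noteq> 0" using n by (cases "n = 0") auto
      then have "real n * (x - c) < 0" using True by (simp add: mult_pos_neg)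
      moreover have "real n * (x - d) + 1 < 0" using n \<open>real n * (x - c) < 0\<close> by (simp add: algebra_simps)
      ultimately show ?thesis using H(3) by (simp add: \<psi>_def)
    next
      case False
      have "n \<noteq> 0" using n by (cases "n = 0") auto
      then have "x > d" using that False by auto
      have "real n * (x - d) > 0" using \<open>x > d\<close> \<open>n \<noteq> 0\<close> by simp
      moreover from this have "real n * (x - c) > 1" using n by (simp add: algebra_simps)
      ultimately show ?thesis using H(4) by (simp add: \<psi>_def)
    qed
    have d\<psi>: "deriv \<psi> x = B n c 0 x - B n d 1 x" for x
      unfolding \<psi>_def by (intro DERIV_imp_deriv DERIV_diff dH)
    have out': "deriv \<psi> x = 0" if "x \<notin> {c..d}" for x
      using out[OF that] h(2) unfolding d\<psi> B_def by auto
    have cd\<psi>: "continuous_on UNIV (deriv \<psi>)"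
      unfolding d\<psi> using Bc by (intro continuous_on_diff) auto
    have "test_function \<Omega> \<psi>" by (rule smooth_class_test_function[OF s _ cd(2)]) (use out in auto)
    then have "(LINT x|lebesgue. deriv \<psi> x *\<^sub>R w x) = - (LINT x|lebesgue. \<psi> x *\<^sub>R g x)"
      using w by (simp add: weak_derivative_on_def)
    then have "integral {c..d} (\<lambda>x. deriv \<psi> x * w x) = - integral {c..d} (\<lambda>x. \<psi> x * g x)"
      using LINT_test[OF wi cd\<psi> out'] LINT_test[OF gi smooth_class_continuous[OF s]] out by simp
    moreover have "integral {c..d} (\<lambda>x. deriv \<psi> x * w x) = integral {c..d} (\<lambda>x. B n c 0 x * w x) - integral {c..d} (\<lambda>x. B n d 1 x * w x)"
      unfolding d\<psi> left_diff_distrib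
      by (intro integral_diff integrable_continuous_real continuous_intros Bc cont)
    ultimately show ?case by (simp add: \<psi>_def)
  qed
  from iffD2[OF tendsto_cong[OF this] tendsto_minus[OF lim_g]]
  have "(\<lambda>n. integral {c..d} (\<lambda>x. B n c 0 x * w x) - integral {c..d} (\<lambda>x. B n d 1 x * w x)) \<longlonglongrightarrow> - integral {c..d} g" .
  then have "w c - w d = - integral {c..d} g" using LIMSEQ_unique[OF lim_w] by simp
  moreover have "g integrable_on {c..d}" using gi set_lebesgue_integral_eq_integral(1) by blast
  ultimately show ?thesis by (simp add: has_integral_iff)
qed auto

section \<open>Functions with zero weak derivative and half-bound states\<close>

lemma plateau_integrable:
  fixes H f :: "real \<Rightarrow> real"
  assumes H: "continuous_on UNIV H" "\<And>x. x \<le> 0 \<Longrightarrow> H x = 0" "\<And>x. x \<ge> 1 \<Longrightarrow> H x = 1" "\<And>x. 0 \<le> H x" "\<And>x. H x \<le> 1"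
    and f: "set_integrable lebesgue {a..b} f" and c: "a \<le> c" "c \<le> b" "a \<le> d" "d \<le> b"
  shows "(\<lambda>x. (H (m * (x - c)) - H (m * (x - d))) * f x) integrable_on {a..b}"
  using integrable_diff[OF step_limit(2)[OF H f c(1,2), of m 0] step_limit(2)[OF H f c(3,4), of m 0]]
  by (simp add: left_diff_distrib)

text \<open>A form of the du Bois-Reymond lemma. The test function combines four copies of \<open>K\<close> in such a way that its
  derivative tends to the difference of the normalised indicator functions of \<open>[c, c + s]\<close> and
  \<open>[d, d + t]\<close>; the weights \<open>1 / s\<close> and \<open>1 / t\<close> make the linear growth of \<open>K\<close> cancel far to the
  right.\<close>
lemma weak_derivative_zero_average:
  fixes r :: "real \<Rightarrow> real"
  assumes r: "locally_integrable_on UNIV r"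
    and z: "\<And>\<psi>. test_function UNIV \<psi> \<Longrightarrow> (LINT x|lebesgue. deriv \<psi> x *\<^sub>R r x) = 0"
    and st: "s > 0" "t > 0"
  shows "integral {c..c+s} r / s = integral {d..d+t} r / t"
proof -
  obtain h H K :: "real \<Rightarrow> real" where H: "smooth_class h" "\<And>x. (H has_real_derivative h x) (at x)"
    "\<And>x. x \<le> 0 \<Longrightarrow> H x = 0" "\<And>x. x \<ge> 1 \<Longrightarrow> H x = 1" "\<And>x. 0 \<le> H x" "\<And>x. H x \<le> 1"
    and K: "\<And>x. (K has_real_derivative H x) (at x)" "\<And>x. x \<le> 0 \<Longrightarrow> K x = 0" "\<And>x. x \<ge> 1 \<Longrightarrow> K x = K 1 + x - 1"
    using smooth_step by metis
  have sH: "smooth_class H" by (rule smooth_class.primitive[OF H(1,2)])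
  have sK: "smooth_class K" by (rule smooth_class.primitive[OF sH K(1)])
  note cH = smooth_class_continuous[OF sH]
  define a where "a = min c d"
  define b where "b = max (c + s) (d + t) + 1"
  have ab: "a \<le> c" "a \<le> d" "c + s + 1 \<le> b" "d + t + 1 \<le> b" by (auto simp: a_def b_def)
  have ri: "set_integrable lebesgue {a..b} r" by (rule locally_integrable_on_Icc[OF r]) simp
  define A where "A n x = H (real n * (x - c)) - H (real n * (x - (c + s)))" for n :: nat and x
  define B where "B n x = H (real n * (x - d)) - H (real n * (x - (d + t)))" for n :: nat and x
  have limA: "(\<lambda>n. integral {a..b} (\<lambda>x. A n x * r x)) \<longlonglongrightarrow> integral {c..c+s} r"
    unfolding A_def
    using plateau_limit[OF cH H(3-6) ri, of c "c + s" 0] ab st by simp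
  have limB: "(\<lambda>n. integral {a..b} (\<lambda>x. B n x * r x)) \<longlonglongrightarrow> integral {d..d+t} r"
    unfolding B_def
    using plateau_limit[OF cH H(3-6) ri, of d "d + t" 0] ab st by simp
  have iA: "(\<lambda>x. A n x * r x) integrable_on {a..b}" for n
    unfolding A_def by (rule plateau_integrable[OF cH H(3-6) ri]) (use ab st in auto)
  have iB: "(\<lambda>x. B n x * r x) integrable_on {a..b}" for n
    unfolding B_def by (rule plateau_integrable[OF cH H(3-6) ri]) (use ab st in auto)
  have "(\<lambda>n. integral {a..b} (\<lambda>x. A n x * r x) / s - integral {a..b} (\<lambda>x. B n x * r x) / t)
      \<longlonglongrightarrow> integral {c..c+s} r / s - integral {d..d+t} r / t"
    by (intro tendsto_intros limA limB) (use st in auto)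
  moreover have "\<forall>\<^sub>F n in sequentially. integral {a..b} (\<lambda>x. A n x * r x) / s - integral {a..b} (\<lambda>x. B n x * r x) / t = 0"
    using eventually_gt_at_top[of 0]
  proof eventually_elim
    case (elim n)
    then have n: "real n \<ge> 1" by simp
    define \<psi> where "\<psi> x = (1 / (real n * s)) * (K (real n * (x - c) + 0) - K (real n * (x - (c + s)) + 0))
        - (1 / (real n * t)) * (K (real n * (x - d) + 0) - K (real n * (x - (d + t)) + 0))" for x
    have s: "smooth_class \<psi>" unfolding \<psi>_def
      by (rule smooth_class_diff[OF smooth_class.scale[OF smooth_class_diff[OF smooth_class_rescale[OF sK] smooth_class_rescale[OF sK]]]
           smooth_class.scale[OF smooth_class_diff[OF smooth_class_rescale[OF sK] smooth_class_rescale[OF sK]]]])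
    have dK: "((\<lambda>x. K (real n * (x - e) + 0)) has_real_derivative real n * H (real n * (x - e))) (at x)" for e x
      using DERIV_compose_affine[where f=K and m="real n" and c="- real n * e" and D="H (real n * (x - e))" and x=x] K(1)
      by (simp add: algebra_simps)
    have d\<psi>: "deriv \<psi> x = A n x / s - B n x / t" for x
    proof (rule DERIV_imp_deriv)
      have "(\<psi> has_real_derivative
        (1 / (real n * s)) * (real n * H (real n * (x - c)) - real n * H (real n * (x - (c + s))))
        - (1 / (real n * t)) * (real n * H (real n * (x - d)) - real n * H (real n * (x - (d + t))))) (at x)"
        unfolding \<psi>_def by (rule DERIV_diff[OF DERIV_cmult[OF DERIV_diff[OF dK dK]] DERIV_cmult[OF DERIV_diff[OF dK dK]]])
      moreover have "(1 / (real n * s)) * (real n * H (real n * (x - c)) - real n * H (real n * (x - (c + s)))) = A n x / s"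
        "(1 / (real n * t)) * (real n * H (real n * (x - d)) - real n * H (real n * (x - (d + t)))) = B n x / t"
        unfolding A_def B_def right_diff_distrib[symmetric] using n by simp_all
      ultimately show "(\<psi> has_real_derivative A n x / s - B n x / t) (at x)" by simp
    qed
    have out: "\<psi> x = 0 \<and> deriv \<psi> x = 0" if x: "x \<notin> {a..b}" for x
    proof (cases "x < a")
      case True
      have neg: "real n * (x - e) \<le> 0" if "a \<le> e" for e using True that n by (intro mult_nonneg_nonpos) auto
      have "real n * (x - c) \<le> 0" "real n * (x - d) \<le> 0" "real n * (x - (c+s)) \<le> 0" "real n * (x - (d+t)) \<le> 0"
        using ab st by (auto intro!: neg)
      then show ?thesis unfolding d\<psi> A_def B_def \<psi>_def by (simp add: H(3) K(2))
    next
      case False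
      have pos: "real n * (x - e) \<ge> 1" if "e + 1 \<le> b" for e
      proof -
        have xe: "1 \<le> x - e" using False x that by auto
        show ?thesis using mult_mono[OF n xe] by simp
      qed
      have p: "real n * (x - c) \<ge> 1" "real n * (x - d) \<ge> 1" "real n * (x - (c+s)) \<ge> 1" "real n * (x - (d+t)) \<ge> 1"
        using ab st by (auto intro!: pos)
      have "K (real n * (x - c)) - K (real n * (x - (c+s))) = real n * s"
        "K (real n * (x - d)) - K (real n * (x - (d+t))) = real n * t"
        using K(3)[OF p(1)] K(3)[OF p(2)] K(3)[OF p(3)] K(3)[OF p(4)] by (simp_all add: algebra_simps)
      then have "\<psi> x = 0" unfolding \<psi>_def using n st by simp
      moreover have "deriv \<psi> x = 0" unfolding d\<psi> A_def B_def using p by (simp add: H(4))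
      ultimately show ?thesis by simp
    qed
    have "continuous_on UNIV (deriv \<psi>)"
      using smooth_class_deriv[OF s] by (metis DERIV_imp_deriv ext smooth_class_continuous)
    moreover have "test_function UNIV \<psi>" by (rule smooth_class_test_function[OF s]) (use out in auto)
    ultimately have "integral {a..b} (\<lambda>x. deriv \<psi> x * r x) = 0"
      using z LINT_test[OF ri, of "deriv \<psi>"] out by simp
    moreover have "integral {a..b} (\<lambda>x. deriv \<psi> x * r x) = integral {a..b} (\<lambda>x. A n x * r x / s - B n x * r x / t)"
      unfolding d\<psi> by (simp add: left_diff_distrib)
    moreover have "\<dots> = integral {a..b} (\<lambda>x. A n x * r x) / s - integral {a..b} (\<lambda>x. B n x * r x) / t"
      using integral_unique[OF has_integral_diff[OF has_integral_divide[OF integrable_integral[OF iA[of n]], of s]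
          has_integral_divide[OF integrable_integral[OF iB[of n]], of t]]] .
    ultimately show ?case by simp
  qed
  ultimately have "integral {c..c+s} r / s - integral {d..d+t} r / t = 0"
    by (rule LIMSEQ_unique[OF _ tendsto_eventually])
  then show ?thesis by simp
qed

lemma locally_integrable_onI:
  fixes f :: "real \<Rightarrow> real"
  assumes f: "f \<in> borel_measurable lebesgue" and b: "\<And>N. N > 0 \<Longrightarrow> \<exists>C. \<forall>x\<in>{-N..N}. \<bar>f x\<bar> \<le> C"
  shows "locally_integrable_on \<Omega> f"
  unfolding locally_integrable_on_def
proof safe
  fix K :: "real set" assume K: "compact K" "K \<subseteq> \<Omega>"
  then obtain N where N: "N > 0" "\<And>x. x \<in> K \<Longrightarrow> \<bar>x\<bar> \<le> N"
    using compact_imp_bounded bounded_pos by (metis real_norm_def)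
  obtain C where C: "\<And>x. x \<in> {-N..N} \<Longrightarrow> \<bar>f x\<bar> \<le> C" using b N(1) by blast
  have "set_integrable lebesgue {-N..N} f"
  proof (rule measurable_bounded_by_integrable_imp_absolutely_integrable)
    show "f \<in> borel_measurable (lebesgue_on {-N..N})" using f by (simp add: measurable_restrict_space1)
    show "(\<lambda>_. C) integrable_on {-N..N}" by auto
  qed (use C in auto)
  moreover have "K \<in> sets lebesgue" using K(1) by (simp add: compact_imp_closed borel_closed)
  moreover have "K \<subseteq> {-N..N}"
  proof
    fix x assume "x \<in> K" then show "x \<in> {-N..N}" using N(2)[of x] by (simp add: abs_le_iff)
  qed
  ultimately show "set_integrable lebesgue K f" by (rule set_integrable_subset)
qed

lemma continuous_locally_bounded:
  fixes f :: "real \<Rightarrow> real"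
  assumes "continuous_on UNIV f"
  shows "\<exists>C. \<forall>x\<in>{-N..N}. \<bar>f x\<bar> \<le> C"
proof -
  have "continuous_on {-N..N} f" using assms continuous_on_subset by blast
  then show ?thesis by (metis bounded_on_Icc)
qed

lemma continuous_lebesgue_measurable:
  fixes f :: "real \<Rightarrow> real"
  shows "continuous_on UNIV f \<Longrightarrow> f \<in> borel_measurable lebesgue"
  by (simp add: borel_measurable_continuous_onI measurable_completion)

lemma measurable_glued:
  fixes g h :: "real \<Rightarrow> real"
  assumes "g \<in> borel_measurable lebesgue" "h \<in> borel_measurable lebesgue"
  shows "(\<lambda>x. if x < 0 then g x else h x) \<in> borel_measurable lebesgue"
proof (rule measurable_If[OF assms])
  have "{x \<in> space lebesgue. x < (0::real)} = {..<0}" by auto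
  then show "{x \<in> space lebesgue. x < (0::real)} \<in> sets lebesgue" by simp
qed

text \<open>Integration by parts on either side of the origin. The two boundary terms at the origin vanish
  with the test function when \<open>\<Omega>\<close> omits that point, and cancel when the two pieces match there. The
  first case serves the interface operator, the second the operators on the whole line.\<close>
lemma weak_derivative_on_glued:
  fixes F1 F2 f1 f2 :: "real \<Rightarrow> real"
  assumes F1: "\<And>c d. c \<le> d \<Longrightarrow> (f1 has_integral F1 d - F1 c) {c..d}"
    and F2: "\<And>c d. c \<le> d \<Longrightarrow> (f2 has_integral F2 d - F2 c) {c..d}"
    and c: "continuous_on UNIV F1" "continuous_on UNIV F2"
    and m: "f1 \<in> borel_measurable lebesgue" "f2 \<in> borel_measurable lebesgue"
    and b: "\<And>N. \<exists>M. \<forall>x\<in>{-N..N}. \<bar>f1 x\<bar> \<le> M" "\<And>N. \<exists>M. \<forall>x\<in>{-N..N}. \<bar>f2 x\<bar> \<le> M"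
    and match: "0 \<notin> \<Omega> \<or> F1 0 = F2 0"
  shows "weak_derivative_on \<Omega> (\<lambda>x. if x < 0 then F1 x else F2 x) (\<lambda>x. if x < 0 then f1 x else f2 x)"
proof -
  define F where "F x = (if x < 0 then F1 x else F2 x)" for x
  define f where "f x = (if x < 0 then f1 x else f2 x)" for x
  have liF: "locally_integrable_on S F" for S
  proof (rule locally_integrable_onI)
    show "F \<in> borel_measurable lebesgue" unfolding F_def by (intro measurable_glued continuous_lebesgue_measurable c)
    fix N :: real
    obtain C1 where C1: "\<forall>x\<in>{-N..N}. \<bar>F1 x\<bar> \<le> C1" using continuous_locally_bounded[OF c(1)] by blast
    obtain C2 where C2: "\<forall>x\<in>{-N..N}. \<bar>F2 x\<bar> \<le> C2" using continuous_locally_bounded[OF c(2)] by blast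
    show "\<exists>C. \<forall>x\<in>{-N..N}. \<bar>F x\<bar> \<le> C" using C1 C2 unfolding F_def
      by (intro exI[of _ "max C1 C2"]) (auto simp: le_max_iff_disj)
  qed
  have lif: "locally_integrable_on S f" for S
  proof (rule locally_integrable_onI)
    show "f \<in> borel_measurable lebesgue" unfolding f_def by (intro measurable_glued m)
    fix N :: real
    obtain C1 where C1: "\<forall>x\<in>{-N..N}. \<bar>f1 x\<bar> \<le> C1" using b(1) by blast
    obtain C2 where C2: "\<forall>x\<in>{-N..N}. \<bar>f2 x\<bar> \<le> C2" using b(2) by blast
    show "\<exists>C. \<forall>x\<in>{-N..N}. \<bar>f x\<bar> \<le> C" using C1 C2 unfolding f_def
      by (intro exI[of _ "max C1 C2"]) (auto simp: le_max_iff_disj)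
  qed
  have "(LINT x|lebesgue. deriv \<psi> x *\<^sub>R F x) = - (LINT x|lebesgue. \<psi> x *\<^sub>R f x)"
    if t: "test_function \<Omega> \<psi>" for \<psi>
  proof -
    obtain K where K: "compact K" "K \<subseteq> \<Omega>" "\<And>x. x \<notin> K \<Longrightarrow> \<psi> x = 0" "\<And>x. x \<notin> K \<Longrightarrow> deriv \<psi> x = 0"
      using test_function_support[OF t] by metis
    obtain N0 where N0: "\<And>x. x \<in> K \<Longrightarrow> \<bar>x\<bar> \<le> N0" "N0 > 0"
      using compact_imp_bounded[OF K(1)] bounded_pos by (metis real_norm_def)
    define N where "N = N0 + 1"
    have N: "N > 0" using N0 by (simp add: N_def)
    have out: "x \<notin> K" if "x \<notin> {-N<..<N}" for x using N0(1)[of x] that by (auto simp: N_def)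
    have outI: "x \<notin> K" if "x \<notin> {-N..N}" for x using out[of x] that by auto
    have z0: "(\<psi> 0 = 0 \<and> deriv \<psi> 0 = 0) \<or> F1 0 = F2 0" using match K by blast
    have d: "(\<psi> has_real_derivative deriv \<psi> x) (at x)" for x by (rule test_function_deriv[OF t])
    have c\<psi>: "continuous_on A \<psi>" "continuous_on A (deriv \<psi>)" for A
      using test_function_continuous[OF t] test_function_deriv_continuous[OF t] by auto
    have P: "(deriv \<psi> has_integral \<psi> y - \<psi> x) {x..y}" if "x \<le> y" for x y
      by (rule fundamental_theorem_of_calculus[OF that])
        (metis d has_field_derivative_at_within has_real_derivative_iff_has_vector_derivative)
    obtain D where D: "\<And>x. x \<in> {-N..N} \<Longrightarrow> \<bar>deriv \<psi> x\<bar> \<le> D" using bounded_on_Icc[OF c\<psi>(2)] by metis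
    obtain M1 where M1: "\<forall>x\<in>{-N..N}. \<bar>f1 x\<bar> \<le> M1" using b(1) by blast
    obtain M2 where M2: "\<forall>x\<in>{-N..N}. \<bar>f2 x\<bar> \<le> M2" using b(2) by blast
    have I1: "((\<lambda>x. deriv \<psi> x * F1 x + \<psi> x * f1 x) has_integral \<psi> 0 * F1 0 - \<psi> (-N) * F1 (-N)) {-N..0}"
      by (rule product_rule_integral[where M=D and N=M1]) (use P F1 D M1 N in auto)
    have I2: "((\<lambda>x. deriv \<psi> x * F2 x + \<psi> x * f2 x) has_integral \<psi> N * F2 N - \<psi> 0 * F2 0) {0..N}"
      by (rule product_rule_integral[where M=D and N=M2]) (use P F2 D M2 N in auto)
    have "((\<lambda>x. deriv \<psi> x * F x + \<psi> x * f x) has_integral \<psi> 0 * F1 0 - \<psi> (-N) * F1 (-N)) {-N..0}"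
      by (rule has_integral_spike[of "{0}", OF _ _ I1]) (auto simp: F_def f_def)
    moreover have "((\<lambda>x. deriv \<psi> x * F x + \<psi> x * f x) has_integral \<psi> N * F2 N - \<psi> 0 * F2 0) {0..N}"
      by (rule has_integral_spike[of "{0}", OF _ _ I2]) (auto simp: F_def f_def)
    ultimately have "((\<lambda>x. deriv \<psi> x * F x + \<psi> x * f x) has_integral
       (\<psi> 0 * F1 0 - \<psi> (-N) * F1 (-N)) + (\<psi> N * F2 N - \<psi> 0 * F2 0)) {-N..N}"
      by (intro has_integral_combine[of "-N" 0 N]) (use N in auto)
    moreover have "\<psi> N = 0" "\<psi> (-N) = 0" using K(3) out by auto
    ultimately have I: "((\<lambda>x. deriv \<psi> x * F x + \<psi> x * f x) has_integral 0) {-N..N}"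
      using z0 by auto
    have "set_integrable lebesgue {-N..N} F" "set_integrable lebesgue {-N..N} f"
      using liF lif by (auto intro: locally_integrable_on_Icc)
    note si = this
    have L: "(LINT x|lebesgue. deriv \<psi> x *\<^sub>R F x) = integral {-N..N} (\<lambda>x. deriv \<psi> x * F x)"
      "(LINT x|lebesgue. \<psi> x *\<^sub>R f x) = integral {-N..N} (\<lambda>x. \<psi> x * f x)"
      by (rule LINT_test[OF si(1) c\<psi>(2)], use K outI in blast, rule LINT_test[OF si(2) c\<psi>(1)], use K outI in blast)
    have m\<psi>: "\<psi> \<in> borel_measurable (lebesgue_on {-N..N})"
      using c\<psi> by (intro continuous_imp_measurable_on_sets_lebesgue) auto
    have "bounded (\<psi> ` {-N..N})" using c\<psi> compact_Icc compact_continuous_image compact_imp_bounded by blast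
    then have "(\<lambda>x. \<psi> x * f x) integrable_on {-N..N}"
      using absolutely_integrable_bounded_measurable_product_real[OF m\<psi> _ _ si(2)] set_lebesgue_integral_eq_integral(1) by auto
    from has_integral_diff[OF I integrable_integral[OF this]]
    have "((\<lambda>x. deriv \<psi> x * F x) has_integral 0 - integral {-N..N} (\<lambda>x. \<psi> x * f x)) {-N..N}" by simp
    from integral_unique[OF this] show ?thesis using L by simp
  qed
  then show ?thesis using liF[of \<Omega>] lif[of \<Omega>] unfolding F_def f_def weak_derivative_on_def by auto
qed

lemma weak_derivative_on_primitive:
  fixes F f :: "real \<Rightarrow> real"
  assumes F: "\<And>c d. c \<le> d \<Longrightarrow> (f has_integral F d - F c) {c..d}"
    and c: "continuous_on UNIV F" and m: "f \<in> borel_measurable lebesgue" and b: "\<And>N. \<exists>M. \<forall>x\<in>{-N..N}. \<bar>f x\<bar> \<le> M"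
  shows "weak_derivative_on \<Omega> F f"
  using weak_derivative_on_glued[OF F F c c m m b b] by simp

lemma has_real_derivative_of_integral:
  fixes v z :: "real \<Rightarrow> real"
  assumes z: "continuous_on UNIV z" and i: "\<And>c d. c \<le> d \<Longrightarrow> (z has_integral v d - v c) {c..d}"
  shows "(v has_real_derivative z x) (at x)"
proof -
  have "oriented_integral z x = v x - v 0" for x
    unfolding oriented_integral_def using integral_unique[OF i, of 0 x] integral_unique[OF i, of x 0]
    by (cases "x \<ge> 0"; cases "x = 0") auto
  then have "v = (\<lambda>x. v 0 + oriented_integral z x)" by auto
  moreover have "((\<lambda>x. v 0 + oriented_integral z x) has_real_derivative z x) (at x)"
    by (auto intro!: derivative_eq_intros oriented_integral_deriv[OF z])
  ultimately show ?thesis by metis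
qed

text \<open>Subtracting from the weak derivative of \<open>v\<close> a primitive of \<open>V v\<close> leaves a function with zero weak
  derivative, which integrates like a constant \<open>\<beta>\<close>. Hence \<open>v\<close> is the primitive of a continuous
  function.\<close>
lemma half_bound_state_solves:
  assumes V: "V \<in> borel_measurable lebesgue" "\<And>x. \<bar>V x\<bar> \<le> M"
    and v: "half_bound_state V v"
  obtains z where "solves_on UNIV V v z"
proof -
  obtain g where vc: "continuous_on UNIV v" and g: "weak_derivative_on UNIV v g" "weak_derivative_on UNIV g (\<lambda>x. V x * v x)"
    and vb: "bounded (range v)" using v by (auto simp: half_bound_state_def)
  obtain C where C: "\<And>x. \<bar>v x\<bar> \<le> C" using vb by (auto simp: bounded_iff)
  have M: "M \<ge> 0" using V(2)[of 0] by simp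
  have Vm: "(\<lambda>x. V x * v x) \<in> borel_measurable lebesgue"
    using V(1) continuous_lebesgue_measurable[OF vc] by (rule borel_measurable_times)
  have Vb: "\<bar>V x * v x\<bar> \<le> M * C" for x unfolding abs_mult using V(2) C M by (intro mult_mono) auto
  have Vi: "(\<lambda>x. V x * v x) integrable_on {a..b}" for a b by (rule bounded_measurable_integrable[OF Vm Vb])
  define Z where "Z = oriented_integral (\<lambda>x. V x * v x)"
  have Zc: "continuous_on UNIV Z" unfolding Z_def by (rule oriented_integral_continuous[OF Vi])
  have Zi: "((\<lambda>x. V x * v x) has_integral Z d - Z c) {c..d}" if "c \<le> d" for c d
    unfolding Z_def by (rule oriented_integral_has_integral[OF Vi that])
  have Zw: "weak_derivative_on UNIV Z (\<lambda>x. V x * v x)"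
    by (rule weak_derivative_on_primitive[OF Zi Zc Vm], assumption, intro exI[of _ "M * C"] ballI Vb)
  define r where "r x = g x - Z x" for x
  have li: "locally_integrable_on UNIV g" "locally_integrable_on UNIV Z"
    using g(1) Zw by (auto simp: weak_derivative_on_def)
  have lr: "locally_integrable_on UNIV r"
    using li unfolding locally_integrable_on_def r_def by (auto intro: set_integral_diff(1))
  have "(LINT x|lebesgue. deriv \<psi> x *\<^sub>R r x) = 0" if t: "test_function UNIV \<psi>" for \<psi>
  proof -
    obtain K where K: "compact K" "K \<subseteq> UNIV" "\<And>x. x \<notin> K \<Longrightarrow> \<psi> x = 0" "\<And>x. x \<notin> K \<Longrightarrow> deriv \<psi> x = 0"
      using test_function_support[OF t] by metis
    have i: "integrable lebesgue (\<lambda>x. deriv \<psi> x *\<^sub>R g x)" "integrable lebesgue (\<lambda>x. deriv \<psi> x *\<^sub>R Z x)"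
      using li K unfolding locally_integrable_on_def
      by (intro integrable_scaleR_test[of K] test_function_deriv_continuous[OF t]; blast)+
    have "(LINT x|lebesgue. deriv \<psi> x *\<^sub>R r x) = (LINT x|lebesgue. deriv \<psi> x *\<^sub>R g x - deriv \<psi> x *\<^sub>R Z x)"
      unfolding r_def by (simp add: right_diff_distrib)
    also have "\<dots> = (LINT x|lebesgue. deriv \<psi> x *\<^sub>R g x) - (LINT x|lebesgue. deriv \<psi> x *\<^sub>R Z x)"
      by (rule Bochner_Integration.integral_diff[OF i])
    also have "\<dots> = 0" using g(2) Zw t by (simp add: weak_derivative_on_def)
    finally show ?thesis .
  qed
  note zero = this
  have avg: "integral {c..c+s} r / s = integral {0..0+1} r / 1" if "s > 0" for c s
    by (rule weak_derivative_zero_average[OF lr zero that]) simp_all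
  define \<beta> where "\<beta> = integral {0..1} r"
  have ir: "integral {c..d} r = \<beta> * (d - c)" if "c \<le> d" for c d
    using avg[of "d - c" c] that by (cases "c = d") (auto simp: \<beta>_def field_simps)
  define z where "z x = \<beta> + Z x" for x
  have zc: "continuous_on UNIV z" unfolding z_def by (intro continuous_intros Zc)
  have vi: "(z has_integral v d - v c) {c..d}" if cd: "c \<le> d" for c d
  proof -
    have gi: "(g has_integral v d - v c) {c..d}"
      by (rule weak_derivative_on_integral[OF g(1) _ cd]) (use vc continuous_on_subset in blast, simp)
    have "r integrable_on {c..d}"
      using locally_integrable_on_Icc[OF lr] set_lebesgue_integral_eq_integral(1) by blast
    then have "(r has_integral \<beta> * (d - c)) {c..d}" using ir[OF cd] by (metis integrable_integral)
    from has_integral_diff[OF gi this]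
    have "(Z has_integral (v d - v c) - \<beta> * (d - c)) {c..d}" by (simp add: r_def)
    from has_integral_add[OF this has_integral_const_real[of \<beta> c d]]
    have "((\<lambda>x. Z x + \<beta>) has_integral (v d - v c) - \<beta> * (d - c) + (d - c) * \<beta>) {c..d}" using cd by simp
    then show ?thesis by (simp add: z_def[abs_def] add.commute mult.commute)
  qed
  have "solves_on UNIV V v z"
    unfolding solves_on_def
    using has_real_derivative_of_integral[OF zc vi] Zi by (simp add: z_def)
  then show thesis by (rule that)
qed

text \<open>Beyond the support of the potential a solution is affine, and boundedness excludes a nonzero
  slope.\<close>
lemma bounded_solution_const_right:
  assumes s: "solves_on UNIV V v z" and V0: "\<And>x. x \<ge> R \<Longrightarrow> V x = 0" and b: "bounded (range v)"
    and lim: "(v \<longlongrightarrow> l) at_top" and x: "x \<ge> R"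
  shows "v x = l \<and> z x = 0"
proof -
  have zc: "z x = z R" if "x \<ge> R" for x
  proof -
    have "((\<lambda>t. V t * v t) has_integral z x - z R) {R..x}" using solves_onD(2)[OF s that] by simp
    moreover have "((\<lambda>t. V t * v t) has_integral 0) {R..x}"
      by (rule has_integral_is_0) (use V0 in auto)
    ultimately have "z x - z R = 0" by (rule has_integral_unique)
    then show ?thesis by simp
  qed
  have vx: "v x = v R + z R * (x - R)" if "x \<ge> R" for x
  proof -
    have "(z has_integral v x - v R) {R..x}" using solves_on_has_integral_deriv[OF s that] by simp
    moreover have "(z has_integral (x - R) * z R) {R..x}"
    proof (rule has_integral_eq)
      show "((\<lambda>_. z R) has_integral (x - R) * z R) {R..x}"
        using has_integral_const_real[of "z R" R x] that by simp
      show "z R = z t" if "t \<in> {R..x}" for t using zc[of t] that by simp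
    qed
    ultimately have "v x - v R = (x - R) * z R" by (rule has_integral_unique)
    then show ?thesis by (simp add: algebra_simps)
  qed
  obtain C where C: "\<And>x. \<bar>v x\<bar> \<le> C" using b by (auto simp: bounded_iff)
  have z0: "z R = 0"
  proof (rule ccontr)
    assume ne: "z R \<noteq> 0"
    define X where "X = R + (2 * C + 1) / \<bar>z R\<bar>"
    have C0: "C \<ge> 0" using C[of 0] by simp
    then have "X \<ge> R" by (simp add: X_def)
    then have "\<bar>z R * (X - R)\<bar> \<le> 2 * C" using vx[of X] C[of X] C[of R] by linarith
    moreover have "\<bar>z R * (X - R)\<bar> = 2 * C + 1" using ne C0 by (simp add: X_def abs_mult)
    ultimately show False by simp
  qed
  have const: "v x = v R" if "x \<ge> R" for x using vx[OF that] z0 by simp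
  have "\<forall>\<^sub>F x in at_top. v x = v R" using eventually_ge_at_top[of R] by eventually_elim (rule const)
  then have "(v \<longlongrightarrow> v R) at_top" by (rule tendsto_eventually)
  then have "l = v R" using lim tendsto_unique trivial_limit_at_top_linorder by blast
  then show ?thesis using const[OF x] zc[OF x] z0 by simp
qed

lemma bounded_solution_const_left:
  assumes s: "solves_on UNIV V v z" and V0: "\<And>x. x \<le> - R \<Longrightarrow> V x = 0" and b: "bounded (range v)"
    and lim: "(v \<longlongrightarrow> l) at_bot" and x: "x \<le> - R"
  shows "v x = l \<and> z x = 0"
proof -
  have s': "solves_on UNIV (\<lambda>t. V (- t)) (\<lambda>t. v (- t)) (\<lambda>t. - z (- t))" using solves_on_reflect[OF s] by simp
  have "range (\<lambda>t. v (- t)) \<subseteq> range v" by auto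
  then have b': "bounded (range (\<lambda>t. v (- t)))" using b bounded_subset by blast
  have "((\<lambda>t. v (- t)) \<longlongrightarrow> l) at_top" using lim by (simp add: filterlim_at_bot_mirror)
  from bounded_solution_const_right[OF s' _ b' this, of R "-x"] show ?thesis using V0 x by simp
qed

section \<open>Jost solutions\<close>

lemma solves_on_regularity:
  assumes s: "solves_on UNIV q y z" and q: "q \<in> borel_measurable lebesgue" "\<And>x. \<bar>q x\<bar> \<le> M"
  shows "continuous_on UNIV y" "continuous_on UNIV z" "(\<lambda>x. q x * y x) \<in> borel_measurable lebesgue"
    "\<exists>C. \<forall>x\<in>{-N..N}. \<bar>q x * y x\<bar> \<le> C"
proof -
  show cy: "continuous_on UNIV y"
    using solves_onD(1)[OF s] by (meson DERIV_isCont UNIV_I continuous_at_imp_continuous_on)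
  show "continuous_on UNIV z"
  proof (intro continuous_at_imp_continuous_on ballI)
    fix x :: real
    have "continuous_on {x-1..x+1} z" by (rule solves_on_continuous(2)[OF s _ q(2)]) simp
    then show "isCont z x" by (rule continuous_on_interior) auto
  qed
  show "(\<lambda>x. q x * y x) \<in> borel_measurable lebesgue"
    by (rule borel_measurable_times[OF q(1) continuous_lebesgue_measurable[OF cy]])
  obtain C where C: "C \<ge> 0" "\<And>t. t \<in> {-N..N} \<Longrightarrow> \<bar>y t\<bar> \<le> C"
    using bounded_on_Icc[OF continuous_on_subset[OF cy subset_UNIV]] by metis
  have "M \<ge> 0" using q(2)[of 0] by simp
  then have "\<bar>q x * y x\<bar> \<le> M * C" if "x \<in> {-N..N}" for x
    unfolding abs_mult using q(2) C that by (intro mult_mono) auto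
  then show "\<exists>C. \<forall>x\<in>{-N..N}. \<bar>q x * y x\<bar> \<le> C" by blast
qed

text \<open>A potential supported in \<open>[- R, R]\<close>. The bound and the support are required at every point, so that
  estimates of solutions can be made pointwise.\<close>
locale shooting =
  fixes W :: "real \<Rightarrow> real" and R B :: real
  assumes W_meas: "W \<in> borel_measurable lebesgue" and W_bound: "\<And>x. \<bar>W x\<bar> \<le> B"
    and W_supp: "\<And>x. R \<le> \<bar>x\<bar> \<Longrightarrow> W x = 0" and R_pos: "R > 0"
begin

text \<open>The initial data at \<open>- R\<close> are those of \<open>exp (k (x + R))\<close>, so this is the solution that decays to the
  left; it is normalised to equal one at \<open>- R\<close>.\<close>
definition jost_pair :: "real \<Rightarrow> (real \<Rightarrow> real) \<times> (real \<Rightarrow> real)" where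
  "jost_pair k = (SOME p. solves_on UNIV (\<lambda>x. W x + k\<^sup>2) (fst p) (snd p) \<and> fst p (- R) = 1 \<and> snd p (- R) = k)"

definition jost :: "real \<Rightarrow> real \<Rightarrow> real" where "jost k = fst (jost_pair k)"
definition jost' :: "real \<Rightarrow> real \<Rightarrow> real" where "jost' k = snd (jost_pair k)"

lemma B_nonneg: "0 \<le> B" using W_bound[of 0] by simp

lemma pot_bound: "\<bar>W x + k\<^sup>2\<bar> \<le> B + k\<^sup>2"
  using W_bound[of x] abs_triangle_ineq[of "W x" "k\<^sup>2"] by simp

lemma pot_bound_le:
  assumes "0 \<le> k" "k \<le> K" shows "\<bar>W x + k\<^sup>2\<bar> \<le> B + K\<^sup>2"
  using pot_bound[of x k] power_mono[OF assms(2,1), of 2] by linarith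

lemma pot_meas: "(\<lambda>x. W x + k\<^sup>2) \<in> borel_measurable lebesgue"
  using W_meas by simp

lemma jost_solves: "solves_on UNIV (\<lambda>x. W x + k\<^sup>2) (jost k) (jost' k)"
  and jost_init: "jost k (- R) = 1" "jost' k (- R) = k"
proof -
  obtain y z where "solves_on UNIV (\<lambda>x. W x + k\<^sup>2) y z" "y (- R) = 1" "z (- R) = k"
    using solution_exists[OF pot_meas pot_bound] by metis
  then have "\<exists>p. solves_on UNIV (\<lambda>x. W x + k\<^sup>2) (fst p) (snd p) \<and> fst p (- R) = 1 \<and> snd p (- R) = k"
    by (intro exI[of _ "(y, z)"]) simp
  from someI_ex[OF this]
  show "solves_on UNIV (\<lambda>x. W x + k\<^sup>2) (jost k) (jost' k)" "jost k (- R) = 1" "jost' k (- R) = k"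
    unfolding jost_def jost'_def jost_pair_def by blast+
qed

lemma jost_left:
  assumes "x \<le> - R"
  shows "jost k x = exp (k * (x + R)) \<and> jost' k x = k * exp (k * (x + R))"
proof -
  have "jost k x = exp (k * (x - - R)) \<and> jost' k x = k * exp (k * (x - - R))"
    by (rule solution_unique_left[OF jost_solves exp_solves, where a=x and b="-R"])
      (use pot_bound jost_init W_supp assms in auto)
  then show ?thesis by simp
qed

lemmas jost_regularity = solves_on_regularity[OF jost_solves pot_meas pot_bound]
lemmas jost_continuous = jost_regularity(1)
lemmas jost'_continuous = jost_regularity(2)

end

text \<open>\<open>(y y')' = y'\<^sup>2 + q y\<^sup>2\<close>.\<close>
lemma solution_times_derivative_mono:
  assumes s: "solves_on UNIV q y z" and q: "\<And>x. 0 \<le> q x" "\<And>x. \<bar>q x\<bar> \<le> M" and ab: "a \<le> b"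
  shows "y a * z a \<le> y b * z b"
proof -
  have c: "continuous_on {a..b} y" "continuous_on {a..b} z" using solves_on_continuous[OF s _ q(2)] by auto
  obtain C where C: "C \<ge> 0" "\<And>t. t \<in> {a..b} \<Longrightarrow> \<bar>y t\<bar> \<le> C" using bounded_on_Icc[OF c(1)] by metis
  obtain D where D: "\<And>t. t \<in> {a..b} \<Longrightarrow> \<bar>z t\<bar> \<le> D" using bounded_on_Icc[OF c(2)] by metis
  have M: "M \<ge> 0" using q(2)[of 0] by simp
  have "((\<lambda>t. q t * y t * y t + z t * z t) has_integral z b * y b - z a * y a) {a..b}"
  proof (rule product_rule_integral[where M="M * C" and N=D])
    show "\<bar>q t * y t\<bar> \<le> M * C" if "t \<in> {a..b}" for t
      unfolding abs_mult using q(2) C M that by (intro mult_mono) auto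
  qed (use solves_onD(2)[OF s] solves_on_has_integral_deriv[OF s] D ab in auto)
  then have "0 \<le> z b * y b - z a * y a"
  proof (rule has_integral_nonneg)
    fix t assume "t \<in> {a..b}"
    have "0 \<le> q t * (y t * y t)" by (rule mult_nonneg_nonneg[OF q(1) zero_le_square])
    then show "0 \<le> q t * y t * y t + z t * z t" by (simp add: mult.assoc)
  qed
  then show ?thesis by (simp add: mult.commute)
qed

locale barrier = shooting +
  assumes W_nonneg: "\<And>x. 0 \<le> W x"
begin

text \<open>Since \<open>y y'\<close> is nondecreasing and starts at \<open>k \<ge> 0\<close>, the square of \<open>y\<close> never falls below its initial
  value one; by continuity \<open>y\<close> cannot change sign.\<close>
lemma jost_lower:
  assumes k: "k \<ge> 0" and x: "x \<ge> - R"
  shows "1 \<le> jost k x \<and> 0 \<le> jost' k x"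
proof -
  have yz: "0 \<le> jost k t * jost' k t" if "t \<ge> - R" for t
  proof -
    have "jost k (- R) * jost' k (- R) \<le> jost k t * jost' k t"
      by (rule solution_times_derivative_mono[OF jost_solves _ pot_bound that])
        (use W_nonneg in \<open>auto intro!: add_nonneg_nonneg\<close>)
    then show ?thesis using jost_init k by simp
  qed
  have sq: "1 \<le> (jost k t)\<^sup>2" if "t \<ge> - R" for t
  proof -
    have "((\<lambda>x. (jost k x)\<^sup>2) has_real_derivative 2 * (jost k s * jost' k s)) (at s)" for s
      using solves_onD(1)[OF jost_solves, of s k] by (auto intro!: derivative_eq_intros)
    then have "(jost k (- R))\<^sup>2 \<le> (jost k t)\<^sup>2"
      using yz by (intro DERIV_nonneg_imp_nondecreasing[OF that]) (metis mult_nonneg_nonneg zero_le_numeral)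
    then show ?thesis using jost_init by simp
  qed
  have pos: "1 \<le> jost k t" if t: "t \<ge> - R" for t
  proof (rule ccontr)
    assume "\<not> 1 \<le> jost k t"
    then have "jost k t \<le> 0"
    proof -
      have "\<not> \<bar>jost k t\<bar> < 1" using sq[OF t] abs_square_less_1[of "jost k t"] by simp
      then show ?thesis using \<open>\<not> 1 \<le> jost k t\<close> by linarith
    qed
    then obtain s where "- R \<le> s" "s \<le> t" "jost k s = 0"
      using IVT2'[of "jost k" t 0 "-R"] jost_init t continuous_on_subset[OF jost_continuous] by auto
    then show False using sq[of s] by simp
  qed
  have "0 \<le> jost' k x"
  proof (rule ccontr)
    assume "\<not> 0 \<le> jost' k x"
    then have "jost k x * jost' k x < 0" using pos[OF x] by (intro mult_pos_neg) auto
    then show False using yz[OF x] by simp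
  qed
  then show ?thesis using pos[OF x] by simp
qed

lemma jost_pos: "k \<ge> 0 \<Longrightarrow> jost k x > 0"
  using jost_lower[of k x] jost_left[of x k] by (cases "x \<ge> - R") auto

lemma jost_mono:
  assumes "k \<ge> 0" "- R \<le> x" "x \<le> y" shows "jost k x \<le> jost k y"
proof (rule DERIV_nonneg_imp_nondecreasing[OF assms(3)])
  fix t assume "x \<le> t" "t \<le> y"
  then have "0 \<le> jost' k t" using jost_lower[OF assms(1), of t] assms(2) by simp
  then show "\<exists>d. (jost k has_real_derivative d) (at t) \<and> 0 \<le> d"
    using solves_onD(1)[OF jost_solves UNIV_I] by blast
qed

text \<open>\<open>y'\<^sup>2 - k\<^sup>2 y\<^sup>2\<close> vanishes at \<open>- R\<close> and has derivative \<open>2 W y y' \<ge> 0\<close>.\<close>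
lemma jost'_ge: "k \<ge> 0 \<Longrightarrow> k * jost k 0 \<le> jost' k 0"
proof -
  assume k: "k \<ge> 0"
  have q: "\<And>x. \<bar>W x + k\<^sup>2\<bar> \<le> B + k\<^sup>2" by (rule pot_bound)
  have sub: "{-R..0} \<subseteq> UNIV" by simp
  note c = solves_on_continuous[OF jost_solves sub q]
  obtain C where C: "C \<ge> 0" "\<And>t. t \<in> {-R..0} \<Longrightarrow> \<bar>jost k t\<bar> \<le> C" using bounded_on_Icc[OF c(1)] by metis
  obtain D where D: "D \<ge> 0" "\<And>t. t \<in> {-R..0} \<Longrightarrow> \<bar>jost' k t\<bar> \<le> D" using bounded_on_Icc[OF c(2)] by metis
  have M: "B + k\<^sup>2 \<ge> 0" using B_nonneg by simp
  let ?q = "\<lambda>t. (W t + k\<^sup>2) * jost k t"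
  have 1: "((\<lambda>t. ?q t * jost' k t + jost' k t * ?q t) has_integral jost' k 0 * jost' k 0 - jost' k (-R) * jost' k (-R)) {-R..0}"
  proof (rule product_rule_integral[where M="(B + k\<^sup>2) * C" and N="(B + k\<^sup>2) * C"])
    show "\<bar>?q t\<bar> \<le> (B + k\<^sup>2) * C" if "t \<in> {-R..0}" for t
      unfolding abs_mult using q C M that by (intro mult_mono) auto
    then show "\<bar>?q t\<bar> \<le> (B + k\<^sup>2) * C" if "t \<in> {-R..0}" for t using that .
  qed (use solves_onD(2)[OF jost_solves] R_pos in auto)
  have 2: "((\<lambda>t. jost' k t * jost k t + jost k t * jost' k t) has_integral jost k 0 * jost k 0 - jost k (-R) * jost k (-R)) {-R..0}"
    by (rule product_rule_integral[where M=D and N=D])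
      (use D solves_on_has_integral_deriv[OF jost_solves] R_pos in auto)
  from has_integral_diff[OF 1 has_integral_mult_right[OF 2, of "k\<^sup>2"]]
  have "((\<lambda>t. 2 * W t * (jost k t * jost' k t)) has_integral (jost' k 0)\<^sup>2 - (k * jost k 0)\<^sup>2) {-R..0}"
    using jost_init by (simp add: algebra_simps power2_eq_square)
  then have "0 \<le> (jost' k 0)\<^sup>2 - (k * jost k 0)\<^sup>2"
    by (rule has_integral_nonneg) (use W_nonneg jost_lower[OF k] in \<open>auto intro!: mult_nonneg_nonneg intro: order_trans[OF zero_le_one]\<close>)
  then have "(k * jost k 0)\<^sup>2 \<le> (jost' k 0)\<^sup>2" by simp
  then show ?thesis by (rule power2_le_imp_le) (use jost_lower[OF k, of 0] R_pos in simp)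
qed

text \<open>The equation is integrated over \<open>[- R, 0]\<close>, where \<open>y\<close> is at most \<open>y 0\<close> by monotonicity.\<close>
lemma jost'_le:
  assumes k: "k \<ge> 0"
  shows "jost' k 0 \<le> (k + k\<^sup>2 * R + integral {-R..0} W) * jost k 0"
proof -
  have "jost k 0 \<ge> 1" using jost_lower[OF k, of 0] R_pos by simp
  have Wi: "W integrable_on {-R..0}"
    by (rule bounded_measurable_integrable[OF W_meas W_bound])
  have i1: "((\<lambda>t. (W t + k\<^sup>2) * jost k t) has_integral jost' k 0 - k) {-R..0}"
    using solves_onD(2)[OF jost_solves, of "-R" 0 k] R_pos jost_init by simp
  have i2: "((\<lambda>t. (W t + k\<^sup>2) * jost k 0) has_integral (integral {-R..0} W + k\<^sup>2 * R) * jost k 0) {-R..0}"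
    using has_integral_mult_left[OF has_integral_add[OF integrable_integral[OF Wi] has_integral_const_real[of "k\<^sup>2" "-R" 0]], of "jost k 0"]
      R_pos by (simp add: mult.commute)
  have "jost' k 0 - k \<le> (integral {-R..0} W + k\<^sup>2 * R) * jost k 0"
    by (rule has_integral_le[OF i1 i2]) (use W_nonneg jost_mono[OF k] in \<open>auto intro!: mult_left_mono add_nonneg_nonneg\<close>)
  moreover have "k * 1 \<le> k * jost k 0" using k \<open>jost k 0 \<ge> 1\<close> by (intro mult_left_mono) auto
  ultimately show ?thesis by (simp add: algebra_simps)
qed

end

context shooting
begin

text \<open>The constant that \<open>solution_stability\<close> gives for the initial data of the Jost solutions with \<open>k \<le> K\<close>,
  over the whole interval \<open>[- R, R]\<close>.\<close>
definition jost_bound :: "real \<Rightarrow> real" where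
  "jost_bound K = (1 + K) * exp ((1 + (B + K\<^sup>2)) * (2 * R))"

lemma jost_upper:
  assumes k: "0 \<le> k" "k \<le> K" and x: "x \<in> {-R..R}"
  shows "\<bar>jost k x\<bar> \<le> jost_bound K" "\<bar>jost' k x\<bar> \<le> jost_bound K"
proof -
  have "\<bar>jost k x - 0\<bar> + \<bar>jost' k x - 0\<bar>
     \<le> (\<bar>jost k (-R) - 0\<bar> + \<bar>jost' k (-R) - 0\<bar> + 0 * 0 * (R - - R)) * exp ((1 + (B + K\<^sup>2)) * (x - - R))"
    by (rule solution_stability[OF jost_solves solves_on_zero _ pot_bound_le[OF k] pot_bound_le[OF k] _ _ x]) auto
  also have "\<dots> \<le> (1 + K) * exp ((1 + (B + K\<^sup>2)) * (2 * R))"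
    using jost_init k x B_nonneg by (intro mult_mono) (auto intro!: mult_left_mono add_nonneg_nonneg)
  finally show "\<bar>jost k x\<bar> \<le> jost_bound K" "\<bar>jost' k x\<bar> \<le> jost_bound K" by (auto simp: jost_bound_def)
qed

lemma jost_bound_ge1:
  assumes "0 \<le> K" shows "1 \<le> jost_bound K"
proof -
  have "1 \<le> exp ((1 + (B + K\<^sup>2)) * (2 * R))" using B_nonneg R_pos by simp
  then have "1 * 1 \<le> (1 + K) * exp ((1 + (B + K\<^sup>2)) * (2 * R))" using assms by (intro mult_mono) auto
  then show ?thesis by (simp add: jost_bound_def)
qed

lemma jost_near_0:
  assumes k: "0 \<le> k" "k \<le> K" and x: "x \<in> {-R..0}"
  shows "\<bar>jost k x - jost k 0\<bar> \<le> jost_bound K * \<bar>x\<bar>"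
    "\<bar>jost' k x - jost' k 0\<bar> \<le> (B + K\<^sup>2) * jost_bound K * \<bar>x\<bar>"
proof -
  show "\<bar>jost k x - jost k 0\<bar> \<le> jost_bound K * \<bar>x\<bar>"
    using primitive_lipschitz[where F="jost k" and f="jost' k" and a="-R" and b=0 and M="jost_bound K" and x=0 and y=x]
      solves_on_has_integral_deriv[OF jost_solves] jost_upper[OF k] R_pos x by simp
  have "\<bar>(W t + k\<^sup>2) * jost k t\<bar> \<le> (B + K\<^sup>2) * jost_bound K" if "t \<in> {-R..0}" for t
    unfolding abs_mult using pot_bound_le[OF k] jost_upper(1)[OF k, of t] that R_pos B_nonneg
    by (intro mult_mono) auto
  then show "\<bar>jost' k x - jost' k 0\<bar> \<le> (B + K\<^sup>2) * jost_bound K * \<bar>x\<bar>"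
    using primitive_lipschitz[where F="jost' k" and f="\<lambda>t. (W t + k\<^sup>2) * jost k t" and a="-R" and b=0 and M="(B + K\<^sup>2) * jost_bound K" and x=0 and y=x]
      solves_onD(2)[OF jost_solves] R_pos x by simp
qed

lemma jost_lipschitz:
  assumes K: "0 \<le> K" and x: "x \<in> {-R..R}"
  obtains L where "L \<ge> 0" "\<And>k l. k \<in> {0..K} \<Longrightarrow> l \<in> {0..K} \<Longrightarrow> \<bar>jost k x - jost l x\<bar> \<le> L * \<bar>k - l\<bar>"
    "\<And>k l. k \<in> {0..K} \<Longrightarrow> l \<in> {0..K} \<Longrightarrow> \<bar>jost' k x - jost' l x\<bar> \<le> L * \<bar>k - l\<bar>"
proof -
  define L where "L = (1 + 2 * K * jost_bound K * (x + R)) * exp ((1 + (B + K\<^sup>2)) * (x + R))"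
  have *: "\<bar>jost k x - jost l x\<bar> + \<bar>jost' k x - jost' l x\<bar> \<le> L * \<bar>k - l\<bar>"
    if k: "k \<in> {0..K}" and l: "l \<in> {0..K}" for k l
  proof -
    have d: "\<bar>(W t + k\<^sup>2) - (W t + l\<^sup>2)\<bar> \<le> 2 * K * \<bar>k - l\<bar>" for t
    proof -
      have "(W t + k\<^sup>2) - (W t + l\<^sup>2) = (k + l) * (k - l)" by (simp add: algebra_simps power2_eq_square)
      then show ?thesis using k l by (auto simp: abs_mult intro!: mult_right_mono)
    qed
    have "\<bar>jost k x - jost l x\<bar> + \<bar>jost' k x - jost' l x\<bar>
     \<le> (\<bar>jost k (-R) - jost l (-R)\<bar> + \<bar>jost' k (-R) - jost' l (-R)\<bar> + (2 * K * \<bar>k - l\<bar>) * jost_bound K * (x - - R)) * exp ((1 + (B + K\<^sup>2)) * (x - - R))"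
      by (rule solution_stability[OF jost_solves jost_solves _ pot_bound_le pot_bound_le d])
        (use k l R_pos x jost_upper[of l K] in auto)
    also have "\<dots> = L * \<bar>k - l\<bar>" using jost_init by (simp add: L_def algebra_simps)
    finally show ?thesis .
  qed
  have xR: "0 \<le> x + R" using x by simp
  have "L \<ge> 0" unfolding L_def using K jost_bound_ge1[OF K]
    by (intro mult_nonneg_nonneg add_nonneg_nonneg[OF zero_le_one] xR) auto
  moreover have "\<bar>jost k x - jost l x\<bar> \<le> L * \<bar>k - l\<bar>" "\<bar>jost' k x - jost' l x\<bar> \<le> L * \<bar>k - l\<bar>"
    if "k \<in> {0..K}" "l \<in> {0..K}" for k l using *[OF that] by linarith+
  ultimately show thesis by (rule that)
qed

lemma jost_continuous_param:
  assumes K: "0 \<le> K" and x: "x \<in> {-R..R}"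
  shows "continuous_on {0..K} (\<lambda>k. jost k x)" "continuous_on {0..K} (\<lambda>k. jost' k x)"
proof -
  obtain L where L: "L \<ge> 0" "\<And>k l. k \<in> {0..K} \<Longrightarrow> l \<in> {0..K} \<Longrightarrow> \<bar>jost k x - jost l x\<bar> \<le> L * \<bar>k - l\<bar>"
    "\<And>k l. k \<in> {0..K} \<Longrightarrow> l \<in> {0..K} \<Longrightarrow> \<bar>jost' k x - jost' l x\<bar> \<le> L * \<bar>k - l\<bar>"
    using jost_lipschitz[OF K x] by blast
  show "continuous_on {0..K} (\<lambda>k. jost k x)"
    by (rule lipschitz_on_continuous_on[where L=L], rule lipschitz_onI)
      (use L in \<open>auto simp: dist_real_def\<close>)
  show "continuous_on {0..K} (\<lambda>k. jost' k x)"
    by (rule lipschitz_on_continuous_on[where L=L], rule lipschitz_onI)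
      (use L in \<open>auto simp: dist_real_def\<close>)
qed

end

context barrier
begin

text \<open>Sturm comparison. The Wronskian of the solutions for \<open>l\<close> and \<open>k\<close> starts at \<open>l - k\<close> and increases,
  because \<open>l\<^sup>2 - k\<^sup>2\<close> and both solutions are nonnegative; division by their values at the origin gives
  the difference of the logarithmic derivatives.\<close>
lemma jost_log_derivative_mono:
  assumes "0 \<le> k" "k \<le> l" "l \<le> K"
  shows "(l - k) / (jost_bound K)\<^sup>2 \<le> jost' l 0 / jost l 0 - jost' k 0 / jost k 0"
proof -
  have l: "0 \<le> l" using assms by simp
  have bl: "\<bar>W t + l\<^sup>2\<bar> \<le> B + K\<^sup>2" and bk: "\<bar>W t + k\<^sup>2\<bar> \<le> B + K\<^sup>2" for t
    using pot_bound_le assms l by auto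
  have "((\<lambda>t. ((W t + l\<^sup>2) - (W t + k\<^sup>2)) * jost l t * jost k t) has_integral
           (jost' l 0 * jost k 0 - jost l 0 * jost' k 0) - (jost' l (-R) * jost k (-R) - jost l (-R) * jost' k (-R))) {-R..0}"
    by (rule wronskian_integral[OF jost_solves jost_solves _ _ bl bk]) (use R_pos in auto)
  then have "0 \<le> (jost' l 0 * jost k 0 - jost l 0 * jost' k 0) - (jost' l (-R) * jost k (-R) - jost l (-R) * jost' k (-R))"
  proof (rule has_integral_nonneg)
    fix t :: real
    have "k\<^sup>2 \<le> l\<^sup>2" using assms by (intro power_mono) auto
    then show "0 \<le> ((W t + l\<^sup>2) - (W t + k\<^sup>2)) * jost l t * jost k t"
      using jost_pos[of l t] jost_pos[of k t] l assms by (auto intro!: mult_nonneg_nonneg)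
  qed
  then have w: "l - k \<le> jost' l 0 * jost k 0 - jost l 0 * jost' k 0" using jost_init by simp
  have p: "jost l 0 > 0" "jost k 0 > 0" using jost_pos l assms by auto
  have e: "jost' l 0 / jost l 0 - jost' k 0 / jost k 0 = (jost' l 0 * jost k 0 - jost l 0 * jost' k 0) / (jost l 0 * jost k 0)"
    using p by (simp add: field_simps)
  have "jost l 0 * jost k 0 \<le> jost_bound K * jost_bound K"
    using jost_upper(1)[of l K 0] jost_upper(1)[of k K 0] assms l R_pos p by (intro mult_mono) auto
  then have "(l - k) / (jost_bound K)\<^sup>2 \<le> (l - k) / (jost l 0 * jost k 0)"
    using p assms jost_bound_ge1[of K] by (intro divide_left_mono) (auto simp: power2_eq_square intro!: mult_pos_pos)
  also have "\<dots> \<le> (jost' l 0 * jost k 0 - jost l 0 * jost' k 0) / (jost l 0 * jost k 0)"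
    using w p by (intro divide_right_mono) auto
  finally show ?thesis using e by simp
qed

text \<open>The Wronskian of \<open>r\<close> with the Jost solution is constant. Near \<open>-\<infinity>\<close> it is at most \<open>\<bar>r'\<bar> + k \<bar>r\<bar>\<close>, which
  is square integrable on a half-line; so the constant is zero, and \<open>r / jost k\<close> has zero derivative.\<close>
lemma jost_decaying_unique:
  assumes s: "solves_on {..<0} (\<lambda>x. W x + k\<^sup>2) r r'" and k: "k > 0"
    and i: "set_integrable lebesgue {..<0} (\<lambda>x. (r x)\<^sup>2)" "set_integrable lebesgue {..<0} (\<lambda>x. (r' x)\<^sup>2)"
  obtains C where "\<And>x. x < 0 \<Longrightarrow> r x = C * jost k x" "\<And>x. x < 0 \<Longrightarrow> r' x = C * jost' k x"
proof -
  define w where "w x = r' x * jost k x - r x * jost' k x" for x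
  have js: "solves_on {..<0} (\<lambda>x. W x + k\<^sup>2) (jost k) (jost' k)"
    by (rule solves_on_subset[OF jost_solves]) simp
  have wc: "w b = w a" if "a \<le> b" "b < 0" for a b
  proof -
    have "((\<lambda>t. ((W t + k\<^sup>2) - (W t + k\<^sup>2)) * r t * jost k t) has_integral w b - w a) {a..b}"
      unfolding w_def by (rule wronskian_integral[OF s js _ _ pot_bound pot_bound]) (use that in auto)
    then have "((\<lambda>t. 0) has_integral w b - w a) {a..b}" by simp
    then have "w b - w a = 0" using has_integral_0 has_integral_unique by blast
    then show ?thesis by simp
  qed
  define c where "c = w (- R)"
  define f where "f x = 2 * (r' x)\<^sup>2 + 2 * k\<^sup>2 * (r x)\<^sup>2" for x
  have fi: "set_integrable lebesgue {..<0} f"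
    unfolding f_def using i by (intro set_integral_add set_integrable_mult_right) auto
  then have fi': "f integrable_on {..<0}" using set_lebesgue_integral_eq_integral(1) by blast
  have f0: "0 \<le> f x" for x by (simp add: f_def)
  have cf: "c\<^sup>2 \<le> f x" if "x \<le> - R" for x
  proof -
    have "c = w x" using wc[of x "-R"] that R_pos by (simp add: c_def)
    moreover have e: "jost k x = exp (k * (x + R))" "jost' k x = k * exp (k * (x + R))" using jost_left[OF that] by auto
    have "exp (k * (x + R)) \<le> 1" using that k by (simp add: mult_nonneg_nonpos)
    ultimately have "\<bar>c\<bar> \<le> \<bar>r' x\<bar> + k * \<bar>r x\<bar>"
    proof -
      assume cw: "c = w x" and e1: "exp (k * (x + R)) \<le> 1"
      have "\<bar>c\<bar> \<le> \<bar>r' x * exp (k * (x + R))\<bar> + \<bar>r x * (k * exp (k * (x + R)))\<bar>"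
        unfolding cw w_def e by (rule abs_triangle_ineq4)
      also have "\<bar>r' x * exp (k * (x + R))\<bar> \<le> \<bar>r' x\<bar>" using e1 by (simp add: abs_mult mult_left_le)
      also have "\<bar>r x * (k * exp (k * (x + R)))\<bar> \<le> k * \<bar>r x\<bar>"
        using mult_left_le[OF e1, of "k * \<bar>r x\<bar>"] k by (simp add: abs_mult mult_ac)
      finally show ?thesis by simp
    qed
    then have "c\<^sup>2 \<le> (\<bar>r' x\<bar> + k * \<bar>r x\<bar>)\<^sup>2" by (metis abs_ge_zero power2_abs power_mono)
    also have "\<dots> \<le> 2 * \<bar>r' x\<bar>\<^sup>2 + 2 * (k * \<bar>r x\<bar>)\<^sup>2"
      using sum_squares_bound[of "\<bar>r' x\<bar>" "k * \<bar>r x\<bar>"] by (simp add: power2_sum)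
    also have "\<dots> = f x" by (simp add: f_def power_mult_distrib)
    finally show ?thesis .
  qed
  have c0: "c = 0"
  proof (rule ccontr)
    assume "c \<noteq> 0"
    then have c2: "c\<^sup>2 > 0" by simp
    define T where "T = integral {..<0} f"
    have "c\<^sup>2 * n \<le> T" if "n \<ge> 0" for n
    proof -
      have fin: "f integrable_on {-R-n..-R}"
      proof -
        have "set_integrable lebesgue {-R-n..-R} f" by (rule set_integrable_subset[OF fi]) (use R_pos in auto)
        then show ?thesis using set_lebesgue_integral_eq_integral(1) by blast
      qed
      have "c\<^sup>2 * n = integral {-R-n..-R} (\<lambda>_. c\<^sup>2)" using that by simp
      also have "\<dots> \<le> integral {-R-n..-R} f" by (rule integral_le) (use fin cf in auto)
      also have "\<dots> \<le> T" unfolding T_def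
        by (rule integral_subset_le[OF _ fin fi']) (use R_pos f0 in auto)
      finally show ?thesis .
    qed
    from this[of "(\<bar>T\<bar> + 1) / c\<^sup>2"] show False using c2 by auto
  qed
  have w0: "w x = 0" if "x < 0" for x
    using wc[of x "-R"] wc[of "-R" x] that c0 R_pos unfolding c_def by (cases "x \<le> - R") auto
  have der: "((\<lambda>x. r x / jost k x) has_real_derivative 0) (at x within {..<0})" if "x < 0" for x
  proof -
    have "((\<lambda>x. r x / jost k x) has_real_derivative (r' x * jost k x - r x * jost' k x) / (jost k x * jost k x)) (at x)"
      by (rule DERIV_divide) (use that solves_onD(1)[OF s] solves_onD(1)[OF jost_solves] jost_pos[of k x] k in auto)
    then have "((\<lambda>x. r x / jost k x) has_real_derivative 0) (at x)" using w0[OF that] by (simp add: w_def)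
    then show ?thesis by (rule has_field_derivative_at_within)
  qed
  have "\<exists>C. \<forall>x\<in>{..<0}. r x / jost k x = C"
    by (rule has_field_derivative_zero_constant) (use der in auto)
  then obtain C where C: "\<And>x. x < 0 \<Longrightarrow> r x / jost k x = C" by auto
  have rC: "r x = C * jost k x" if "x < 0" for x
    using C[OF that] jost_pos[of k x] k by (simp add: field_simps)
  have "r' x = C * jost' k x" if "x < 0" for x
  proof -
    have "(r' x - C * jost' k x) * jost k x = 0" using w0[OF that] rC[OF that] by (simp add: w_def algebra_simps)
    then show ?thesis using jost_pos[of k x] k by simp
  qed
  with rC show thesis by (rule that)
qed

end

section \<open>Eigenvalues from decaying Jost solutions\<close>

lemma integrable_exp_abs:
  assumes k: "k > (0::real)"
  shows "integrable lebesgue (\<lambda>x. exp (- (k * \<bar>x\<bar>)))"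
proof -
  define f where "f x = indicator {0..} x *\<^sub>R exp (- (k * x))" for x :: real
  have "(\<lambda>x. exp (- (k * x))) integrable_on {0..}"
    using integrable_on_exp_minus_to_infinity[OF k, of 0] by simp
  then have "set_integrable lebesgue {0..} (\<lambda>x. exp (- (k * x)))"
    by (intro nonnegative_absolutely_integrable_1) auto
  then have f: "integrable lebesgue f" by (simp add: set_integrable_def f_def[abs_def])
  have f': "integrable lebesgue (\<lambda>x. f (- x))"
    using lebesgue_integrable_real_affine[OF f, of "-1" 0] by simp
  show ?thesis
  proof (rule Bochner_Integration.integrable_bound[OF Bochner_Integration.integrable_add[OF f f']])
    show "(\<lambda>x. exp (- (k * \<bar>x\<bar>))) \<in> borel_measurable lebesgue"
      by (intro continuous_lebesgue_measurable continuous_intros)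
    show "AE x in lebesgue. norm (exp (- (k * \<bar>x\<bar>))) \<le> norm (f x + f (- x))"
      by (intro AE_I2) (auto simp: f_def indicator_def)
  qed
qed

lemma square_integrable_on_exp_decay:
  fixes f :: "real \<Rightarrow> real"
  assumes f: "f \<in> borel_measurable lebesgue" and k: "k > 0"
    and b: "\<And>x. \<bar>f x\<bar> \<le> C * exp (- (k * \<bar>x\<bar>))" and \<Omega>: "\<Omega> \<in> sets lebesgue"
  shows "square_integrable_on \<Omega> (\<lambda>x. complex_of_real (f x))"
proof -
  have m: "(\<lambda>x. complex_of_real (f x)) \<in> borel_measurable lebesgue" using f by simp
  have "integrable lebesgue (\<lambda>x. (f x)\<^sup>2)"
  proof (rule Bochner_Integration.integrable_bound[OF integrable_mult_right[OF integrable_exp_abs[of "2 * k"], of "C\<^sup>2"]])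
    show "AE x in lebesgue. norm ((f x)\<^sup>2) \<le> norm (C\<^sup>2 * exp (- (2 * k * \<bar>x\<bar>)))"
    proof (intro AE_I2)
      fix x
      have "\<bar>f x\<bar>\<^sup>2 \<le> (C * exp (- (k * \<bar>x\<bar>)))\<^sup>2" using b by (intro power_mono) auto
      also have "\<dots> = C\<^sup>2 * exp (- (2 * k * \<bar>x\<bar>))" by (simp add: power_mult_distrib exp_double[symmetric])
      finally show "norm ((f x)\<^sup>2) \<le> norm (C\<^sup>2 * exp (- (2 * k * \<bar>x\<bar>)))" by simp
    qed
  qed (use k f in auto)
  then have "set_integrable lebesgue \<Omega> (\<lambda>x. (cmod (complex_of_real (f x)))\<^sup>2)"
    unfolding set_integrable_def norm_of_real power2_abs by (rule integrable_mult_indicator[OF \<Omega>])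
  moreover have "set_borel_measurable lebesgue \<Omega> (\<lambda>x. complex_of_real (f x))"
    unfolding set_borel_measurable_def using m \<Omega> by simp
  ultimately show ?thesis by (simp add: square_integrable_on_def)
qed

lemma schrodinger_operatorI:
  assumes "\<phi> \<in> D" "weak_derivative_on \<Omega> \<phi> g" "weak_derivative_on \<Omega> g h"
    and "\<And>x. f x = - h x + complex_of_real (q x) * \<phi> x"
  shows "(\<phi>, f) \<in> schrodinger_operator \<Omega> q D"
  using assms unfolding schrodinger_operator_def by auto

lemma not_AE_zero:
  fixes \<phi> :: "real \<Rightarrow> 'a::zero"
  assumes "a < b" "\<And>x. a \<le> x \<Longrightarrow> x \<le> b \<Longrightarrow> \<phi> x \<noteq> 0"
  shows "\<not> (AE x in lebesgue. \<phi> x = 0)"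
proof
  assume "AE x in lebesgue. \<phi> x = 0"
  then obtain N where N: "negligible N" "{x. \<not> \<phi> x = 0} \<subseteq> N"
    unfolding eventually_ae_filter_negligible by blast
  have "cbox a b \<subseteq> N" using assms(2) N(2) by auto
  then have "negligible (cbox a b)" using N(1) negligible_subset by blast
  then have "box a b = {}" by (rule iffD1[OF negligible_interval(1)])
  then show False using assms(1) by simp
qed

context shooting
begin

lemma jost_decay:
  assumes k: "0 \<le> k" and x: "x \<le> R"
  shows "\<bar>jost k x\<bar> \<le> jost_bound k * exp (k * (x + R)) \<and> \<bar>jost' k x\<bar> \<le> jost_bound k * exp (k * (x + R))"
proof (cases "x \<le> - R")
  case True
  have "1 + k \<le> jost_bound k"
    unfolding jost_bound_def using k B_nonneg R_pos by simp
  then have "1 * exp (k * (x + R)) \<le> jost_bound k * exp (k * (x + R))" "k * exp (k * (x + R)) \<le> jost_bound k * exp (k * (x + R))"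
    using k by (auto intro!: mult_right_mono)
  then show ?thesis using jost_left[OF True] k by (simp add: abs_mult)
next
  case False
  have J: "1 \<le> jost_bound k" using jost_bound_ge1[OF k] .
  have "1 \<le> exp (k * (x + R))" using k False by simp
  then have "jost_bound k * 1 \<le> jost_bound k * exp (k * (x + R))" using J by (intro mult_left_mono) auto
  then show ?thesis using jost_upper[OF k order_refl, of x] x False by auto
qed

end

lemma (in barrier) jost_normalized_decay:
  assumes k: "0 \<le> k" and x: "x \<le> 0"
  shows "\<bar>c / jost k 0 * jost k x\<bar> \<le> \<bar>c\<bar> * (jost_bound k * (exp (k * R) * exp (- (k * \<bar>x\<bar>)))) \<and>
    \<bar>c / jost k 0 * jost' k x\<bar> \<le> \<bar>c\<bar> * (jost_bound k * (exp (k * R) * exp (- (k * \<bar>x\<bar>))))"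
proof -
  have "1 \<le> jost k 0" using jost_lower[of k 0] k R_pos by simp
  then have "\<bar>c\<bar> * 1 \<le> \<bar>c\<bar> * jost k 0" by (intro mult_left_mono) auto
  then have c: "\<bar>c / jost k 0\<bar> \<le> \<bar>c\<bar>" using \<open>1 \<le> jost k 0\<close> by (simp add: abs_divide divide_le_eq)
  have "exp (k * (x + R)) = exp (k * R) * exp (- (k * \<bar>x\<bar>))"
    using x by (simp add: exp_add[symmetric] algebra_simps)
  then have b: "\<bar>jost k x\<bar> \<le> jost_bound k * (exp (k * R) * exp (- (k * \<bar>x\<bar>)))"
    "\<bar>jost' k x\<bar> \<le> jost_bound k * (exp (k * R) * exp (- (k * \<bar>x\<bar>)))"
    using jost_decay[of k x] k x R_pos by auto
  show ?thesis unfolding abs_mult[of "c / jost k 0"]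
    by (intro conjI mult_mono[OF c] b) auto
qed

context shooting
begin

text \<open>The assumption says that at \<open>R\<close> the Jost solution has the logarithmic derivative of \<open>exp (- k x)\<close>, with
  which it therefore agrees, up to a factor, to the right of the support.\<close>
lemma eigenvalue_of_decaying_jost:
  assumes k: "k > 0" and miss: "jost' k R + k * jost k R = 0"
  shows "negative_eigenvalue (schrodinger_operator UNIV W (sobolev_2_2 UNIV)) (- (k\<^sup>2))"
proof -
  let ?h = "\<lambda>x. (W x + k\<^sup>2) * jost k x"
  have right: "jost k x = jost k R * exp (- k * (x - R)) \<and> jost' k x = jost k R * (- k * exp (- k * (x - R)))"
    if "x \<ge> R" for x
  proof (rule solution_unique[OF jost_solves solves_on_cmult[OF exp_solves], where a=R and b=x])
    show "jost k R = jost k R * exp (- k * (R - R))" "jost' k R = jost k R * (- k * exp (- k * (R - R)))"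
      using miss by (auto simp: eq_neg_iff_add_eq_0 mult.commute)
  qed (use that pot_bound W_supp R_pos in auto)
  define C where "C = (1 + k) * (jost_bound k * exp (3 * k * R))"
  have J: "1 \<le> jost_bound k" using jost_bound_ge1 k by simp
  have dec: "\<bar>jost k x\<bar> \<le> C * exp (- (k * \<bar>x\<bar>)) \<and> \<bar>jost' k x\<bar> \<le> C * exp (- (k * \<bar>x\<bar>))" for x
  proof (cases "x \<le> R")
    case True
    have "k * (x + R) \<le> 3 * k * R + - (k * \<bar>x\<bar>)"
    proof -
      have "x + R \<le> 3 * R - \<bar>x\<bar>" using True R_pos by linarith
      then have "k * (x + R) \<le> k * (3 * R - \<bar>x\<bar>)" using k by (intro mult_left_mono) auto
      then show ?thesis by (simp add: algebra_simps)
    qed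
    then have "exp (k * (x + R)) \<le> exp (3 * k * R) * exp (- (k * \<bar>x\<bar>))" by (simp add: exp_add[symmetric])
    then have "jost_bound k * exp (k * (x + R)) \<le> jost_bound k * (exp (3 * k * R) * exp (- (k * \<bar>x\<bar>)))"
      using J by (intro mult_left_mono) auto
    also have "\<dots> \<le> (1 + k) * (jost_bound k * (exp (3 * k * R) * exp (- (k * \<bar>x\<bar>))))"
    proof -
      have "0 \<le> jost_bound k * (exp (3 * k * R) * exp (- (k * \<bar>x\<bar>)))" using J by (intro mult_nonneg_nonneg) auto
      from mult_right_mono[OF _ this, of 1 "1 + k"] k show ?thesis by simp
    qed
    finally show ?thesis using jost_decay[of k x] k True by (simp add: C_def mult.assoc)
  next
    case False
    have J': "\<bar>jost k R\<bar> \<le> jost_bound k" using jost_upper[of k k R] k R_pos by simp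
    have e: "exp (- k * (x - R)) \<le> exp (3 * k * R) * exp (- (k * \<bar>x\<bar>))"
      using False k R_pos by (simp add: exp_add[symmetric] algebra_simps)
    have m: "\<bar>jost k R\<bar> * exp (- k * (x - R)) \<le> jost_bound k * (exp (3 * k * R) * exp (- (k * \<bar>x\<bar>)))"
      using J' e J by (intro mult_mono) auto
    have p: "0 \<le> jost_bound k * (exp (3 * k * R) * exp (- (k * \<bar>x\<bar>)))" using J by simp
    have "\<bar>jost k x\<bar> \<le> 1 * (jost_bound k * (exp (3 * k * R) * exp (- (k * \<bar>x\<bar>))))"
      using right[of x] False m by (simp add: abs_mult)
    also have "\<dots> \<le> (1 + k) * (jost_bound k * (exp (3 * k * R) * exp (- (k * \<bar>x\<bar>))))"
      using k p by (intro mult_right_mono) auto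
    finally have 1: "\<bar>jost k x\<bar> \<le> C * exp (- (k * \<bar>x\<bar>))" by (simp add: C_def mult.assoc)
    have "\<bar>jost' k x\<bar> = k * (\<bar>jost k R\<bar> * exp (- k * (x - R)))"
      using right[of x] False k by (simp add: abs_mult)
    also have "\<dots> \<le> (1 + k) * (jost_bound k * (exp (3 * k * R) * exp (- (k * \<bar>x\<bar>))))"
      by (rule mult_mono) (use k p m in auto)
    finally have 2: "\<bar>jost' k x\<bar> \<le> C * exp (- (k * \<bar>x\<bar>))" by (simp add: C_def mult.assoc)
    show ?thesis using 1 2 by simp
  qed
  have dech: "\<bar>?h x\<bar> \<le> (B + k\<^sup>2) * C * exp (- (k * \<bar>x\<bar>))" for x
  proof -
    have "\<bar>W x + k\<^sup>2\<bar> * \<bar>jost k x\<bar> \<le> (B + k\<^sup>2) * (C * exp (- (k * \<bar>x\<bar>)))"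
      using pot_bound dec[of x] B_nonneg by (intro mult_mono) auto
    then show ?thesis by (simp add: abs_mult mult.assoc)
  qed
  have w1: "weak_derivative_on UNIV (\<lambda>x. complex_of_real (jost k x)) (\<lambda>x. complex_of_real (jost' k x))"
  proof (rule weak_derivative_on_bounded_linear[OF weak_derivative_on_primitive bounded_linear_of_real])
    show "(jost' k has_integral jost k d - jost k c) {c..d}" if "c \<le> d" for c d
      using solves_on_has_integral_deriv[OF jost_solves that] by simp
  qed (use jost_continuous jost'_continuous in \<open>auto intro: continuous_lebesgue_measurable continuous_locally_bounded\<close>)
  have w2: "weak_derivative_on UNIV (\<lambda>x. complex_of_real (jost' k x)) (\<lambda>x. complex_of_real (?h x))"
  proof (rule weak_derivative_on_bounded_linear[OF weak_derivative_on_primitive bounded_linear_of_real])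
    show "(?h has_integral jost' k d - jost' k c) {c..d}" if "c \<le> d" for c d
      using solves_onD(2)[OF jost_solves that] by simp
  qed (use jost_regularity(2-4) in auto)
  have sob: "(\<lambda>x. complex_of_real (jost k x)) \<in> sobolev_2_2 UNIV"
  proof -
    have "square_integrable_on UNIV (\<lambda>x. complex_of_real (jost k x))"
      by (rule square_integrable_on_exp_decay[OF _ k]) (use continuous_lebesgue_measurable jost_continuous jost'_continuous dec in auto)
    moreover have "square_integrable_on UNIV (\<lambda>x. complex_of_real (jost' k x))"
      by (rule square_integrable_on_exp_decay[OF _ k]) (use continuous_lebesgue_measurable jost_continuous jost'_continuous dec in auto)
    moreover have "square_integrable_on UNIV (\<lambda>x. complex_of_real (?h x))"
      by (rule square_integrable_on_exp_decay[OF jost_regularity(3) k dech]) simp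
    ultimately show ?thesis unfolding sobolev_2_2_def using w1 w2 by blast
  qed
  have "is_eigenvalue (schrodinger_operator UNIV W (sobolev_2_2 UNIV)) (complex_of_real (- (k\<^sup>2)))"
    unfolding is_eigenvalue_def
  proof (intro exI conjI)
    show "((\<lambda>x. complex_of_real (jost k x)), \<lambda>x. complex_of_real (- (k\<^sup>2)) * complex_of_real (jost k x))
      \<in> schrodinger_operator UNIV W (sobolev_2_2 UNIV)"
      by (rule schrodinger_operatorI[OF sob w1 w2]) (simp add: algebra_simps)
    show "\<not> (AE x in lebesgue. complex_of_real (jost k x) = 0)"
      by (rule not_AE_zero[of "- R - 1" "- R"]) (use jost_left in auto)
  qed auto
  then show ?thesis using k by (simp add: negative_eigenvalue_def)
qed

end

section \<open>Eigenvalues of the interface operator\<close>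

lemma AE_nonzero: "AE x in lebesgue. x \<noteq> (0::real)"
  unfolding eventually_ae_filter_negligible by (intro exI[of _ "{0}"]) auto

lemma measurable_of_punctured_continuous:
  fixes f :: "real \<Rightarrow> 'a::euclidean_space"
  assumes "continuous_on (- {0}) f"
  shows "f \<in> borel_measurable lebesgue"
proof (rule borel_measurable_AE)
  show "(\<lambda>x. indicator (- {0}) x *\<^sub>R f x) \<in> borel_measurable lebesgue"
    using borel_measurable_continuous_on_indicator[OF _ assms] by (simp add: measurable_completion)
  show "AE x in lebesgue. indicator (- {0}) x *\<^sub>R f x = f x"
    using AE_nonzero by eventually_elim simp
qed

lemma measurable_of_punctured:
  assumes "square_integrable_on (- {0}) \<phi>"
  shows "\<phi> \<in> borel_measurable lebesgue"
proof (rule borel_measurable_AE)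
  show "(\<lambda>x. indicator (- {0}) x *\<^sub>R \<phi> x) \<in> borel_measurable lebesgue"
    using assms by (simp add: square_integrable_on_def set_borel_measurable_def)
  show "AE x in lebesgue. indicator (- {0}) x *\<^sub>R \<phi> x = \<phi> x"
    using AE_nonzero by eventually_elim simp
qed

text \<open>Over every interval in \<open>\<Omega>\<close> the functions \<open>g\<close> and \<open>r'\<close> have the same integral, namely the increment of
  \<open>r\<close>.\<close>
lemma weak_derivative_unique:
  fixes p g r r' :: "real \<Rightarrow> real"
  assumes \<Omega>: "open \<Omega>" and w: "weak_derivative_on \<Omega> p g" and ae: "AE x in lebesgue. p x = r x"
    and m: "p \<in> borel_measurable lebesgue" "r \<in> borel_measurable lebesgue"
    and d: "\<And>x. x \<in> \<Omega> \<Longrightarrow> (r has_real_derivative r' x) (at x)"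
  shows "AE x in lebesgue. x \<in> \<Omega> \<longrightarrow> g x = r' x"
proof -
  have wr: "weak_derivative_on \<Omega> r g" by (rule weak_derivative_on_cong_left[OF w ae m])
  have I: "((\<lambda>x. g x - r' x) has_integral 0) {a..b}" if "a \<le> b" "{a..b} \<subseteq> \<Omega>" for a b
  proof -
    have "continuous_on {a..b} r"
      using d that(2) by (meson DERIV_isCont continuous_at_imp_continuous_on subsetD)
    then have A: "(g has_integral r b - r a) {a..b}" by (rule weak_derivative_on_integral[OF wr _ that])
    have B: "(r' has_integral r b - r a) {a..b}"
    proof (rule fundamental_theorem_of_calculus[OF that(1)])
      fix x assume "x \<in> {a..b}"
      then have "(r has_real_derivative r' x) (at x)" using d that by blast
      then show "(r has_vector_derivative r' x) (at x within {a..b})"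
        by (meson has_field_derivative_at_within has_real_derivative_iff_has_vector_derivative)
    qed
    show ?thesis using has_integral_diff[OF A B] by simp
  qed
  have "AE x in lebesgue. x \<in> \<Omega> \<longrightarrow> g x - r' x = 0"
  proof (rule AE_zero_of_integrals_zero[OF \<Omega>])
    show "(\<lambda>x. g x - r' x) integrable_on {a..b}" if "{a..b} \<subseteq> \<Omega>" for a b
      using I[OF _ that] by (cases "a \<le> b") (auto simp: integrable_on_def)
    show "integral {a..b} (\<lambda>x. g x - r' x) = 0" if "a \<le> b" "{a..b} \<subseteq> \<Omega>" for a b
      using I[OF that] by (rule integral_unique)
  qed
  then show ?thesis by simp
qed

lemma set_integrable_reflect:
  fixes f :: "real \<Rightarrow> real"
  assumes "set_integrable lebesgue {0<..} f"
  shows "set_integrable lebesgue {..<0} (\<lambda>x. f (- x))"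
proof -
  have "integrable lebesgue (\<lambda>x. indicator {0<..} x *\<^sub>R f x)" using assms by (simp add: set_integrable_def)
  from lebesgue_integrable_real_affine[OF this, of "-1" 0]
  have "integrable lebesgue (\<lambda>x. indicator {0<..} (- x) *\<^sub>R f (- x))" by simp
  moreover have "indicator {0<..} (- x) = (indicator {..<0} x :: real)" for x :: real
    by (simp add: indicator_def)
  ultimately show ?thesis by (simp add: set_integrable_def)
qed

locale interface = barrier +
  fixes \<theta> \<eta> :: real
  assumes theta: "\<theta> \<noteq> 0"

text \<open>The solution that decays to the right is the reflection of the Jost solution of the reflected
  potential.\<close>
sublocale interface \<subseteq> mirror: barrier "\<lambda>x. W (- x)" R B
proof
  show "(\<lambda>x. W (- x)) \<in> borel_measurable lebesgue"
    using measurable_affine_lebesgue[OF W_meas, of "-1" 0] by simp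
qed (use W_bound W_supp R_pos W_nonneg in auto)

context interface
begin

text \<open>A function that decays on both sides is \<open>a \<cdot> jost k x / jost k 0\<close> to the left and, by the first
  interface condition, \<open>\<theta> a \<cdot> mirror.jost k (- x) / mirror.jost k 0\<close> to the right of the origin. The
  second condition then reads \<open>a \<cdot> secular k = 0\<close>.\<close>
definition secular :: "real \<Rightarrow> real" where
  "secular k = jost' k 0 / jost k 0 + \<theta>\<^sup>2 * (mirror.jost' k 0 / mirror.jost k 0) + \<theta> * \<eta>"

text \<open>On each half-line \<open>r\<close> is a multiple of the decaying solution. Eliminating the amplitude on the right
  from the two interface conditions leaves \<open>C \<cdot> jost k 0 \<cdot> secular k = 0\<close> for the amplitude \<open>C\<close> on the left.\<close>
lemma interface_solution_trivial:
  assumes k: "k > 0" and F: "secular k \<noteq> 0"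
    and sl: "solves_on {..<0} (\<lambda>x. W x + k\<^sup>2) r r'" and sr: "solves_on {0<..} (\<lambda>x. W x + k\<^sup>2) r r'"
    and i: "set_integrable lebesgue (- {0}) (\<lambda>x. (r x)\<^sup>2)" "set_integrable lebesgue (- {0}) (\<lambda>x. (r' x)\<^sup>2)"
    and lim: "(r \<longlongrightarrow> a) (at_left 0)" "(r \<longlongrightarrow> b) (at_right 0)" "(r' \<longlongrightarrow> a') (at_left 0)" "(r' \<longlongrightarrow> b') (at_right 0)"
    and bc: "b = \<theta> * a" "b' = inverse \<theta> * a' + \<eta> * a"
    and x: "x \<noteq> 0"
  shows "r x = 0"
proof -
  have il: "set_integrable lebesgue {..<0} (\<lambda>x. (r x)\<^sup>2)" "set_integrable lebesgue {..<0} (\<lambda>x. (r' x)\<^sup>2)"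
    by (rule set_integrable_subset[OF i(1)]; force) (rule set_integrable_subset[OF i(2)]; force)
  have ir: "set_integrable lebesgue {0<..} (\<lambda>x. (r x)\<^sup>2)" "set_integrable lebesgue {0<..} (\<lambda>x. (r' x)\<^sup>2)"
    by (rule set_integrable_subset[OF i(1)]; force) (rule set_integrable_subset[OF i(2)]; force)
  obtain C where C: "\<And>x. x < 0 \<Longrightarrow> r x = C * jost k x" "\<And>x. x < 0 \<Longrightarrow> r' x = C * jost' k x"
    using jost_decaying_unique[OF sl k il] by metis
  have "{t. - t \<in> {0<..}} = {..<(0::real)}" by auto
  then have sm: "solves_on {..<0} (\<lambda>x. W (- x) + k\<^sup>2) (\<lambda>x. r (- x)) (\<lambda>x. - r' (- x))"
    using solves_on_reflect[OF sr] by simp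
  have im: "set_integrable lebesgue {..<0} (\<lambda>x. (r (- x))\<^sup>2)" "set_integrable lebesgue {..<0} (\<lambda>x. (- r' (- x))\<^sup>2)"
    using set_integrable_reflect[OF ir(1)] set_integrable_reflect[OF ir(2)] by simp_all
  obtain D where D: "\<And>x. x < 0 \<Longrightarrow> r (- x) = D * mirror.jost k x" "\<And>x. x < 0 \<Longrightarrow> - r' (- x) = D * mirror.jost' k x"
    using mirror.jost_decaying_unique[OF sm k im] by metis
  have cj: "(jost k \<longlongrightarrow> jost k 0) (at_left 0)" "(jost' k \<longlongrightarrow> jost' k 0) (at_left 0)"
    "(mirror.jost k \<longlongrightarrow> mirror.jost k 0) (at_left 0)" "(mirror.jost' k \<longlongrightarrow> mirror.jost' k 0) (at_left 0)"
    using jost_continuous[of k] jost'_continuous[of k] mirror.jost_continuous[of k] mirror.jost'_continuous[of k]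
    by (auto simp: continuous_on_def intro: tendsto_within_subset)
  have ev: "\<forall>\<^sub>F x in at_left (0::real). x < 0" by (simp add: eventually_at_filter)
  have ea: "a = C * jost k 0"
  proof (rule tendsto_unique[OF _ lim(1)])
    have "\<forall>\<^sub>F x in at_left 0. C * jost k x = r x" using ev by eventually_elim (simp add: C)
    then show "(r \<longlongrightarrow> C * jost k 0) (at_left 0)"
      by (rule Lim_transform_eventually[rotated]) (intro tendsto_intros cj)
  qed simp
  have ea': "a' = C * jost' k 0"
  proof (rule tendsto_unique[OF _ lim(3)])
    have "\<forall>\<^sub>F x in at_left 0. C * jost' k x = r' x" using ev by eventually_elim (simp add: C)
    then show "(r' \<longlongrightarrow> C * jost' k 0) (at_left 0)"
      by (rule Lim_transform_eventually[rotated]) (intro tendsto_intros cj)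
  qed simp
  have lr: "((\<lambda>x. r (- x)) \<longlongrightarrow> b) (at_left 0)" "((\<lambda>x. - r' (- x)) \<longlongrightarrow> - b') (at_left 0)"
    using lim(2) tendsto_minus[OF lim(4)] filterlim_at_left_to_right[of "\<lambda>x. r (- x)" "nhds b" 0]
      filterlim_at_left_to_right[of "\<lambda>x. - r' (- x)" "nhds (- b')" 0] by simp_all
  have eb: "b = D * mirror.jost k 0"
  proof (rule tendsto_unique[OF _ lr(1)])
    have "\<forall>\<^sub>F x in at_left 0. D * mirror.jost k x = r (- x)" using ev by eventually_elim (simp add: D)
    then show "((\<lambda>x. r (- x)) \<longlongrightarrow> D * mirror.jost k 0) (at_left 0)"
      by (rule Lim_transform_eventually[rotated]) (intro tendsto_intros cj)
  qed simp
  have eb': "- b' = D * mirror.jost' k 0"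
  proof (rule tendsto_unique[OF _ lr(2)])
    have "\<forall>\<^sub>F x in at_left 0. D * mirror.jost' k x = - r' (- x)" using ev by eventually_elim (simp add: D)
    then show "((\<lambda>x. - r' (- x)) \<longlongrightarrow> D * mirror.jost' k 0) (at_left 0)"
      by (rule Lim_transform_eventually[rotated]) (intro tendsto_intros cj)
  qed simp
  have p: "jost k 0 > 0" "mirror.jost k 0 > 0" using jost_pos mirror.jost_pos k by auto
  have Deq: "D = \<theta> * C * jost k 0 / mirror.jost k 0" using eb ea bc(1) p by (simp add: field_simps)
  have "\<theta> * b' = a' + \<theta> * \<eta> * a" using bc(2) theta by (simp add: field_simps)
  moreover have "\<theta> * b' = - \<theta> * (D * mirror.jost' k 0)" unfolding eb'[symmetric] by simp
  ultimately have "C * (jost' k 0 + \<theta> * \<eta> * jost k 0) + \<theta> * (D * mirror.jost' k 0) = 0"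
    using ea ea' by (simp add: algebra_simps)
  moreover have "C * jost k 0 * secular k = C * (jost' k 0 + \<theta> * \<eta> * jost k 0) + \<theta> * (D * mirror.jost' k 0)"
    unfolding Deq secular_def using p by (simp add: field_simps power2_eq_square)
  ultimately have "C * jost k 0 * secular k = 0" by simp
  then have C0: "C = 0" using F p by simp
  then have D0: "D = 0" using Deq by simp
  show ?thesis
  proof (cases "x < 0")
    case True then show ?thesis using C C0 by simp
  next
    case False then show ?thesis using D(1)[of "-x"] D0 x by simp
  qed
qed

text \<open>An eigenfunction agrees with a differentiable representative whose real and imaginary parts solve the
  differential equation on both half-lines. Unless \<open>secular k = 0\<close>, both parts vanish by
  \<open>interface_solution_trivial\<close>.\<close>
lemma eigenvalue_imp_secular:
  assumes "negative_eigenvalue (H_interface W \<theta> \<eta>) \<mu>"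
  shows "\<exists>k>0. \<mu> = - (k\<^sup>2) \<and> secular k = 0"
proof -
  define k where "k = sqrt (- \<mu>)"
  have mu: "\<mu> < 0" using assms by (simp add: negative_eigenvalue_def)
  then have k: "k > 0" "\<mu> = - (k\<^sup>2)" by (auto simp: k_def)
  obtain \<phi> f where \<phi>f: "(\<phi>, f) \<in> H_interface W \<theta> \<eta>" and nz: "\<not> (AE x in lebesgue. \<phi> x = 0)"
    and fe: "AE x in lebesgue. f x = complex_of_real \<mu> * \<phi> x"
    using assms by (auto simp: negative_eigenvalue_def is_eigenvalue_def)
  obtain g h where dom: "\<phi> \<in> interface_domain \<theta> \<eta>" and w1: "weak_derivative_on (- {0}) \<phi> g"
    and w2: "weak_derivative_on (- {0}) g h" and fh: "AE x in lebesgue. f x = - h x + complex_of_real (W x) * \<phi> x"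
    using \<phi>f by (auto simp: H_interface_def schrodinger_operator_def)
  obtain u u' a b a' b' where sob: "\<phi> \<in> sobolev_2_2 (- {0})" and au: "AE x in lebesgue. \<phi> x = u x"
    and du: "\<And>x. x \<noteq> 0 \<Longrightarrow> (u has_vector_derivative u' x) (at x)" and cu': "continuous_on (- {0}) u'"
    and lim: "(u \<longlongrightarrow> a) (at_left 0)" "(u \<longlongrightarrow> b) (at_right 0)" "(u' \<longlongrightarrow> a') (at_left 0)" "(u' \<longlongrightarrow> b') (at_right 0)"
    and bc: "b = complex_of_real \<theta> * a" "b' = complex_of_real (inverse \<theta>) * a' + complex_of_real \<eta> * a"
    using dom unfolding interface_domain_def by blast
  obtain g2 where w1': "weak_derivative_on (- {0}) \<phi> g2" and sq: "square_integrable_on (- {0}) \<phi>" "square_integrable_on (- {0}) g2"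
    using sob unfolding sobolev_2_2_def by blast
  have cu: "continuous_on (- {0}) u"
    using du by (auto intro!: continuous_at_imp_continuous_on dest: has_vector_derivative_continuous)
  have mu: "u \<in> borel_measurable lebesgue" "u' \<in> borel_measurable lebesgue"
    using measurable_of_punctured_continuous cu cu' by auto
  have m\<phi>: "\<phi> \<in> borel_measurable lebesgue" by (rule measurable_of_punctured[OF sq(1)])
  have op: "open (- {0::real})" by (simp add: open_Compl)
  have real_part: "AE x in lebesgue. T (\<phi> x) = 0"
    if F: "secular k \<noteq> 0" and T: "bounded_linear T" "\<And>z. \<bar>T z\<bar> \<le> cmod z" "\<And>c z. T (complex_of_real c * z) = c * T z"
      and Tm: "T \<in> borel_measurable borel" for T :: "complex \<Rightarrow> real"
  proof -
    interpret T: bounded_linear T by (rule T(1))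
    define r where "r x = T (u x)" for x
    define r' where "r' x = T (u' x)" for x
    have dr: "(r has_real_derivative r' x) (at x)" if "x \<in> - {0}" for x
      using bounded_linear.has_vector_derivative[OF T(1) du] that
      by (simp add: r_def[abs_def] r'_def has_real_derivative_iff_has_vector_derivative)
    have mr: "r \<in> borel_measurable lebesgue" "r' \<in> borel_measurable lebesgue" "(\<lambda>x. T (\<phi> x)) \<in> borel_measurable lebesgue"
      unfolding r_def r'_def using measurable_compose[OF mu(1) Tm] measurable_compose[OF mu(2) Tm] measurable_compose[OF m\<phi> Tm] by auto
    have aer: "AE x in lebesgue. T (\<phi> x) = r x" using au by eventually_elim (simp add: r_def)
    have gr: "AE x in lebesgue. x \<in> - {0} \<longrightarrow> T (g x) = r' x"
      by (rule weak_derivative_unique[OF op weak_derivative_on_bounded_linear[OF w1 T(1)] aer mr(3,1) dr])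
    have g2r: "AE x in lebesgue. x \<in> - {0} \<longrightarrow> T (g2 x) = r' x"
      by (rule weak_derivative_unique[OF op weak_derivative_on_bounded_linear[OF w1' T(1)] aer mr(3,1) dr])
    have gr': "AE x in lebesgue. T (g x) = r' x" using gr AE_nonzero by eventually_elim simp
    have g2r': "AE x in lebesgue. T (g2 x) = r' x" using g2r AE_nonzero by eventually_elim simp
    have mg: "(\<lambda>x. T (g x)) \<in> borel_measurable lebesgue"
    proof (rule borel_measurable_AE[OF mr(2)])
      show "AE x in lebesgue. r' x = T (g x)" using gr' by eventually_elim simp
    qed
    have wr': "weak_derivative_on (- {0}) r' (\<lambda>x. T (h x))"
      by (rule weak_derivative_on_cong_left[OF weak_derivative_on_bounded_linear[OF w2 T(1)] gr' mg mr(2)])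
    have cr': "continuous_on (- {0}) r'"
      unfolding r'_def by (rule bounded_linear.continuous_on[OF T(1) cu'])
    have hr: "AE x in lebesgue. T (h x) = (W x + k\<^sup>2) * r x"
      using fh fe aer
    proof eventually_elim
      case (elim x)
      have "complex_of_real \<mu> * \<phi> x = - h x + complex_of_real (W x) * \<phi> x" using elim by simp
      then have "h x = complex_of_real (W x + k\<^sup>2) * \<phi> x" using k(2) by (simp add: algebra_simps)
      then have "T (h x) = (W x + k\<^sup>2) * T (\<phi> x)" by (simp only: T(3))
      then show ?case using elim(3) by simp
    qed
    have Ih: "((\<lambda>t. (W t + k\<^sup>2) * r t) has_integral r' d - r' c) {c..d}" if cd: "c \<le> d" "{c..d} \<subseteq> - {0}" for c d
    proof -
      have I: "((\<lambda>x. T (h x)) has_integral r' d - r' c) {c..d}"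
        by (rule weak_derivative_on_integral[OF wr' continuous_on_subset[OF cr' cd(2)] cd])
      obtain N where N: "negligible N" "{x. \<not> T (h x) = (W x + k\<^sup>2) * r x} \<subseteq> N"
        using hr unfolding eventually_ae_filter_negligible by blast
      show ?thesis
      proof (rule has_integral_spike[OF N(1) _ I])
        fix x assume "x \<in> {c..d} - N"
        then have "x \<notin> {x. \<not> T (h x) = (W x + k\<^sup>2) * r x}" using N(2) by blast
        then show "(W x + k\<^sup>2) * r x = T (h x)" by simp
      qed
    qed
    have sl: "solves_on {..<0} (\<lambda>x. W x + k\<^sup>2) r r'" and sr: "solves_on {0<..} (\<lambda>x. W x + k\<^sup>2) r r'"
      unfolding solves_on_def using dr Ih by (auto simp: subset_iff)
    have i1: "set_integrable lebesgue (- {0}) (\<lambda>x. (r x)\<^sup>2)"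
      if p: "square_integrable_on (- {0}) p" and pr: "AE x in lebesgue. T (p x) = r x"
        and mr: "r \<in> borel_measurable lebesgue" for p r
    proof -
      have pi: "integrable lebesgue (\<lambda>x. indicator (- {0}) x *\<^sub>R (cmod (p x))\<^sup>2)"
        using p by (simp add: square_integrable_on_def set_integrable_def)
      show ?thesis unfolding set_integrable_def
      proof (rule Bochner_Integration.integrable_bound[OF pi])
        show "(\<lambda>x. indicator (- {0}) x *\<^sub>R (r x)\<^sup>2) \<in> borel_measurable lebesgue"
          by (rule borel_measurable_scaleR[OF borel_measurable_indicator borel_measurable_power[OF mr]])
            (use op in \<open>simp add: borel_open\<close>)
        show "AE x in lebesgue. norm (indicator (- {0}) x *\<^sub>R (r x)\<^sup>2) \<le> norm (indicator (- {0}) x *\<^sub>R (cmod (p x))\<^sup>2)"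
          using pr
        proof eventually_elim
          case (elim x)
          have "\<bar>r x\<bar>\<^sup>2 \<le> (cmod (p x))\<^sup>2" using T(2)[of "p x"] elim by (intro power_mono) auto
          then show ?case by (simp add: indicator_def)
        qed
      qed
    qed
    have z: "r x = 0" if "x \<noteq> 0" for x
    proof (rule interface_solution_trivial[OF k(1) F sl sr i1[OF sq(1) aer mr(1)] i1[OF sq(2) g2r' mr(2)] _ _ _ _ _ _ that])
      show "(r \<longlongrightarrow> T a) (at_left 0)" "(r \<longlongrightarrow> T b) (at_right 0)" "(r' \<longlongrightarrow> T a') (at_left 0)" "(r' \<longlongrightarrow> T b') (at_right 0)"
        unfolding r_def r'_def by (intro T.tendsto lim)+
      show "T b = \<theta> * T a" using bc(1) T(3) by simp
      show "T b' = inverse \<theta> * T a' + \<eta> * T a" unfolding bc(2) T.add T(3) ..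
    qed
    show ?thesis using aer AE_nonzero by eventually_elim (simp add: z)
  qed
  have "secular k = 0"
  proof (rule ccontr)
    assume F: "secular k \<noteq> 0"
    have "AE x in lebesgue. Re (\<phi> x) = 0"
      by (rule real_part[OF F bounded_linear_Re abs_Re_le_cmod]) auto
    moreover have "AE x in lebesgue. Im (\<phi> x) = 0"
      by (rule real_part[OF F bounded_linear_Im abs_Im_le_cmod]) auto
    ultimately have "AE x in lebesgue. \<phi> x = 0" by eventually_elim (simp add: complex_eq_iff)
    then show False using nz by simp
  qed
  then show ?thesis using k by blast
qed

text \<open>The eigenfunction glues the two decaying solutions, normalised to \<open>1\<close> and \<open>\<theta>\<close> at the origin.\<close>
lemma secular_imp_eigenvalue:
  assumes k: "k > 0" and F: "secular k = 0"
  shows "negative_eigenvalue (H_interface W \<theta> \<eta>) (- (k\<^sup>2))"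
proof -
  let ?q = "\<lambda>x. W x + k\<^sup>2"
  define F1 where "F1 x = (1 / jost k 0) * jost k x" for x
  define f1 where "f1 x = (1 / jost k 0) * jost' k x" for x
  define F2 where "F2 x = (\<theta> / mirror.jost k 0) * mirror.jost k (- x)" for x
  define f2 where "f2 x = (\<theta> / mirror.jost k 0) * - mirror.jost' k (- x)" for x
  have p: "jost k 0 \<ge> 1" "mirror.jost k 0 \<ge> 1"
    using jost_lower[of k 0] mirror.jost_lower[of k 0] k R_pos by auto
  have s1: "solves_on UNIV ?q F1 f1"
    unfolding F1_def f1_def by (rule solves_on_cmult[OF jost_solves])
  have "solves_on UNIV ?q (\<lambda>x. mirror.jost k (- x)) (\<lambda>x. - mirror.jost' k (- x))"
    using solves_on_reflect[OF mirror.jost_solves[of k]] by simp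
  from solves_on_cmult[OF this, of "\<theta> / mirror.jost k 0"]
  have s2: "solves_on UNIV ?q F2 f2" unfolding F2_def f2_def by simp
  note reg1 = solves_on_regularity[OF s1 pot_meas pot_bound]
  note reg2 = solves_on_regularity[OF s2 pot_meas pot_bound]
  define r where "r x = (if x < 0 then F1 x else F2 x)" for x
  define r' where "r' x = (if x < 0 then f1 x else f2 x)" for x
  define h where "h x = ?q x * r x" for x
  have h_eq: "h x = (if x < 0 then ?q x * F1 x else ?q x * F2 x)" for x by (simp add: h_def r_def)
  have w1: "weak_derivative_on (- {0}) r r'"
    unfolding r_def r'_def
  proof (rule weak_derivative_on_glued)
    show "(f1 has_integral F1 d - F1 c) {c..d}" "(f2 has_integral F2 d - F2 c) {c..d}" if "c \<le> d" for c d
      using solves_on_has_integral_deriv[OF s1 that] solves_on_has_integral_deriv[OF s2 that] by auto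
  qed (use reg1 reg2 in \<open>auto intro: continuous_lebesgue_measurable continuous_locally_bounded\<close>)
  have w2: "weak_derivative_on (- {0}) r' h"
    unfolding r'_def h_eq[abs_def]
  proof (rule weak_derivative_on_glued)
    show "((\<lambda>x. ?q x * F1 x) has_integral f1 d - f1 c) {c..d}" "((\<lambda>x. ?q x * F2 x) has_integral f2 d - f2 c) {c..d}" if "c \<le> d" for c d
      using solves_onD(2)[OF s1 that] solves_onD(2)[OF s2 that] by auto
    show "\<exists>M. \<forall>x\<in>{- N..N}. \<bar>?q x * F1 x\<bar> \<le> M" "\<exists>M. \<forall>x\<in>{- N..N}. \<bar>?q x * F2 x\<bar> \<le> M" for N
      by (rule reg1(4), rule reg2(4))
  qed (use reg1 reg2 in auto)
  have m: "r \<in> borel_measurable lebesgue" "r' \<in> borel_measurable lebesgue" "h \<in> borel_measurable lebesgue"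
    unfolding r_def r'_def h_eq[abs_def]
    by (intro measurable_glued continuous_lebesgue_measurable reg1 reg2)+
  define C where "C = (jost_bound k + \<bar>\<theta>\<bar> * mirror.jost_bound k) * exp (k * R)"
  have J: "1 \<le> jost_bound k" "1 \<le> mirror.jost_bound k"
    using jost_bound_ge1[of k] mirror.jost_bound_ge1[of k] k by auto
  have le: "\<bar>1\<bar> * (jost_bound k * (exp (k * R) * exp (- (k * \<bar>x\<bar>)))) \<le> C * exp (- (k * \<bar>x\<bar>))"
    "\<bar>\<theta>\<bar> * (mirror.jost_bound k * (exp (k * R) * exp (- (k * \<bar>x\<bar>)))) \<le> C * exp (- (k * \<bar>x\<bar>))" for x
    using J by (auto simp: C_def algebra_simps)
  have dec: "\<bar>r x\<bar> \<le> C * exp (- (k * \<bar>x\<bar>)) \<and> \<bar>r' x\<bar> \<le> C * exp (- (k * \<bar>x\<bar>))" for x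
  proof (cases "x < 0")
    case True
    have "\<bar>1 / jost k 0 * jost k x\<bar> \<le> C * exp (- (k * \<bar>x\<bar>)) \<and> \<bar>1 / jost k 0 * jost' k x\<bar> \<le> C * exp (- (k * \<bar>x\<bar>))"
      using jost_normalized_decay[OF less_imp_le[OF k] less_imp_le[OF True], of 1] le(1)[of x] by (meson order_trans)
    then show ?thesis using True unfolding r_def r'_def F1_def f1_def by simp
  next
    case False
    then have x: "- x \<le> 0" by simp
    have "\<bar>\<theta> / mirror.jost k 0 * mirror.jost k (- x)\<bar> \<le> C * exp (- (k * \<bar>x\<bar>)) \<and>
      \<bar>\<theta> / mirror.jost k 0 * mirror.jost' k (- x)\<bar> \<le> C * exp (- (k * \<bar>x\<bar>))"
      using mirror.jost_normalized_decay[OF less_imp_le[OF k] x, of \<theta>] le(2)[of x]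
      unfolding abs_minus_cancel by (meson order_trans)
    then show ?thesis using False unfolding r_def r'_def F2_def f2_def by simp
  qed
  have dech: "\<bar>h x\<bar> \<le> (B + k\<^sup>2) * C * exp (- (k * \<bar>x\<bar>))" for x
  proof -
    have "\<bar>?q x\<bar> * \<bar>r x\<bar> \<le> (B + k\<^sup>2) * (C * exp (- (k * \<bar>x\<bar>)))"
      using pot_bound dec[of x] B_nonneg by (intro mult_mono) auto
    then show ?thesis by (simp add: h_def abs_mult mult.assoc)
  qed
  let ?c = complex_of_real
  have W1: "weak_derivative_on (- {0}) (\<lambda>x. ?c (r x)) (\<lambda>x. ?c (r' x))"
    by (rule weak_derivative_on_bounded_linear[OF w1 bounded_linear_of_real])
  have W2: "weak_derivative_on (- {0}) (\<lambda>x. ?c (r' x)) (\<lambda>x. ?c (h x))"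
    by (rule weak_derivative_on_bounded_linear[OF w2 bounded_linear_of_real])
  have sob: "(\<lambda>x. ?c (r x)) \<in> sobolev_2_2 (- {0})"
  proof -
    have "square_integrable_on (- {0}) (\<lambda>x. ?c (r x))"
      by (rule square_integrable_on_exp_decay[OF m(1) k]) (use dec in auto)
    moreover have "square_integrable_on (- {0}) (\<lambda>x. ?c (r' x))"
      by (rule square_integrable_on_exp_decay[OF m(2) k]) (use dec in auto)
    moreover have "square_integrable_on (- {0}) (\<lambda>x. ?c (h x))"
      by (rule square_integrable_on_exp_decay[OF m(3) k dech]) simp
    ultimately show ?thesis unfolding sobolev_2_2_def using W1 W2 by blast
  qed
  have dr: "(r has_real_derivative r' x) (at x)" if "x \<noteq> 0" for x
  proof (cases "x < 0")
    case True
    have "(F1 has_real_derivative r' x) (at x)" using solves_onD(1)[OF s1] True by (simp add: r'_def)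
    then show ?thesis by (rule has_field_derivative_transform_within_open[where S="{..<0}"]) (use True in \<open>auto simp: r_def\<close>)
  next
    case False
    have "(F2 has_real_derivative r' x) (at x)" using solves_onD(1)[OF s2] False by (simp add: r'_def)
    then show ?thesis by (rule has_field_derivative_transform_within_open[where S="{0<..}"]) (use False that in \<open>auto simp: r_def\<close>)
  qed
  have cr': "continuous_on (- {0}) r'"
  proof (rule continuous_at_imp_continuous_on, rule ballI)
    fix x :: real assume x: "x \<in> - {0}"
    show "isCont r' x"
    proof (cases "x < 0")
      case True
      have "isCont f1 x" using reg1(2) by (simp add: continuous_on_eq_continuous_at)
      moreover have "\<forall>\<^sub>F t in nhds x. r' t = f1 t"
        using eventually_nhds_in_open[of "{..<0}" x] True by (auto elim!: eventually_mono simp: r'_def)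
      ultimately show ?thesis using isCont_cong by blast
    next
      case False
      have "isCont f2 x" using reg2(2) by (simp add: continuous_on_eq_continuous_at)
      moreover have "\<forall>\<^sub>F t in nhds x. r' t = f2 t"
        using eventually_nhds_in_open[of "{0<..}" x] False x by (auto elim!: eventually_mono simp: r'_def)
      ultimately show ?thesis using isCont_cong by blast
    qed
  qed
  have lims: "(r \<longlongrightarrow> 1) (at_left 0)" "(r \<longlongrightarrow> \<theta>) (at_right 0)"
    "(r' \<longlongrightarrow> f1 0) (at_left 0)" "(r' \<longlongrightarrow> f2 0) (at_right 0)"
  proof -
    have e: "F1 0 = 1" "F2 0 = \<theta>" using p by (auto simp: F1_def F2_def)
    have l: "(g \<longlongrightarrow> g 0) (at_left 0)" "(g \<longlongrightarrow> g 0) (at_right 0)" if "continuous_on UNIV g" for g :: "real \<Rightarrow> real"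
      using that by (auto simp: continuous_on_def intro: tendsto_within_subset)
    have evl: "\<forall>\<^sub>F x in at_left (0::real). x < 0" and evr: "\<forall>\<^sub>F x in at_right (0::real). x > 0"
      by (simp_all add: eventually_at_filter)
    show "(r \<longlongrightarrow> 1) (at_left 0)"
      by (rule Lim_transform_eventually[OF l(1)[OF reg1(1), unfolded e]])
        (use evl in \<open>auto elim!: eventually_mono simp: r_def\<close>)
    show "(r' \<longlongrightarrow> f1 0) (at_left 0)"
      by (rule Lim_transform_eventually[OF l(1)[OF reg1(2)]])
        (use evl in \<open>auto elim!: eventually_mono simp: r'_def\<close>)
    show "(r \<longlongrightarrow> \<theta>) (at_right 0)"
      by (rule Lim_transform_eventually[OF l(2)[OF reg2(1), unfolded e]])
        (use evr in \<open>auto elim!: eventually_mono simp: r_def\<close>)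
    show "(r' \<longlongrightarrow> f2 0) (at_right 0)"
      by (rule Lim_transform_eventually[OF l(2)[OF reg2(2)]])
        (use evr in \<open>auto elim!: eventually_mono simp: r'_def\<close>)
  qed
  have jump: "f2 0 = inverse \<theta> * f1 0 + \<eta>"
  proof -
    have "\<theta> * (\<theta> * (mirror.jost' k 0 / mirror.jost k 0)) = - (jost' k 0 / jost k 0 + \<theta> * \<eta>)"
      using F by (simp add: secular_def power2_eq_square mult.assoc)
    then have "\<theta> * f2 0 = f1 0 + \<theta> * \<eta>" by (simp add: f1_def f2_def)
    then show ?thesis using theta by (simp add: field_simps)
  qed
  have dom: "(\<lambda>x. ?c (r x)) \<in> interface_domain \<theta> \<eta>"
    unfolding interface_domain_def mem_Collect_eq
  proof (intro conjI sob exI)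
    show "AE x in lebesgue. ?c (r x) = ?c (r x)" by simp
    show "\<forall>x. x \<noteq> 0 \<longrightarrow> ((\<lambda>x. ?c (r x)) has_vector_derivative ?c (r' x)) (at x)"
      using dr by (auto intro: has_vector_derivative_of_real)
    show "continuous_on (- {0}) (\<lambda>x. ?c (r' x))" by (intro continuous_intros cr')
    show "((\<lambda>x. ?c (r x)) \<longlongrightarrow> ?c 1) (at_left 0)" "((\<lambda>x. ?c (r x)) \<longlongrightarrow> ?c \<theta>) (at_right 0)"
      "((\<lambda>x. ?c (r' x)) \<longlongrightarrow> ?c (f1 0)) (at_left 0)" "((\<lambda>x. ?c (r' x)) \<longlongrightarrow> ?c (f2 0)) (at_right 0)"
      by (intro tendsto_of_real lims)+
    show "?c \<theta> = ?c \<theta> * ?c 1" by simp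
    show "?c (f2 0) = ?c (inverse \<theta>) * ?c (f1 0) + ?c \<eta> * ?c 1" unfolding jump by simp
  qed
  have "is_eigenvalue (H_interface W \<theta> \<eta>) (?c (- (k\<^sup>2)))"
    unfolding is_eigenvalue_def
  proof (intro exI conjI)
    show "((\<lambda>x. ?c (r x)), \<lambda>x. ?c (- (k\<^sup>2)) * ?c (r x)) \<in> H_interface W \<theta> \<eta>"
      unfolding H_interface_def
      by (rule schrodinger_operatorI[OF dom W1 W2]) (simp add: h_def algebra_simps)
    show "\<not> (AE x in lebesgue. ?c (r x) = 0)"
      by (rule not_AE_zero[of "-2" "-1"]) (use jost_pos[of k] k p in \<open>auto simp: r_def F1_def less_imp_neq[symmetric]\<close>)
  qed auto
  then show ?thesis using k by (simp add: negative_eigenvalue_def)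
qed

theorem interface_eigenvalue_iff:
  "negative_eigenvalue (H_interface W \<theta> \<eta>) \<mu> \<longleftrightarrow> (\<exists>k>0. \<mu> = - (k\<^sup>2) \<and> secular k = 0)"
  using eigenvalue_imp_secular secular_imp_eigenvalue by blast

end

section \<open>The roots of the two spectral equations\<close>

context interface
begin

lemma secular_mono:
  assumes "0 \<le> k" "k \<le> l" "l \<le> K"
  shows "(l - k) / (jost_bound K)\<^sup>2 \<le> secular l - secular k"
proof -
  have "0 \<le> (l - k) / (mirror.jost_bound K)\<^sup>2" using assms by simp
  also have "\<dots> \<le> mirror.jost' l 0 / mirror.jost l 0 - mirror.jost' k 0 / mirror.jost k 0"
    by (rule mirror.jost_log_derivative_mono[OF assms])
  finally have "0 \<le> \<theta>\<^sup>2 * (mirror.jost' l 0 / mirror.jost l 0 - mirror.jost' k 0 / mirror.jost k 0)" by simp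
  then show ?thesis using jost_log_derivative_mono[OF assms]
    by (simp add: secular_def right_diff_distrib)
qed

lemma secular_strict_mono: "0 \<le> k \<Longrightarrow> k < l \<Longrightarrow> secular k < secular l"
proof -
  assume kl: "0 \<le> k" "k < l"
  then have "0 < (l - k) / (jost_bound l)\<^sup>2" using jost_bound_ge1[of l] by simp
  then show ?thesis using secular_mono[of k l l] kl by simp
qed

lemma secular_continuous:
  assumes K: "0 \<le> K" shows "continuous_on {0..K} secular"
proof -
  have z: "0 \<in> {-R..R}" using R_pos by simp
  have nz: "jost k 0 \<noteq> 0" "mirror.jost k 0 \<noteq> 0" if "k \<in> {0..K}" for k
    using jost_pos[of k 0] mirror.jost_pos[of k 0] that by auto
  show ?thesis unfolding secular_def[abs_def]
    by (intro continuous_intros jost_continuous_param[OF K z] mirror.jost_continuous_param[OF K z] ballI nz)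
qed

text \<open>At zero the logarithmic derivatives are at most the integrals of \<open>W\<close> over the two half-lines, at
  \<open>K = - \<theta> \<eta>\<close> they are at least \<open>K\<close>; this gives the signs needed for the intermediate value theorem.
  Strict monotonicity gives uniqueness.\<close>
lemma secular_root:
  assumes neg: "integral {-R..0} W + \<theta>\<^sup>2 * integral {0..R} W + \<theta> * \<eta> < 0"
  obtains k where "k > 0" "secular k = 0" "\<And>l. l > 0 \<Longrightarrow> secular l = 0 \<Longrightarrow> l = k"
proof -
  have p: "jost k 0 > 0" "mirror.jost k 0 > 0" if "k \<ge> 0" for k using jost_pos mirror.jost_pos that by auto
  have Wn: "0 \<le> integral {a..b} W" for a b
    by (rule integral_nonneg[OF bounded_measurable_integrable[OF W_meas W_bound]]) (rule W_nonneg)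
  have refl: "integral {-R..0} (\<lambda>x. W (- x)) = integral {0..R} W"
    using Henstock_Kurzweil_Integration.integral_reflect_real[of R 0 W] by simp
  have "jost' 0 0 / jost 0 0 \<le> integral {-R..0} W"
    using jost'_le[of 0] p[of 0] by (simp add: pos_divide_le_eq)
  moreover have "mirror.jost' 0 0 / mirror.jost 0 0 \<le> integral {0..R} W"
    using mirror.jost'_le[of 0] p[of 0] refl by (simp add: pos_divide_le_eq)
  then have "\<theta>\<^sup>2 * (mirror.jost' 0 0 / mirror.jost 0 0) \<le> \<theta>\<^sup>2 * integral {0..R} W"
    by (intro mult_left_mono) auto
  ultimately have lo: "secular 0 < 0" using neg by (simp add: secular_def)
  define K where "K = - (\<theta> * \<eta>)"
  have "0 \<le> \<theta>\<^sup>2 * integral {0..R} W" using Wn by (intro mult_nonneg_nonneg) auto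
  then have K: "K \<ge> 0" using neg Wn[of "-R" 0] by (simp add: K_def)
  have "K \<le> jost' K 0 / jost K 0" using jost'_ge[OF K] p(1)[OF K] by (simp add: pos_le_divide_eq)
  moreover have "K \<le> mirror.jost' K 0 / mirror.jost K 0" using mirror.jost'_ge[OF K] p(2)[OF K] by (simp add: pos_le_divide_eq)
  then have "0 \<le> \<theta>\<^sup>2 * (mirror.jost' K 0 / mirror.jost K 0)" using K by (intro mult_nonneg_nonneg) auto
  ultimately have hi: "0 \<le> secular K" by (simp add: secular_def K_def)
  obtain k where k: "0 \<le> k" "k \<le> K" "secular k = 0"
    using IVT'[of secular 0 0 K] lo hi K secular_continuous[OF K] by auto
  then have "k \<noteq> 0" using lo by auto
  then have k0: "k > 0" using k by simp
  show thesis
  proof (rule that[OF k0 k(3)])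
    fix l assume "l > 0" "secular l = 0"
    then show "l = k" using secular_strict_mono[of k l] secular_strict_mono[of l k] k by (cases k l rule: linorder_cases) auto
  qed
qed

end

lemma product_difference_bound:
  fixes x y x0 y0 :: real
  assumes "\<bar>x - x0\<bar> \<le> \<delta>" "\<bar>y - y0\<bar> \<le> \<delta>" "\<bar>y\<bar> \<le> J" "\<bar>x0\<bar> \<le> J"
  shows "\<bar>x * y - x0 * y0\<bar> \<le> 2 * J * \<delta>"
proof -
  have eq: "x * y - x0 * y0 = (x - x0) * y + x0 * (y - y0)" by (simp add: algebra_simps)
  have 1: "\<bar>(x - x0) * y\<bar> \<le> \<delta> * J" unfolding abs_mult using assms by (intro mult_mono) auto
  have 2: "\<bar>x0 * (y - y0)\<bar> \<le> J * \<delta>" unfolding abs_mult using assms by (intro mult_mono) auto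
  have "\<bar>x * y - x0 * y0\<bar> \<le> \<bar>(x - x0) * y\<bar> + \<bar>x0 * (y - y0)\<bar>" unfolding eq by (rule abs_triangle_ineq)
  then show ?thesis using 1 2 mult.commute[of \<delta> J] by linarith
qed

text \<open>The data of the theorem in normalised form. The conditions on \<open>v\<close> and \<open>v'\<close> at \<open>\<plusminus>R\<close> say that \<open>v\<close> is constant
  outside \<open>[- R, R]\<close>.\<close>
locale resonance = barrier W R B for W :: "real \<Rightarrow> real" and R B :: real +
  fixes U V v v' :: "real \<Rightarrow> real" and v_minus v_plus :: real
  assumes U_meas: "U \<in> borel_measurable lebesgue" and U_bound: "\<And>x. \<bar>U x\<bar> \<le> B"
    and U_supp: "\<And>x. R \<le> \<bar>x\<bar> \<Longrightarrow> U x = 0"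
    and V_meas: "V \<in> borel_measurable lebesgue" and V_bound: "\<And>x. \<bar>V x\<bar> \<le> B"
    and V_supp: "\<And>x. R \<le> \<bar>x\<bar> \<Longrightarrow> V x = 0"
    and v_solves: "solves_on UNIV V v v'"
    and v_left: "v (- R) = v_minus" "v' (- R) = 0" and v_right: "v R = v_plus" "v' R = 0"
    and v_nonzero: "v_minus \<noteq> 0" "v_plus \<noteq> 0"
begin

definition coupling :: real where "coupling = integral {-R..R} (\<lambda>x. U x * (v x)\<^sup>2)"

definition scaled_potential :: "real \<Rightarrow> real \<Rightarrow> real" where
  "scaled_potential \<epsilon> x = W x + U (x / \<epsilon>) / \<epsilon> + V (x / \<epsilon>) / \<epsilon>\<^sup>2"

lemma scaled_potential_shooting:
  assumes e: "0 < \<epsilon>" "\<epsilon> \<le> 1"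
  shows "shooting (scaled_potential \<epsilon>) R (B + B / \<epsilon> + B / \<epsilon>\<^sup>2)"
proof
  have m: "(\<lambda>x. q (x / \<epsilon>)) \<in> borel_measurable lebesgue" if "q \<in> borel_measurable lebesgue" for q :: "real \<Rightarrow> real"
    using measurable_affine_lebesgue[OF that, of "1 / \<epsilon>" 0] e by simp
  show "scaled_potential \<epsilon> \<in> borel_measurable lebesgue"
    unfolding scaled_potential_def[abs_def]
    by (rule borel_measurable_add[OF borel_measurable_add[OF W_meas
          borel_measurable_divide[OF m[OF U_meas] borel_measurable_const]]
          borel_measurable_divide[OF m[OF V_meas] borel_measurable_const]])
  show "\<bar>scaled_potential \<epsilon> x\<bar> \<le> B + B / \<epsilon> + B / \<epsilon>\<^sup>2" for x
  proof -
    have "\<bar>U (x / \<epsilon>) / \<epsilon>\<bar> \<le> B / \<epsilon>" "\<bar>V (x / \<epsilon>) / \<epsilon>\<^sup>2\<bar> \<le> B / \<epsilon>\<^sup>2"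
      using U_bound V_bound e by (auto simp: abs_divide intro!: divide_right_mono)
    then show ?thesis using W_bound[of x] unfolding scaled_potential_def by linarith
  qed
  show "scaled_potential \<epsilon> x = 0" if x: "R \<le> \<bar>x\<bar>" for x
  proof -
    have "R * \<epsilon> \<le> \<bar>x\<bar>" using x e R_pos mult_left_le[of \<epsilon> R] by linarith
    then have "R \<le> \<bar>x / \<epsilon>\<bar>" using e by (simp add: abs_divide pos_le_divide_eq)
    then show ?thesis using W_supp U_supp V_supp x by (simp add: scaled_potential_def)
  qed
qed (rule R_pos)

text \<open>To the right of \<open>R\<close> the solution is a combination of \<open>exp (k x)\<close> and \<open>exp (- k x)\<close>; up to a nonzero
  factor this is the coefficient of the growing exponential.\<close>
definition shot :: "real \<Rightarrow> real \<Rightarrow> real" where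
  "shot \<epsilon> k = shooting.jost' (scaled_potential \<epsilon>) R k R + k * shooting.jost (scaled_potential \<epsilon>) R k R"

lemma shot_eigenvalue:
  assumes e: "0 < \<epsilon>" "\<epsilon> \<le> 1" and k: "k > 0" and s: "shot \<epsilon> k = 0"
  shows "negative_eigenvalue (schrodinger_operator UNIV (scaled_potential \<epsilon>) (sobolev_2_2 UNIV)) (- (k\<^sup>2))"
proof -
  interpret E: shooting "scaled_potential \<epsilon>" R "B + B / \<epsilon> + B / \<epsilon>\<^sup>2" by (rule scaled_potential_shooting[OF e])
  show ?thesis by (rule E.eigenvalue_of_decaying_jost[OF k]) (use s in \<open>simp add: shot_def\<close>)
qed

lemma shot_continuous:
  assumes e: "0 < \<epsilon>" "\<epsilon> \<le> 1" and K: "0 \<le> K"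
  shows "continuous_on {0..K} (shot \<epsilon>)"
proof -
  interpret E: shooting "scaled_potential \<epsilon>" R "B + B / \<epsilon> + B / \<epsilon>\<^sup>2" by (rule scaled_potential_shooting[OF e])
  have "R \<in> {-R..R}" using R_pos by simp
  from E.jost_continuous_param[OF K this] show ?thesis
    unfolding shot_def[abs_def] by (intro continuous_intros)
qed

end

sublocale resonance \<subseteq> interface W R B "v_plus / v_minus" "1 / (v_minus * v_plus) * coupling"
  by unfold_locales (use v_nonzero in simp)

context resonance
begin

text \<open>The solution is followed from \<open>- \<epsilon> R\<close> to \<open>\<epsilon> R\<close> in the variable \<open>t = x / \<epsilon>\<close> and compared with the multiple of
  \<open>v\<close> that has the same value at \<open>t = - R\<close>. Stability controls the values up to \<open>O(\<epsilon>)\<close>. The slope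
  with respect to \<open>x\<close> is \<open>1 / \<epsilon>\<close> times the slope with respect to \<open>t\<close> and needs one more order, which
  comes from the Wronskian with \<open>v\<close>.\<close>
lemma shot_asymptotics:
  assumes K: "0 \<le> K"
  obtains C where "C \<ge> 0" "\<And>\<epsilon> k. 0 < \<epsilon> \<Longrightarrow> \<epsilon> \<le> 1 \<Longrightarrow> 0 \<le> k \<Longrightarrow> k \<le> K \<Longrightarrow>
    \<bar>v_plus / v_minus * shot \<epsilon> k - secular k * (jost k 0 * mirror.jost k 0)\<bar> \<le> C * \<epsilon>"
proof -
  define \<theta> where "\<theta> = v_plus / v_minus"
  define J where "J = jost_bound K + mirror.jost_bound K"
  have J1: "1 \<le> jost_bound K" "1 \<le> mirror.jost_bound K" using jost_bound_ge1[OF K] mirror.jost_bound_ge1[OF K] by auto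
  then have J: "jost_bound K \<le> J" "mirror.jost_bound K \<le> J" "0 \<le> J" by (auto simp: J_def)
  obtain Nv where Nv: "Nv \<ge> 0" "\<And>t. t \<in> {-R..R} \<Longrightarrow> \<bar>v t\<bar> \<le> Nv"
    using bounded_on_Icc[OF solves_on_continuous(1)[OF v_solves subset_UNIV V_bound]] by metis
  \<comment> \<open>\<open>c1 \<epsilon>\<close> bounds the perturbation of \<open>V\<close>, \<open>M\<close> all inner potentials, \<open>Y\<close> the comparison
    solution, \<open>c2 \<epsilon>\<close> the deviation from it, \<open>c3 \<epsilon>\<^sup>2\<close> the error in the integrand of the Wronskian identity, and
    \<open>\<kappa> \<epsilon>\<close> the change of the outer solutions between \<open>0\<close> and \<open>\<plusminus>\<epsilon> R\<close>\<close>
  define c1 where "c1 = 2 * B + K\<^sup>2"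
  define M where "M = B + c1"
  define Y where "Y = J * Nv / \<bar>v_minus\<bar>"
  define c2 where "c2 = (J + c1 * Y * (2 * R)) * exp ((1 + M) * (2 * R))"
  define c3 where "c3 = B * c2 * Nv + (B + K\<^sup>2) * (Y + c2) * Nv"
  define c4 where "c4 = c3 * (2 * R)"
  define \<kappa> where "\<kappa> = (1 + (B + K\<^sup>2)) * J * R"
  have nn: "0 \<le> B" "0 \<le> R" "0 \<le> c1" "0 \<le> Y" "0 \<le> c2" "0 \<le> M" "0 \<le> \<kappa>"
  proof -
    show B: "0 \<le> B" and Rn: "0 \<le> R" using B_nonneg R_pos by auto
    show c1n: "0 \<le> c1" unfolding c1_def using B by simp
    show Yn: "0 \<le> Y" unfolding Y_def using J Nv by simp
    have "0 \<le> J + c1 * Y * (2 * R)" by (intro add_nonneg_nonneg mult_nonneg_nonneg) (use J c1n Yn Rn in auto)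
    then show "0 \<le> c2" unfolding c2_def by simp
    show "0 \<le> M" unfolding M_def using B c1n by simp
    show "0 \<le> \<kappa>" unfolding \<kappa>_def using J Rn B by simp
  qed
  have c3n: "0 \<le> c3" unfolding c3_def using nn Nv by (intro add_nonneg_nonneg mult_nonneg_nonneg) auto
  define C where "C = c4 * J / \<bar>v_minus\<bar> + \<bar>\<theta>\<bar> * c2 * J + 2 * J * \<kappa> + \<bar>coupling / v_minus\<^sup>2\<bar> * (2 * J * \<kappa>) + \<theta>\<^sup>2 * (2 * J * \<kappa>)"
  have C0: "C \<ge> 0" unfolding C_def c4_def
    by (intro add_nonneg_nonneg mult_nonneg_nonneg divide_nonneg_nonneg) (use c3n nn J in auto)
  have main: "\<bar>\<theta> * shot \<epsilon> k - secular k * (jost k 0 * mirror.jost k 0)\<bar> \<le> C * \<epsilon>"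
    if e: "0 < \<epsilon>" "\<epsilon> \<le> 1" and k: "0 \<le> k" "k \<le> K" for \<epsilon> k
  proof -
    interpret E: shooting "scaled_potential \<epsilon>" R "B + B / \<epsilon> + B / \<epsilon>\<^sup>2" by (rule scaled_potential_shooting[OF e])
    have eR: "\<epsilon> * R \<le> R" "0 \<le> \<epsilon> * R" using e R_pos by auto
    have xin: "- (\<epsilon> * R) \<in> {-R..0}" using eR by auto
    have xin': "- (\<epsilon> * R) \<in> {-R..R}" "0 \<in> {-R..R}" using eR R_pos by auto
    define a where "a = jost k 0"
    define a' where "a' = jost' k 0"
    define b where "b = mirror.jost k 0"
    define b' where "b' = mirror.jost' k 0"
    define ae where "ae = jost k (- (\<epsilon> * R))"
    define ae' where "ae' = jost' k (- (\<epsilon> * R))"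
    define be where "be = mirror.jost k (- (\<epsilon> * R))"
    define be' where "be' = mirror.jost' k (- (\<epsilon> * R))"
    have bnd: "\<bar>a\<bar> \<le> J" "\<bar>a'\<bar> \<le> J" "\<bar>ae\<bar> \<le> J" "\<bar>ae'\<bar> \<le> J" "\<bar>be\<bar> \<le> J" "\<bar>be'\<bar> \<le> J"
      using jost_upper[OF k xin'(1)] jost_upper[OF k xin'(2)] mirror.jost_upper[OF k xin'(1)] J
      unfolding a_def a'_def ae_def ae'_def be_def be'_def by linarith+
    have lipn: "jost_bound K * \<bar>- (\<epsilon> * R)\<bar> \<le> \<kappa> * \<epsilon>" "(B + K\<^sup>2) * jost_bound K * \<bar>- (\<epsilon> * R)\<bar> \<le> \<kappa> * \<epsilon>"
      "mirror.jost_bound K * \<bar>- (\<epsilon> * R)\<bar> \<le> \<kappa> * \<epsilon>" "(B + K\<^sup>2) * mirror.jost_bound K * \<bar>- (\<epsilon> * R)\<bar> \<le> \<kappa> * \<epsilon>"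
    proof -
      have p: "c * j * \<bar>- (\<epsilon> * R)\<bar> \<le> \<kappa> * \<epsilon>" if "0 \<le> c" "c \<le> 1 + (B + K\<^sup>2)" "0 \<le> j" "j \<le> J" for c j
      proof -
        have "c * j \<le> (1 + (B + K\<^sup>2)) * J" by (rule mult_mono) (use that in auto)
        then have "c * j * (\<epsilon> * R) \<le> (1 + (B + K\<^sup>2)) * J * (\<epsilon> * R)"
          by (rule mult_right_mono[OF _ eR(2)])
        then show ?thesis using eR by (simp add: \<kappa>_def mult_ac)
      qed
      show "jost_bound K * \<bar>- (\<epsilon> * R)\<bar> \<le> \<kappa> * \<epsilon>" using p[of 1 "jost_bound K"] nn J J1 by simp
      show "mirror.jost_bound K * \<bar>- (\<epsilon> * R)\<bar> \<le> \<kappa> * \<epsilon>" using p[of 1 "mirror.jost_bound K"] nn J J1 by simp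
      show "(B + K\<^sup>2) * jost_bound K * \<bar>- (\<epsilon> * R)\<bar> \<le> \<kappa> * \<epsilon>" by (rule p) (use nn J J1 in auto)
      show "(B + K\<^sup>2) * mirror.jost_bound K * \<bar>- (\<epsilon> * R)\<bar> \<le> \<kappa> * \<epsilon>" by (rule p) (use nn J J1 in auto)
    qed
    have lip: "\<bar>ae - a\<bar> \<le> \<kappa> * \<epsilon>" "\<bar>ae' - a'\<bar> \<le> \<kappa> * \<epsilon>" "\<bar>be - b\<bar> \<le> \<kappa> * \<epsilon>" "\<bar>be' - b'\<bar> \<le> \<kappa> * \<epsilon>"
      using jost_near_0[OF k xin] mirror.jost_near_0[OF k xin] lipn
      unfolding a_def a'_def b_def b'_def ae_def ae'_def be_def be'_def by linarith+
    have outer: "scaled_potential \<epsilon> x = W x" if "\<epsilon> * R \<le> \<bar>x\<bar>" for x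
    proof -
      have "R \<le> \<bar>x / \<epsilon>\<bar>" using that e by (simp add: abs_divide pos_le_divide_eq mult.commute)
      then show ?thesis using U_supp V_supp by (simp add: scaled_potential_def)
    qed
    define y where "y = E.jost k"
    define z where "z = E.jost' k"
    have ysol: "solves_on UNIV (\<lambda>x. scaled_potential \<epsilon> x + k\<^sup>2) y z" unfolding y_def z_def by (rule E.jost_solves)
    have yl: "y (- (\<epsilon> * R)) = ae \<and> z (- (\<epsilon> * R)) = ae'"
      unfolding ae_def ae'_def
    proof (rule solution_unique[OF ysol jost_solves, where a="-R" and b="- (\<epsilon> * R)"])
      show "scaled_potential \<epsilon> t + k\<^sup>2 = W t + k\<^sup>2" if "t \<in> {-R..- (\<epsilon> * R)}" for t
        using outer[of t] that eR by auto
      show "\<bar>scaled_potential \<epsilon> t + k\<^sup>2\<bar> \<le> B + B / \<epsilon> + B / \<epsilon>\<^sup>2 + k\<^sup>2" for t by (rule E.pot_bound)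
    qed (use E.jost_init jost_init eR in \<open>auto simp: y_def z_def\<close>)
    have msol: "solves_on UNIV (\<lambda>x. W x + k\<^sup>2) (\<lambda>x. mirror.jost k (- x)) (\<lambda>x. - mirror.jost' k (- x))"
      using solves_on_reflect[OF mirror.jost_solves[of k]] by simp
    \<comment> \<open>beyond \<open>\<epsilon> R\<close> the Wronskian with the solution decaying to the right is constant, and at \<open>R\<close> it
      equals \<open>shot \<epsilon> k\<close>\<close>
    have shot: "shot \<epsilon> k = z (\<epsilon> * R) * be + y (\<epsilon> * R) * be'"
    proof -
      define M' where "M' = B + B / \<epsilon> + B / \<epsilon>\<^sup>2 + k\<^sup>2"
      have bW: "\<bar>W t + k\<^sup>2\<bar> \<le> M'" for t using pot_bound[of t k] B_nonneg e unfolding M'_def by (auto intro: order_trans)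
      have "((\<lambda>t. ((scaled_potential \<epsilon> t + k\<^sup>2) - (W t + k\<^sup>2)) * y t * mirror.jost k (- t)) has_integral
           (z R * mirror.jost k (- R) - y R * - mirror.jost' k (- R)) - (z (\<epsilon> * R) * mirror.jost k (- (\<epsilon> * R)) - y (\<epsilon> * R) * - mirror.jost' k (- (\<epsilon> * R)))) {\<epsilon> * R..R}"
        by (rule wronskian_integral[OF ysol msol eR(1) subset_UNIV _ bW]) (unfold M'_def, rule E.pot_bound)
      moreover have "((\<lambda>t. ((scaled_potential \<epsilon> t + k\<^sup>2) - (W t + k\<^sup>2)) * y t * mirror.jost k (- t)) has_integral 0) {\<epsilon> * R..R}"
        by (rule has_integral_is_0) (use outer eR in auto)
      ultimately have "(z R * mirror.jost k (- R) - y R * - mirror.jost' k (- R)) - (z (\<epsilon> * R) * mirror.jost k (- (\<epsilon> * R)) - y (\<epsilon> * R) * - mirror.jost' k (- (\<epsilon> * R))) = 0"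
        by (rule has_integral_unique)
      then show ?thesis using mirror.jost_init[of k]
        by (simp add: shot_def y_def z_def be_def be'_def mult.commute)
    qed
    define Q where "Q t = \<epsilon>\<^sup>2 * (scaled_potential \<epsilon> (\<epsilon> * t) + k\<^sup>2)" for t
    define w where "w t = y (\<epsilon> * t)" for t
    define w' where "w' t = \<epsilon> * z (\<epsilon> * t)" for t
    have wsol: "solves_on UNIV Q w w'"
      using solves_on_affine[OF ysol, of \<epsilon> 0] e unfolding Q_def w_def w'_def by simp
    have Qe: "Q t - V t = \<epsilon> * U t + \<epsilon>\<^sup>2 * (W (\<epsilon> * t) + k\<^sup>2)" for t
      using e by (simp add: Q_def scaled_potential_def field_simps power2_eq_square)
    have e2: "\<epsilon>\<^sup>2 \<le> \<epsilon>" using e by (simp add: power2_eq_square mult_left_le)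
    have Wk: "\<bar>W x + k\<^sup>2\<bar> \<le> B + K\<^sup>2" for x by (rule pot_bound_le[OF k])
    have Qclose: "\<bar>Q t - V t\<bar> \<le> c1 * \<epsilon>" for t
    proof -
      have "\<bar>\<epsilon> * U t\<bar> \<le> \<epsilon> * B" using U_bound e by (simp add: abs_mult)
      moreover have "\<bar>\<epsilon>\<^sup>2 * (W (\<epsilon> * t) + k\<^sup>2)\<bar> \<le> \<epsilon> * (B + K\<^sup>2)"
        unfolding abs_mult using Wk e2 e by (intro mult_mono) auto
      ultimately show ?thesis unfolding Qe c1_def by (simp add: algebra_simps)
    qed
    have Qb: "\<bar>Q t\<bar> \<le> M" for t
    proof -
      have "c1 * \<epsilon> \<le> c1" using e nn by (simp add: mult_left_le)
      then show ?thesis using Qclose[of t] V_bound[of t] unfolding M_def by linarith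
    qed
    \<comment> \<open>the comparison solution\<close>
    define u where "u t = (ae / v_minus) * v t" for t
    define u' where "u' t = (ae / v_minus) * v' t" for t
    have usol: "solves_on UNIV V u u'" unfolding u_def u'_def by (rule solves_on_cmult[OF v_solves])
    have ub: "\<bar>u t\<bar> \<le> Y" if "t \<in> {-R..R}" for t
    proof -
      have "\<bar>ae\<bar> / \<bar>v_minus\<bar> * \<bar>v t\<bar> \<le> J / \<bar>v_minus\<bar> * Nv"
        using bnd Nv that J by (intro mult_mono divide_right_mono) auto
      then show ?thesis by (simp add: u_def Y_def abs_mult abs_divide)
    qed
    have init: "w (- R) = ae" "w' (- R) = \<epsilon> * ae'" "u (- R) = ae" "u' (- R) = 0"
      using yl v_left v_nonzero by (auto simp: w_def w'_def u_def u'_def)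
    have close: "\<bar>w t - u t\<bar> \<le> c2 * \<epsilon>" if t: "t \<in> {-R..R}" for t
    proof -
      have "\<bar>w t - u t\<bar> + \<bar>w' t - u' t\<bar> \<le> (\<bar>w (- R) - u (- R)\<bar> + \<bar>w' (- R) - u' (- R)\<bar> + c1 * \<epsilon> * Y * (R - - R)) * exp ((1 + M) * (t - - R))"
        by (rule solution_stability[OF wsol usol subset_UNIV Qb V_bound Qclose ub t])
      also have "\<dots> \<le> (\<epsilon> * (J + c1 * Y * (2 * R))) * exp ((1 + M) * (2 * R))"
      proof (rule mult_mono)
        have "\<epsilon> * \<bar>ae'\<bar> \<le> \<epsilon> * J" using bnd e by (intro mult_left_mono) auto
        then show "\<bar>w (- R) - u (- R)\<bar> + \<bar>w' (- R) - u' (- R)\<bar> + c1 * \<epsilon> * Y * (R - - R) \<le> \<epsilon> * (J + c1 * Y * (2 * R))"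
          unfolding init using e by (simp add: abs_mult algebra_simps)
        have "(1 + M) * (t - - R) \<le> (1 + M) * (2 * R)" using nn t by (intro mult_left_mono) auto
        then show "exp ((1 + M) * (t - - R)) \<le> exp ((1 + M) * (2 * R))" by simp
        show "0 \<le> \<epsilon> * (J + c1 * Y * (2 * R))" using e J nn by (intro mult_nonneg_nonneg add_nonneg_nonneg) auto
      qed auto
      finally show ?thesis by (simp add: c2_def mult_ac)
    qed
    \<comment> \<open>\<open>v'\<close> vanishes at \<open>\<plusminus>R\<close>, so only the slopes of \<open>w\<close> appear\<close>
    have wron: "((\<lambda>t. (Q t - V t) * w t * v t) has_integral \<epsilon> * z (\<epsilon> * R) * v_plus - \<epsilon> * ae' * v_minus) {-R..R}"
    proof -
      have bV: "\<bar>V t\<bar> \<le> M" for t using V_bound[of t] nn by (simp add: M_def)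
      have "((\<lambda>t. (Q t - V t) * w t * v t) has_integral (w' R * v R - w R * v' R) - (w' (- R) * v (- R) - w (- R) * v' (- R))) {-R..R}"
        by (rule wronskian_integral[OF wsol v_solves _ subset_UNIV Qb bV]) (use R_pos in simp)
      then show ?thesis using v_left v_right yl by (simp add: w'_def)
    qed
    have Ui: "((\<lambda>t. \<epsilon> * (ae / v_minus) * (U t * (v t)\<^sup>2)) has_integral \<epsilon> * (ae / v_minus) * coupling) {-R..R}"
    proof -
      have cv: "continuous_on {-R..R} v" by (rule solves_on_continuous(1)[OF v_solves subset_UNIV V_bound])
      have "(\<lambda>t. U t * (v t)\<^sup>2) integrable_on {-R..R}"
        by (rule integral_continuous_mult_integrable[OF bounded_measurable_integrable[OF U_meas U_bound] U_bound])
          (intro continuous_intros cv)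
      then show ?thesis unfolding coupling_def by (intro has_integral_mult_right integrable_integral)
    qed
    have zest: "\<bar>z (\<epsilon> * R) * v_plus - ae' * v_minus - ae / v_minus * coupling\<bar> \<le> c4 * \<epsilon>"
    proof -
      have bd: "norm ((Q t - V t) * w t * v t - \<epsilon> * (ae / v_minus) * (U t * (v t)\<^sup>2)) \<le> \<epsilon> * \<epsilon> * c3" if t: "t \<in> {-R..R} - {}" for t
      proof -
        have t': "t \<in> {-R..R}" using t by simp
        have id: "(Q t - V t) * w t * v t - \<epsilon> * (ae / v_minus) * (U t * (v t)\<^sup>2)
          = \<epsilon> * (U t * (w t - u t) * v t) + \<epsilon>\<^sup>2 * ((W (\<epsilon> * t) + k\<^sup>2) * w t * v t)"
          unfolding Qe u_def by (simp add: algebra_simps power2_eq_square)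
        have "\<bar>U t * (w t - u t) * v t\<bar> \<le> B * (c2 * \<epsilon>) * Nv"
          unfolding abs_mult using U_bound close[OF t'] Nv(2)[OF t'] nn e Nv by (intro mult_mono mult_nonneg_nonneg) auto
        then have 1: "\<bar>\<epsilon> * (U t * (w t - u t) * v t)\<bar> \<le> \<epsilon> * (B * (c2 * \<epsilon>) * Nv)"
          unfolding abs_mult[of \<epsilon>] using e by (intro mult_mono) auto
        have "c2 * \<epsilon> \<le> c2" using e nn by (simp add: mult_left_le)
        then have wb: "\<bar>w t\<bar> \<le> Y + c2" using close[OF t'] ub[OF t'] by linarith
        have "\<bar>(W (\<epsilon> * t) + k\<^sup>2) * w t * v t\<bar> \<le> (B + K\<^sup>2) * (Y + c2) * Nv"
          unfolding abs_mult using Wk wb Nv(2)[OF t'] nn Nv by (intro mult_mono mult_nonneg_nonneg) auto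
        then have 2: "\<bar>\<epsilon>\<^sup>2 * ((W (\<epsilon> * t) + k\<^sup>2) * w t * v t)\<bar> \<le> \<epsilon>\<^sup>2 * ((B + K\<^sup>2) * (Y + c2) * Nv)"
          unfolding abs_mult[of "\<epsilon>\<^sup>2"] using e by (intro mult_mono) auto
        have "\<epsilon> * (B * (c2 * \<epsilon>) * Nv) + \<epsilon>\<^sup>2 * ((B + K\<^sup>2) * (Y + c2) * Nv) = \<epsilon> * \<epsilon> * c3"
          by (simp add: c3_def power2_eq_square algebra_simps)
        then show ?thesis using 1 2 unfolding id by simp
      qed
      have "norm ((\<epsilon> * z (\<epsilon> * R) * v_plus - \<epsilon> * ae' * v_minus) - \<epsilon> * (ae / v_minus) * coupling) \<le> \<epsilon> * \<epsilon> * c3 * measure lborel {-R..R}"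
        by (rule has_integral_bound_real[OF _ _ has_integral_diff[OF wron Ui] bd]) (use c3n e in auto)
      then have "\<bar>\<epsilon> * (z (\<epsilon> * R) * v_plus - ae' * v_minus - ae / v_minus * coupling)\<bar> \<le> \<epsilon> * (c4 * \<epsilon>)"
        using R_pos by (simp add: c4_def algebra_simps)
      then show ?thesis using e by (simp add: abs_mult)
    qed
    have yest: "\<bar>y (\<epsilon> * R) - \<theta> * ae\<bar> \<le> c2 * \<epsilon>"
      using close[of R] R_pos v_right by (simp add: w_def u_def \<theta>_def mult.commute)
    have E_eq: "secular k * (jost k 0 * mirror.jost k 0) = a' * b + coupling / v_minus\<^sup>2 * (a * b) + \<theta>\<^sup>2 * (a * b')"
    proof -
      have "a \<noteq> 0" "b \<noteq> 0" using jost_pos[OF k(1), of 0] mirror.jost_pos[OF k(1), of 0] by (auto simp: a_def b_def)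
      then show ?thesis unfolding secular_def a_def[symmetric] b_def[symmetric] a'_def[symmetric] b'_def[symmetric] \<theta>_def
        using v_nonzero by (simp add: field_simps power2_eq_square)
    qed
    have split: "\<theta> * shot \<epsilon> k - secular k * (jost k 0 * mirror.jost k 0)
       = 1 / v_minus * ((z (\<epsilon> * R) * v_plus - ae' * v_minus - ae / v_minus * coupling) * be)
         + \<theta> * ((y (\<epsilon> * R) - \<theta> * ae) * be')
         + (ae' * be - a' * b) + coupling / v_minus\<^sup>2 * (ae * be - a * b) + \<theta>\<^sup>2 * (ae * be' - a * b')"
      unfolding E_eq shot \<theta>_def using v_nonzero by (simp add: field_simps power2_eq_square)
    have t1: "\<bar>1 / v_minus * ((z (\<epsilon> * R) * v_plus - ae' * v_minus - ae / v_minus * coupling) * be)\<bar> \<le> c4 * J / \<bar>v_minus\<bar> * \<epsilon>"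
    proof -
      have "\<bar>(z (\<epsilon> * R) * v_plus - ae' * v_minus - ae / v_minus * coupling) * be\<bar> \<le> c4 * \<epsilon> * J"
        unfolding abs_mult using zest bnd J by (intro mult_mono) auto
      then have "\<bar>(z (\<epsilon> * R) * v_plus - ae' * v_minus - ae / v_minus * coupling) * be\<bar> / \<bar>v_minus\<bar> \<le> c4 * \<epsilon> * J / \<bar>v_minus\<bar>"
        by (rule divide_right_mono) simp
      then show ?thesis by (simp add: abs_mult mult_ac)
    qed
    have t2: "\<bar>\<theta> * ((y (\<epsilon> * R) - \<theta> * ae) * be')\<bar> \<le> \<bar>\<theta>\<bar> * c2 * J * \<epsilon>"
    proof -
      have "\<bar>(y (\<epsilon> * R) - \<theta> * ae) * be'\<bar> \<le> c2 * \<epsilon> * J"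
        unfolding abs_mult using yest bnd J by (intro mult_mono) auto
      then have "\<bar>\<theta>\<bar> * \<bar>(y (\<epsilon> * R) - \<theta> * ae) * be'\<bar> \<le> \<bar>\<theta>\<bar> * (c2 * \<epsilon> * J)" by (intro mult_left_mono) auto
      then show ?thesis by (simp add: abs_mult mult_ac)
    qed
    have d1: "\<bar>ae' * be - a' * b\<bar> \<le> 2 * J * (\<kappa> * \<epsilon>)" by (rule product_difference_bound[OF lip(2) lip(3) bnd(5) bnd(2)])
    have d2: "\<bar>ae * be - a * b\<bar> \<le> 2 * J * (\<kappa> * \<epsilon>)" by (rule product_difference_bound[OF lip(1) lip(3) bnd(5) bnd(1)])
    have d3: "\<bar>ae * be' - a * b'\<bar> \<le> 2 * J * (\<kappa> * \<epsilon>)" by (rule product_difference_bound[OF lip(1) lip(4) bnd(6) bnd(1)])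
    have t4: "\<bar>coupling / v_minus\<^sup>2 * (ae * be - a * b)\<bar> \<le> \<bar>coupling / v_minus\<^sup>2\<bar> * (2 * J * (\<kappa> * \<epsilon>))"
      unfolding abs_mult[of "coupling / v_minus\<^sup>2"] using d2 by (intro mult_left_mono) auto
    have t5: "\<bar>\<theta>\<^sup>2 * (ae * be' - a * b')\<bar> \<le> \<theta>\<^sup>2 * (2 * J * (\<kappa> * \<epsilon>))"
      unfolding abs_mult[of "\<theta>\<^sup>2"] using d3 by (simp add: mult_left_mono)
    have triangle: "\<bar>p1 + p2 + p3 + p4 + p5\<bar> \<le> q1 + q2 + q3 + q4 + q5"
      if "\<bar>p1\<bar> \<le> q1" "\<bar>p2\<bar> \<le> q2" "\<bar>p3\<bar> \<le> q3" "\<bar>p4\<bar> \<le> q4" "\<bar>p5\<bar> \<le> q5"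
      for p1 p2 p3 p4 p5 q1 q2 q3 q4 q5 :: real
      using that by linarith
    have C_eq: "C * \<epsilon> = c4 * J / \<bar>v_minus\<bar> * \<epsilon> + \<bar>\<theta>\<bar> * c2 * J * \<epsilon> + 2 * J * (\<kappa> * \<epsilon>)
        + \<bar>coupling / v_minus\<^sup>2\<bar> * (2 * J * (\<kappa> * \<epsilon>)) + \<theta>\<^sup>2 * (2 * J * (\<kappa> * \<epsilon>))"
      by (simp add: C_def algebra_simps)
    show ?thesis unfolding split C_eq by (rule triangle[OF t1 t2 d1 t4 t5])
  qed
  show thesis by (rule that[OF C0]) (use main in \<open>simp add: \<theta>_def\<close>)
qed

text \<open>At \<open>k\<^sub>0 \<plusminus> C \<epsilon>\<close> the main term of \<open>shot_asymptotics\<close> is at least \<open>(C\<^sub>1 + 1) \<epsilon>\<close> in modulus, with opposite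
  signs, while the error is at most \<open>C\<^sub>1 \<epsilon>\<close>.\<close>
lemma eigenvalue_near_root:
  assumes k0: "k0 > 0" "secular k0 = 0"
  obtains C \<epsilon>0 where "C \<ge> 0" "0 < \<epsilon>0" "\<epsilon>0 \<le> 1"
    "\<And>\<epsilon>. 0 < \<epsilon> \<Longrightarrow> \<epsilon> < \<epsilon>0 \<Longrightarrow> \<exists>k>0. \<bar>k - k0\<bar> \<le> C * \<epsilon> \<and> k \<le> k0 + 1 \<and> shot \<epsilon> k = 0"
proof -
  define K where "K = k0 + 1"
  have K: "0 \<le> K" using k0 by (simp add: K_def)
  define \<theta> where "\<theta> = v_plus / v_minus"
  have th: "\<theta> \<noteq> 0" using v_nonzero by (simp add: \<theta>_def)
  obtain C1 where C1: "C1 \<ge> 0" "\<And>\<epsilon> k. 0 < \<epsilon> \<Longrightarrow> \<epsilon> \<le> 1 \<Longrightarrow> 0 \<le> k \<Longrightarrow> k \<le> K \<Longrightarrow>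
    \<bar>\<theta> * shot \<epsilon> k - secular k * (jost k 0 * mirror.jost k 0)\<bar> \<le> C1 * \<epsilon>"
    using shot_asymptotics[OF K] unfolding \<theta>_def by metis
  define J where "J = (jost_bound K)\<^sup>2"
  have J: "J > 0" using jost_bound_ge1[OF K] by (simp add: J_def)
  define C where "C = (C1 + 1) * J"
  have C: "C > 0" using C1 J by (simp add: C_def)
  define \<epsilon>0 where "\<epsilon>0 = min 1 (min 1 k0 / (2 * C))"
  have e0: "0 < \<epsilon>0" "\<epsilon>0 \<le> 1" using C k0 by (auto simp: \<epsilon>0_def)
  have ab: "1 \<le> jost k 0 * mirror.jost k 0" if "0 \<le> k" for k
  proof -
    have "1 \<le> jost k 0" "1 \<le> mirror.jost k 0" using jost_lower[OF that, of 0] mirror.jost_lower[OF that, of 0] R_pos by auto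
    then show ?thesis using mult_mono[of 1 "jost k 0" 1 "mirror.jost k 0"] by simp
  qed
  show thesis
  proof (rule that[of C \<epsilon>0])
    fix \<epsilon> assume e: "0 < \<epsilon>" "\<epsilon> < \<epsilon>0"
    have "C * \<epsilon> < min 1 k0"
    proof -
      have "\<epsilon> < min 1 k0 / (2 * C)" using e by (simp add: \<epsilon>0_def)
      then have "\<epsilon> * (2 * C) < min 1 k0" using C by (simp only: pos_less_divide_eq mult_pos_pos zero_less_numeral)
      moreover have "0 < C * \<epsilon>" using C e by simp
      moreover have "\<epsilon> * (2 * C) = 2 * (C * \<epsilon>)" by simp
      ultimately show ?thesis by linarith
    qed
    then have small: "0 < C * \<epsilon>" "C * \<epsilon> < 1" "C * \<epsilon> < k0" using C e by auto
    have e1: "\<epsilon> \<le> 1" using e e0 by simp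
    define l where "l = k0 - C * \<epsilon>"
    define h where "h = k0 + C * \<epsilon>"
    have lh: "0 < l" "l < k0" "k0 < h" "h \<le> K" "l \<le> h" using small by (auto simp: l_def h_def K_def)
    have gap: "C * \<epsilon> / J = (C1 + 1) * \<epsilon>" using J by (simp add: C_def)
    have "(C1 + 1) * \<epsilon> \<le> secular h"
      using secular_mono[of k0 h K] lh k0 gap by (simp add: h_def J_def)
    moreover have "secular h * 1 \<le> secular h * (jost h 0 * mirror.jost h 0)"
    proof (rule mult_left_mono[OF ab])
      have "0 \<le> (C1 + 1) * \<epsilon>" using C1 e by simp
      then show "0 \<le> secular h" using \<open>(C1 + 1) * \<epsilon> \<le> secular h\<close> by linarith
    qed (use lh in simp)
    ultimately have "(C1 + 1) * \<epsilon> \<le> secular h * (jost h 0 * mirror.jost h 0)" by linarith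
    then have up: "0 \<le> \<theta> * shot \<epsilon> h" using C1(2)[OF e(1) e1, of h] lh e by (simp add: algebra_simps)
    have "secular l \<le> - ((C1 + 1) * \<epsilon>)"
      using secular_mono[of l k0 K] lh k0 gap by (simp add: l_def J_def K_def)
    moreover have "secular l * (jost l 0 * mirror.jost l 0) \<le> secular l * 1"
    proof (rule mult_left_mono_neg[OF ab])
      have "0 \<le> (C1 + 1) * \<epsilon>" using C1 e by simp
      then show "secular l \<le> 0" using \<open>secular l \<le> - ((C1 + 1) * \<epsilon>)\<close> by linarith
    qed (use lh in simp)
    ultimately have "secular l * (jost l 0 * mirror.jost l 0) \<le> - ((C1 + 1) * \<epsilon>)" by linarith
    then have lo: "\<theta> * shot \<epsilon> l \<le> 0" using C1(2)[OF e(1) e1, of l] lh e by (simp add: algebra_simps)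
    have "continuous_on {l..h} (\<lambda>k. \<theta> * shot \<epsilon> k)"
    proof -
      have "continuous_on {0..K} (\<lambda>k. \<theta> * shot \<epsilon> k)" by (intro continuous_intros shot_continuous[OF e(1) e1 K])
      then show ?thesis by (rule continuous_on_subset) (use lh in auto)
    qed
    then obtain k where k: "l \<le> k" "k \<le> h" "\<theta> * shot \<epsilon> k = 0"
      using IVT'[of "\<lambda>k. \<theta> * shot \<epsilon> k" l 0 h] lo up lh by auto
    show "\<exists>k>0. \<bar>k - k0\<bar> \<le> C * \<epsilon> \<and> k \<le> k0 + 1 \<and> shot \<epsilon> k = 0"
    proof (intro exI[of _ k] conjI)
      show "0 < k" using k lh by linarith
      show "\<bar>k - k0\<bar> \<le> C * \<epsilon>" using k by (auto simp: l_def h_def)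
      show "k \<le> k0 + 1" using k lh by (simp add: K_def)
      show "shot \<epsilon> k = 0" using k th by simp
    qed
  qed (use C e0 in auto)
qed

end

section \<open>Convergence of the eigenvalue\<close>

lemma AE_rescale:
  fixes \<epsilon> :: real
  assumes "AE x in lebesgue. P x" and e: "\<epsilon> > 0"
  shows "AE x in lebesgue. P (x / \<epsilon>)"
proof -
  obtain N where N: "negligible N" "{x. \<not> P x} \<subseteq> N"
    using assms(1) unfolding eventually_ae_filter_negligible by blast
  have "negligible ((\<lambda>x. \<epsilon> * x) ` N)"
    by (rule negligible_differentiable_image_negligible[OF _ N(1)]) (auto intro!: derivative_intros)
  moreover have "{x. \<not> P (x / \<epsilon>)} \<subseteq> (\<lambda>x. \<epsilon> * x) ` N"
  proof
    fix x assume "x \<in> {x. \<not> P (x / \<epsilon>)}"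
    then have "x / \<epsilon> \<in> N" using N(2) by auto
    moreover have "x = \<epsilon> * (x / \<epsilon>)" using e by simp
    ultimately show "x \<in> (\<lambda>x. \<epsilon> * x) ` N" by blast
  qed
  ultimately show ?thesis unfolding eventually_ae_filter_negligible by blast
qed

lemma AE_reflect:
  assumes "AE x in lebesgue. P (x::real)"
  shows "AE x in lebesgue. P (- x)"
proof -
  obtain N where N: "negligible N" "{x. \<not> P x} \<subseteq> N"
    using assms(1) unfolding eventually_ae_filter_negligible by blast
  have "negligible (uminus ` N)"
    by (rule negligible_differentiable_image_negligible[OF _ N(1)]) (auto intro!: derivative_intros)
  moreover have "{x. \<not> P (- x)} \<subseteq> uminus ` N"
  proof
    fix x assume "x \<in> {x. \<not> P (- x)}"
    then have "- x \<in> N" using N(2) by auto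
    then have "- (- x) \<in> uminus ` N" by (rule imageI)
    then show "x \<in> uminus ` N" by simp
  qed
  ultimately show ?thesis unfolding eventually_ae_filter_negligible by blast
qed

lemma schrodinger_operator_cong_AE:
  assumes "AE x in lebesgue. q x = q' x"
  shows "schrodinger_operator \<Omega> q D = schrodinger_operator \<Omega> q' D"
proof -
  have "(AE x in lebesgue. f x = - h x + complex_of_real (q x) * \<phi> x) \<longleftrightarrow>
        (AE x in lebesgue. f x = - h x + complex_of_real (q' x) * \<phi> x)" for f h \<phi>
  proof
    show "AE x in lebesgue. f x = - h x + complex_of_real (q' x) * \<phi> x"
      if "AE x in lebesgue. f x = - h x + complex_of_real (q x) * \<phi> x"
      using that assms by eventually_elim simp
    show "AE x in lebesgue. f x = - h x + complex_of_real (q x) * \<phi> x"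
      if "AE x in lebesgue. f x = - h x + complex_of_real (q' x) * \<phi> x"
      using that assms by eventually_elim simp
  qed
  then show ?thesis unfolding schrodinger_operator_def by auto
qed

text \<open>A representative of an essentially bounded function that is bounded by \<open>B\<close> and supported in \<open>[- R, R]\<close>
  at every point.\<close>
definition truncate :: "real \<Rightarrow> real \<Rightarrow> (real \<Rightarrow> real) \<Rightarrow> real \<Rightarrow> real" where
  "truncate R B f x = (if \<bar>x\<bar> < R \<and> \<bar>f x\<bar> \<le> B then f x else 0)"

lemma truncate_measurable:
  assumes "f \<in> borel_measurable lebesgue"
  shows "truncate R B f \<in> borel_measurable lebesgue"
proof -
  have "{x \<in> space lebesgue. \<bar>f x\<bar> \<le> B} \<in> sets lebesgue"
    using assms by (intro borel_measurable_le borel_measurable_abs borel_measurable_const)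
  moreover have "{x::real. \<bar>x\<bar> < R} \<in> sets lebesgue"
  proof -
    have "{x::real. \<bar>x\<bar> < R} = {-R<..<R}" by auto
    then show ?thesis by simp
  qed
  ultimately have "{x. \<bar>x\<bar> < R} \<inter> {x \<in> space lebesgue. \<bar>f x\<bar> \<le> B} \<in> sets lebesgue" by blast
  moreover have "{x. \<bar>x\<bar> < R} \<inter> {x \<in> space lebesgue. \<bar>f x\<bar> \<le> B} = {x \<in> space lebesgue. \<bar>x\<bar> < R \<and> \<bar>f x\<bar> \<le> B}" by auto
  ultimately have "{x \<in> space lebesgue. \<bar>x\<bar> < R \<and> \<bar>f x\<bar> \<le> B} \<in> sets lebesgue" by simp
  then show ?thesis unfolding truncate_def[abs_def]
    by (intro measurable_If assms measurable_const) auto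
qed

lemma truncate_properties:
  assumes "0 \<le> B"
  shows "\<bar>truncate R B f x\<bar> \<le> B" "R \<le> \<bar>x\<bar> \<Longrightarrow> truncate R B f x = 0"
  using assms by (auto simp: truncate_def)

lemma compactly_supported_Linf_truncate:
  assumes "compactly_supported_Linf f"
  obtains R0 B0 where "\<And>R B. R0 < R \<Longrightarrow> B0 \<le> B \<Longrightarrow> AE x in lebesgue. f x = truncate R B f x"
proof -
  obtain C r where C: "AE x in lebesgue. \<bar>f x\<bar> \<le> C" and r: "AE x in lebesgue. \<bar>x\<bar> > r \<longrightarrow> f x = 0"
    using assms by (auto simp: compactly_supported_Linf_def)
  show thesis
  proof (rule that)
    fix R B assume "r < R" "C \<le> B"
    show "AE x in lebesgue. f x = truncate R B f x"
      using C r by eventually_elim (use \<open>r < R\<close> \<open>C \<le> B\<close> in \<open>auto simp: truncate_def\<close>)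
  qed
qed

lemma LINT_eq_integral:
  fixes f g :: "real \<Rightarrow> real"
  assumes m: "f \<in> borel_measurable lebesgue" "g \<in> borel_measurable lebesgue"
    and b: "\<And>x. x \<in> {a..b} \<Longrightarrow> \<bar>g x\<bar> \<le> M" and ae: "AE x in lebesgue. f x = indicator {a..b} x * g x"
  shows "(LINT x|lebesgue. f x) = integral {a..b} g"
proof -
  have "set_integrable lebesgue {a..b} g"
  proof (rule measurable_bounded_by_integrable_imp_absolutely_integrable)
    show "g \<in> borel_measurable (lebesgue_on {a..b})" using m(2) by (simp add: measurable_restrict_space1)
    show "(\<lambda>_. M) integrable_on {a..b}" by auto
  qed (use b in auto)
  then have "(LINT x:{a..b}|lebesgue. g x) = integral {a..b} g"
    by (rule set_lebesgue_integral_eq_integral(2))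
  moreover have "(LINT x|lebesgue. f x) = (LINT x|lebesgue. indicator {a..b} x *\<^sub>R g x)"
  proof (rule integral_cong_AE[OF m(1)])
    show "(\<lambda>x. indicator {a..b} x *\<^sub>R g x) \<in> borel_measurable lebesgue"
      by (rule borel_measurable_scaleR[OF borel_measurable_indicator m(2)]) simp
  qed (use ae in simp)
  ultimately show ?thesis by (simp add: set_lebesgue_integral_def)
qed

context barrier
begin

lemma jost_free:
  assumes W0: "\<And>x. W x = 0" and k: "0 \<le> k"
  shows "jost' k 0 / jost k 0 = k"
proof -
  have "jost k 0 = exp (k * (0 - - R)) \<and> jost' k 0 = k * exp (k * (0 - - R))"
    by (rule solution_unique[OF jost_solves exp_solves, where a="-R" and b=0])
      (use pot_bound jost_init W0 R_pos in auto)
  then show ?thesis by simp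
qed

end

context resonance
begin

text \<open>Without a potential the Jost solutions are exponentials, and the equation \<open>secular k = 0\<close> is linear
  in \<open>k\<close>.\<close>
lemma secular_root_free:
  assumes W0: "\<And>x. W x = 0" and k: "0 < k" "secular k = 0"
  shows "k = - coupling / (v_minus\<^sup>2 + v_plus\<^sup>2)"
proof -
  have "k + (v_plus / v_minus)\<^sup>2 * k + v_plus / v_minus * (1 / (v_minus * v_plus) * coupling) = 0"
    using k(2) unfolding secular_def jost_free[OF W0 less_imp_le[OF k(1)]] mirror.jost_free[OF W0 less_imp_le[OF k(1)]] .
  then have "k * (v_minus\<^sup>2 + v_plus\<^sup>2) + coupling = 0"
    using v_nonzero by (simp add: field_simps power2_eq_square)
  then have "k * (v_minus\<^sup>2 + v_plus\<^sup>2) = - coupling" by simp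
  moreover have "v_minus\<^sup>2 + v_plus\<^sup>2 \<noteq> 0" using v_nonzero by (simp add: sum_power2_eq_zero_iff)
  ultimately show ?thesis using nonzero_eq_divide_eq by blast
qed

theorem resonance_eigenvalues:
  assumes neg: "v_minus\<^sup>2 * integral {-R..0} W + v_plus\<^sup>2 * integral {0..R} W + coupling < 0"
  obtains k0 \<epsilon>0 kf C where "k0 > 0" "secular k0 = 0"
    "\<And>\<mu>. negative_eigenvalue (H_interface W (v_plus / v_minus) (1 / (v_minus * v_plus) * coupling)) \<mu> \<longleftrightarrow> \<mu> = - (k0\<^sup>2)"
    "0 < \<epsilon>0" "\<And>\<epsilon>. 0 < \<epsilon> \<Longrightarrow> \<epsilon> < \<epsilon>0 \<Longrightarrow>
       negative_eigenvalue (schrodinger_operator UNIV (scaled_potential \<epsilon>) (sobolev_2_2 UNIV)) (- ((kf \<epsilon>)\<^sup>2))"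
    "\<And>\<epsilon>. 0 < \<epsilon> \<Longrightarrow> \<epsilon> < \<epsilon>0 \<Longrightarrow> \<bar>- ((kf \<epsilon>)\<^sup>2) - - (k0\<^sup>2)\<bar> \<le> C * \<epsilon>"
proof -
  have "integral {-R..0} W + (v_plus / v_minus)\<^sup>2 * integral {0..R} W + v_plus / v_minus * (1 / (v_minus * v_plus) * coupling)
      = (v_minus\<^sup>2 * integral {-R..0} W + v_plus\<^sup>2 * integral {0..R} W + coupling) / v_minus\<^sup>2"
    using v_nonzero by (simp add: field_simps power2_eq_square)
  also have "\<dots> < 0" using neg v_nonzero by (simp add: divide_neg_pos)
  finally obtain k0 where k0: "k0 > 0" "secular k0 = 0" "\<And>l. l > 0 \<Longrightarrow> secular l = 0 \<Longrightarrow> l = k0"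
    using secular_root by metis
  obtain C \<epsilon>0 where C: "C \<ge> 0" "0 < \<epsilon>0" "\<epsilon>0 \<le> 1"
    "\<And>\<epsilon>. 0 < \<epsilon> \<Longrightarrow> \<epsilon> < \<epsilon>0 \<Longrightarrow> \<exists>k>0. \<bar>k - k0\<bar> \<le> C * \<epsilon> \<and> k \<le> k0 + 1 \<and> shot \<epsilon> k = 0"
    using eigenvalue_near_root[OF k0(1,2)] by metis
  then have "\<forall>\<epsilon>. \<exists>k. 0 < \<epsilon> \<and> \<epsilon> < \<epsilon>0 \<longrightarrow> k > 0 \<and> \<bar>k - k0\<bar> \<le> C * \<epsilon> \<and> k \<le> k0 + 1 \<and> shot \<epsilon> k = 0" by blast
  then obtain kf where kf: "\<And>\<epsilon>. 0 < \<epsilon> \<Longrightarrow> \<epsilon> < \<epsilon>0 \<Longrightarrow> kf \<epsilon> > 0 \<and> \<bar>kf \<epsilon> - k0\<bar> \<le> C * \<epsilon> \<and> kf \<epsilon> \<le> k0 + 1 \<and> shot \<epsilon> (kf \<epsilon>) = 0"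
    by metis
  show thesis
  proof (rule that[OF k0(1,2) _ C(2), of kf "C * (2 * k0 + 1)"])
    fix \<mu>
    show "negative_eigenvalue (H_interface W (v_plus / v_minus) (1 / (v_minus * v_plus) * coupling)) \<mu> \<longleftrightarrow> \<mu> = - (k0\<^sup>2)"
      unfolding interface_eigenvalue_iff using k0 by metis
  next
    fix \<epsilon> assume e: "0 < \<epsilon>" "\<epsilon> < \<epsilon>0"
    show "negative_eigenvalue (schrodinger_operator UNIV (scaled_potential \<epsilon>) (sobolev_2_2 UNIV)) (- ((kf \<epsilon>)\<^sup>2))"
      by (rule shot_eigenvalue) (use kf[OF e] e C(3) in auto)
    have "\<bar>kf \<epsilon> - k0\<bar> * \<bar>kf \<epsilon> + k0\<bar> \<le> (C * \<epsilon>) * (2 * k0 + 1)"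
      using kf[OF e] k0(1) by (intro mult_mono) auto
    moreover have "- ((kf \<epsilon>)\<^sup>2) - - (k0\<^sup>2) = - ((kf \<epsilon> - k0) * (kf \<epsilon> + k0))"
      by (simp add: algebra_simps power2_eq_square)
    ultimately show "\<bar>- ((kf \<epsilon>)\<^sup>2) - - (k0\<^sup>2)\<bar> \<le> C * (2 * k0 + 1) * \<epsilon>"
      by (simp add: abs_mult mult_ac)
  qed
qed

end

theorem theorem5:
  fixes U V W v :: "real \<Rightarrow> real" and v_minus v_plus :: real
  assumes "compactly_supported_Linf U"
    and "compactly_supported_Linf V"
    and "compactly_supported_Linf W"
    and "resonant V"
    and "half_bound_state V v"
    and "(v \<longlongrightarrow> v_minus) at_bot"
    and "(v \<longlongrightarrow> v_plus) at_top"
    and "AE x in lebesgue. W x \<ge> 0"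
    and "(LINT x:{0<..}|lebesgue. v_minus\<^sup>2 * W (- x) + v_plus\<^sup>2 * W x)
           < - (1 / 2) * (LINT x|lebesgue. U x * (v x)\<^sup>2)"
  shows "\<exists>\<mu>\<^sub>0 \<Lambda>.
     (let \<theta> = v_plus / v_minus;
          \<eta> = 1 / (v_minus * v_plus) * (LINT x|lebesgue. U x * (v x)\<^sup>2)
      in \<forall>\<mu>. negative_eigenvalue (H_interface W \<theta> \<eta>) \<mu> \<longleftrightarrow> \<mu> = \<mu>\<^sub>0) \<and>
     (\<forall>\<^sub>F \<epsilon> in at_right 0. negative_eigenvalue (H_eps U V W \<epsilon>) (\<Lambda> \<epsilon>)) \<and>
     (\<Lambda> \<longlongrightarrow> \<mu>\<^sub>0) (at_right 0) \<and>
     ((AE x in lebesgue. W x = 0) \<and> (LINT x|lebesgue. U x * (v x)\<^sup>2) < 0 \<longrightarrow>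
        (\<lambda>\<epsilon>. \<Lambda> \<epsilon> - (- (1 / (v_minus\<^sup>2 + v_plus\<^sup>2)\<^sup>2) * (LINT x|lebesgue. U x * (v x)\<^sup>2)\<^sup>2))
          \<in> O[at_right 0](\<lambda>\<epsilon>. \<epsilon>))"
proof -
  have meas: "U \<in> borel_measurable lebesgue" "V \<in> borel_measurable lebesgue" "W \<in> borel_measurable lebesgue"
    using assms(1-3) by (auto simp: compactly_supported_Linf_def)
  obtain RU BU where U0: "\<And>R B. RU < R \<Longrightarrow> BU \<le> B \<Longrightarrow> AE x in lebesgue. U x = truncate R B U x"
    using compactly_supported_Linf_truncate[OF assms(1)] by metis
  obtain RV BV where V0: "\<And>R B. RV < R \<Longrightarrow> BV \<le> B \<Longrightarrow> AE x in lebesgue. V x = truncate R B V x"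
    using compactly_supported_Linf_truncate[OF assms(2)] by metis
  obtain RW BW where W0: "\<And>R B. RW < R \<Longrightarrow> BW \<le> B \<Longrightarrow> AE x in lebesgue. W x = truncate R B W x"
    using compactly_supported_Linf_truncate[OF assms(3)] by metis
  \<comment> \<open>strictly larger than all three radii, so that the truncations vanish at \<open>\<plusminus>R\<close> as well\<close>
  define R where "R = max 0 (max RU (max RV RW)) + 1"
  define B where "B = max 0 (max BU (max BV BW))"
  have R: "R > 0" "RU < R" "RV < R" "RW < R" by (auto simp: R_def)
  have B: "0 \<le> B" "BU \<le> B" "BV \<le> B" "BW \<le> B" by (auto simp: B_def)
  define Uc where "Uc = truncate R B U"
  define Vc where "Vc = truncate R B V"
  \<comment> \<open>if \<open>W\<close> vanishes almost everywhere, it is replaced by zero, so that the logarithmic derivatives are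
    exactly \<open>k\<close>\<close>
  define Wc where "Wc x = (if (AE x in lebesgue. W x = 0) then 0 else max 0 (truncate R B W x))" for x
  have U: "AE x in lebesgue. U x = Uc x" and V: "AE x in lebesgue. V x = Vc x"
    unfolding Uc_def Vc_def using U0 V0 R B by auto
  have W: "AE x in lebesgue. W x = Wc x"
  proof (cases "AE x in lebesgue. W x = 0")
    case True then show ?thesis by (simp add: Wc_def)
  next
    case False
    have "AE x in lebesgue. W x = max 0 (truncate R B W x)"
      using W0[OF R(4) B(4)] assms(8) by eventually_elim simp
    then show ?thesis using False by (simp add: Wc_def)
  qed
  have mc: "Uc \<in> borel_measurable lebesgue" "Vc \<in> borel_measurable lebesgue" "Wc \<in> borel_measurable lebesgue"
  proof -
    show "Uc \<in> borel_measurable lebesgue" "Vc \<in> borel_measurable lebesgue"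
      unfolding Uc_def Vc_def by (intro truncate_measurable meas)+
    have "(\<lambda>x. max 0 (truncate R B W x)) \<in> borel_measurable lebesgue"
      by (intro borel_measurable_max borel_measurable_const truncate_measurable meas)
    then show "Wc \<in> borel_measurable lebesgue" unfolding Wc_def[abs_def] by (cases "AE x in lebesgue. W x = 0") auto
  qed
  have vc: "continuous_on UNIV v" and vb: "bounded (range v)" and v_ne: "\<exists>x. v x \<noteq> 0"
    using assms(5) by (auto simp: half_bound_state_def)
  have vm: "v \<in> borel_measurable lebesgue" by (rule continuous_lebesgue_measurable[OF vc])
  have "half_bound_state Vc v"
  proof -
    obtain g where g: "weak_derivative_on UNIV v g" "weak_derivative_on UNIV g (\<lambda>x. V x * v x)"
      using assms(5) by (auto simp: half_bound_state_def)
    have "AE x in lebesgue. V x * v x = Vc x * v x" using V by eventually_elim simp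
    from weak_derivative_on_cong_right[OF g(2) this borel_measurable_times[OF meas(2) vm] borel_measurable_times[OF mc(2) vm]]
    show ?thesis using g(1) vc vb v_ne unfolding half_bound_state_def by blast
  qed
  then obtain v' where v': "solves_on UNIV Vc v v'"
    using half_bound_state_solves[OF mc(2), of B v] truncate_properties(1)[OF B(1)] unfolding Vc_def by metis
  have Vz: "Vc x = 0" if "R \<le> \<bar>x\<bar>" for x unfolding Vc_def by (rule truncate_properties(2)[OF B(1) that])
  have Vb: "\<bar>Vc x\<bar> \<le> B" for x unfolding Vc_def by (rule truncate_properties(1)[OF B(1)])
  have right: "v R = v_plus \<and> v' R = 0"
    by (rule bounded_solution_const_right[OF v' _ vb assms(7), of R]) (use Vz in auto)
  have left: "v (- R) = v_minus \<and> v' (- R) = 0"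
    by (rule bounded_solution_const_left[OF v' _ vb assms(6), of R]) (use Vz in auto)
  have nz: "v_minus \<noteq> 0" "v_plus \<noteq> 0"
    using zero_solution[OF v' Vb, of "- R"] zero_solution[OF v' Vb, of R] left right v_ne by auto
  interpret resonance Wc R B Uc Vc v v' v_minus v_plus
  proof
    show "\<bar>Wc x\<bar> \<le> B" for x
      using truncate_properties(1)[OF B(1), of R W x] B(1) by (auto simp: Wc_def)
    show "Wc x = 0" if "R \<le> \<bar>x\<bar>" for x
      using truncate_properties(2)[OF B(1) that, of W] by (auto simp: Wc_def)
    show "0 \<le> Wc x" for x by (simp add: Wc_def)
    show "\<bar>Uc x\<bar> \<le> B" for x unfolding Uc_def by (rule truncate_properties(1)[OF B(1)])
    show "Uc x = 0" if "R \<le> \<bar>x\<bar>" for x unfolding Uc_def by (rule truncate_properties(2)[OF B(1) that])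
  qed (use mc R Vb Vz v' left right nz in auto)
  obtain Nv where Nv: "Nv \<ge> 0" "\<And>x. \<bar>v x\<bar> \<le> Nv"
  proof -
    obtain a where "\<forall>x\<in>range v. norm x \<le> a" using vb unfolding bounded_iff by blast
    then have "\<bar>v x\<bar> \<le> a" for x by simp
    moreover from this[of 0] have "a \<ge> 0" by simp
    ultimately show ?thesis using that by blast
  qed
  have coup: "(LINT x|lebesgue. U x * (v x)\<^sup>2) = coupling"
    unfolding coupling_def
  proof (rule LINT_eq_integral)
    have v2: "(\<lambda>x. (v x)\<^sup>2) \<in> borel_measurable lebesgue" by (rule borel_measurable_power[OF vm])
    show "(\<lambda>x. U x * (v x)\<^sup>2) \<in> borel_measurable lebesgue" "(\<lambda>x. Uc x * (v x)\<^sup>2) \<in> borel_measurable lebesgue"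
      by (rule borel_measurable_times[OF meas(1) v2], rule borel_measurable_times[OF mc(1) v2])
    show "\<bar>Uc x * (v x)\<^sup>2\<bar> \<le> B * Nv\<^sup>2" for x
      using U_bound[of x] power_mono[OF Nv(2)[of x], of 2] B(1) by (auto simp: abs_mult intro!: mult_mono)
    show "AE x in lebesgue. U x * (v x)\<^sup>2 = indicator {- R..R} x * (Uc x * (v x)\<^sup>2)"
      using U
    proof eventually_elim
      case (elim x)
      then show ?case using U_supp[of x] by (cases "x \<in> {-R..R}") auto
    qed
  qed
  have Wi: "integral {0..R} (\<lambda>x. v_minus\<^sup>2 * Wc (- x) + v_plus\<^sup>2 * Wc x)
     = v_minus\<^sup>2 * integral {-R..0} Wc + v_plus\<^sup>2 * integral {0..R} Wc"
  proof -
    have i: "Wc integrable_on {a..b}" "(\<lambda>x. Wc (- x)) integrable_on {a..b}" for a b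
      by (rule bounded_measurable_integrable[OF W_meas W_bound], rule bounded_measurable_integrable[OF mirror.W_meas mirror.W_bound])
    have "integral {0..R} (\<lambda>x. Wc (- x)) = integral {-R..0} Wc"
      using Henstock_Kurzweil_Integration.integral_reflect_real[of 0 "-R" Wc] by simp
    then show ?thesis using i by (subst integral_add) (auto intro!: integrable_on_mult_right)
  qed
  have Wint: "(LINT x:{0<..}|lebesgue. v_minus\<^sup>2 * W (- x) + v_plus\<^sup>2 * W x)
     = v_minus\<^sup>2 * integral {-R..0} Wc + v_plus\<^sup>2 * integral {0..R} Wc"
    unfolding set_lebesgue_integral_def Wi[symmetric]
  proof (rule LINT_eq_integral)
    have mr: "(\<lambda>x. W (- x)) \<in> borel_measurable lebesgue"
      using measurable_affine_lebesgue[OF meas(3), of "-1" 0] by simp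
    have m1: "(\<lambda>x. v_minus\<^sup>2 * W (- x) + v_plus\<^sup>2 * W x) \<in> borel_measurable lebesgue"
      by (rule borel_measurable_add[OF borel_measurable_times[OF borel_measurable_const mr] borel_measurable_times[OF borel_measurable_const meas(3)]])
    show "(\<lambda>x. indicator {0<..} x *\<^sub>R (v_minus\<^sup>2 * W (- x) + v_plus\<^sup>2 * W x)) \<in> borel_measurable lebesgue"
      by (rule borel_measurable_scaleR[OF borel_measurable_indicator m1]) simp
    show "(\<lambda>x. v_minus\<^sup>2 * Wc (- x) + v_plus\<^sup>2 * Wc x) \<in> borel_measurable lebesgue"
      by (rule borel_measurable_add[OF borel_measurable_times[OF borel_measurable_const mirror.W_meas] borel_measurable_times[OF borel_measurable_const W_meas]])
    show "\<bar>v_minus\<^sup>2 * Wc (- x) + v_plus\<^sup>2 * Wc x\<bar> \<le> v_minus\<^sup>2 * B + v_plus\<^sup>2 * B" for x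
    proof -
      have "\<bar>v_minus\<^sup>2 * Wc (- x)\<bar> \<le> v_minus\<^sup>2 * B" "\<bar>v_plus\<^sup>2 * Wc x\<bar> \<le> v_plus\<^sup>2 * B"
        using W_bound by (auto simp: abs_mult intro!: mult_left_mono)
      then show ?thesis by linarith
    qed
    show "AE x in lebesgue. indicator {0<..} x *\<^sub>R (v_minus\<^sup>2 * W (- x) + v_plus\<^sup>2 * W x)
       = indicator {0..R} x * (v_minus\<^sup>2 * Wc (- x) + v_plus\<^sup>2 * Wc x)"
      using W AE_reflect[OF W] AE_nonzero
    proof eventually_elim
      case (elim x)
      then show ?case using W_supp[of x] W_supp[of "- x"]
        by (cases "0 < x"; cases "x \<le> R") (auto simp: indicator_def)
    qed
  qed
  have nonneg: "0 \<le> v_minus\<^sup>2 * integral {-R..0} Wc + v_plus\<^sup>2 * integral {0..R} Wc"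
  proof -
    have "0 \<le> integral {a..b} Wc" for a b
      by (rule integral_nonneg[OF bounded_measurable_integrable[OF W_meas W_bound]]) (rule W_nonneg)
    then show ?thesis by (intro add_nonneg_nonneg mult_nonneg_nonneg) auto
  qed
  have hyp: "v_minus\<^sup>2 * integral {-R..0} Wc + v_plus\<^sup>2 * integral {0..R} Wc < - (1 / 2) * coupling"
    using assms(9) unfolding Wint coup .
  have neg: "v_minus\<^sup>2 * integral {-R..0} Wc + v_plus\<^sup>2 * integral {0..R} Wc + coupling < 0"
    using hyp nonneg by linarith
  obtain k0 \<epsilon>0 kf C where k0: "k0 > 0" "secular k0 = 0"
    and iff: "\<And>\<mu>. negative_eigenvalue (H_interface Wc (v_plus / v_minus) (1 / (v_minus * v_plus) * coupling)) \<mu> \<longleftrightarrow> \<mu> = - (k0\<^sup>2)"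
    and e0: "0 < \<epsilon>0" and ev: "\<And>\<epsilon>. 0 < \<epsilon> \<Longrightarrow> \<epsilon> < \<epsilon>0 \<Longrightarrow>
       negative_eigenvalue (schrodinger_operator UNIV (scaled_potential \<epsilon>) (sobolev_2_2 UNIV)) (- ((kf \<epsilon>)\<^sup>2))"
    and cl: "\<And>\<epsilon>. 0 < \<epsilon> \<Longrightarrow> \<epsilon> < \<epsilon>0 \<Longrightarrow> \<bar>- ((kf \<epsilon>)\<^sup>2) - - (k0\<^sup>2)\<bar> \<le> C * \<epsilon>"
    apply (rule resonance_eigenvalues[OF neg])
    subgoal premises p for k0 \<epsilon>0 kf C by (rule p(1)[OF p(2-7)])
    done
  have Heps: "H_eps U V W \<epsilon> = schrodinger_operator UNIV (scaled_potential \<epsilon>) (sobolev_2_2 UNIV)" if e: "\<epsilon> > 0" for \<epsilon>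
    unfolding H_eps_def
  proof (rule schrodinger_operator_cong_AE)
    show "AE x in lebesgue. W x + U (x / \<epsilon>) / \<epsilon> + V (x / \<epsilon>) / \<epsilon>\<^sup>2 = scaled_potential \<epsilon> x"
      using W AE_rescale[OF U e] AE_rescale[OF V e] by eventually_elim (simp add: scaled_potential_def)
  qed
  have Hint: "H_interface W \<theta> \<eta> = H_interface Wc \<theta> \<eta>" for \<theta> \<eta>
    unfolding H_interface_def by (rule schrodinger_operator_cong_AE[OF W])
  have near: "\<forall>\<^sub>F \<epsilon> in at_right 0. 0 < \<epsilon> \<and> \<epsilon> < \<epsilon>0"
    using e0 by (auto simp: eventually_at_right_field)
  have rate: "\<forall>\<^sub>F \<epsilon> in at_right 0. \<bar>- ((kf \<epsilon>)\<^sup>2) - - (k0\<^sup>2)\<bar> \<le> C * \<epsilon>"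
    using near by eventually_elim (simp only: cl)
  have big: "(\<lambda>\<epsilon>. - ((kf \<epsilon>)\<^sup>2) - - (k0\<^sup>2)) \<in> O[at_right 0](\<lambda>\<epsilon>. \<epsilon>)"
  proof (rule bigoI)
    show "\<forall>\<^sub>F \<epsilon> in at_right 0. norm (- ((kf \<epsilon>)\<^sup>2) - - (k0\<^sup>2)) \<le> C * norm \<epsilon>"
      using near rate by eventually_elim simp
  qed
  show ?thesis
  proof (intro exI conjI)
    show "let \<theta> = v_plus / v_minus;
          \<eta> = 1 / (v_minus * v_plus) * (LINT x|lebesgue. U x * (v x)\<^sup>2)
      in \<forall>\<mu>. negative_eigenvalue (H_interface W \<theta> \<eta>) \<mu> \<longleftrightarrow> \<mu> = - (k0\<^sup>2)"
      unfolding Let_def coup Hint using iff by blast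
    show "\<forall>\<^sub>F \<epsilon> in at_right 0. negative_eigenvalue (H_eps U V W \<epsilon>) (- ((kf \<epsilon>)\<^sup>2))"
      using near
    proof eventually_elim
      case (elim \<epsilon>)
      then show ?case using Heps[of \<epsilon>] ev[of \<epsilon>] by simp
    qed
    show "((\<lambda>\<epsilon>. - ((kf \<epsilon>)\<^sup>2)) \<longlongrightarrow> - (k0\<^sup>2)) (at_right 0)"
    proof (rule Lim_null[THEN iffD2], rule Lim_null_comparison)
      show "\<forall>\<^sub>F \<epsilon> in at_right 0. norm (- ((kf \<epsilon>)\<^sup>2) - - (k0\<^sup>2)) \<le> C * \<epsilon>" using rate by simp
      show "((\<lambda>\<epsilon>. C * \<epsilon>) \<longlongrightarrow> 0) (at_right 0)" by (auto intro!: tendsto_eq_intros)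
    qed
    show "(AE x in lebesgue. W x = 0) \<and> (LINT x|lebesgue. U x * (v x)\<^sup>2) < 0 \<longrightarrow>
        (\<lambda>\<epsilon>. - ((kf \<epsilon>)\<^sup>2) - (- (1 / (v_minus\<^sup>2 + v_plus\<^sup>2)\<^sup>2) * (LINT x|lebesgue. U x * (v x)\<^sup>2)\<^sup>2))
          \<in> O[at_right 0](\<lambda>\<epsilon>. \<epsilon>)"
    proof
      assume "(AE x in lebesgue. W x = 0) \<and> (LINT x|lebesgue. U x * (v x)\<^sup>2) < 0"
      then have "Wc x = 0" for x by (simp add: Wc_def)
      then have "k0 = - coupling / (v_minus\<^sup>2 + v_plus\<^sup>2)" by (rule secular_root_free[OF _ k0])
      then have "- (k0\<^sup>2) = - (1 / (v_minus\<^sup>2 + v_plus\<^sup>2)\<^sup>2) * coupling\<^sup>2"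
        by (simp add: power_divide)
      then show "(\<lambda>\<epsilon>. - ((kf \<epsilon>)\<^sup>2) - (- (1 / (v_minus\<^sup>2 + v_plus\<^sup>2)\<^sup>2) * (LINT x|lebesgue. U x * (v x)\<^sup>2)\<^sup>2))
          \<in> O[at_right 0](\<lambda>\<epsilon>. \<epsilon>)"
        using big unfolding coup by simp
    qed
  qed
qed

end
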